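(* For $j=1,2$ let $0<\ell_j\le\infty$, let $q_j\in L^1_{\mathrm{loc}}([0,\ell_j))$ be real-valued, let $h_j\in\mathbb R$, and consider the Sturm-Liouville problem $$-y''(x)+q_j(x)y(x)-zy(x)=0,\quad x\in[0,\ell_j),\ z\in\mathbb C,\qquad y'(0)-h_j\,y(0)=0 .$$ Let $\Phi_j$ be a transfer function of the $j$-th problem on $[0,2\ell_j)$, that is, $\Phi_j=\Phi_{\tau_j}$ on $[0,2\ell_j)$ for a spectral measure $\tau_j$ of the $j$-th problem. If, for some $a$ with $0<a\le\min\{\ell_1,\ell_2\}$, $$\Phi_1(t)=\Phi_2(t)\quad\text{for all } t\in[0,2a),$$ then $q_1=q_2$ a.e. on $[0,a)$ and $h_1=h_2$.
   Context: Let $0<\ell\le\infty$, $q\in L^1_{\mathrm{loc}}([0,\ell))$ real-valued (locally integrable on $[0,\ell)$, in particular integrable near $0$), and $h\in\mathbb R$. Consider the problem $$-y''+qy-zy=0 \text{ on } [0,\ell),\quad z\in\mathbb C,\qquad y'(0)-hy(0)=0. \qquad ( * )$$ Write $h=\cot\alpha$ with $0<\alpha<\pi$, and let $\varphi(\cdot;z)$ be the solution of the differential equation in $( * )$ with $\varphi(0;z)=\sin\alpha$, $\varphi'(0;z)=\cos\alpha$. Spectral measures. Let $\mathcal L_0$ be the set of all $f\in L^2(0,\ell)$ which vanish identically near $\ell$. For $y\in\mathcal L_0$ put $\mathcal F(y;\lambda):=\int_0^\ell y(x)\varphi(x;\lambda)\,dx$, $\lambda\in\mathbb R$. A (nonnegative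 Borel) measure $\tau$ on $\mathbb R$ is called a spectral measure of problem $( * )$ if $$\int_0^\ell|y(x)|^2dx=\int_{\mathbb R}|\mathcal F(y;\lambda)|^2d\tau(\lambda)\quad\text{for all } y\in\mathcal L_0 .$$ A problem may have one or infinitely many spectral measures. Transfer functions. For a spectral measure $\tau$ of $( * )$ the corresponding transfer function is $$\Phi_\tau(t):=\int_{\mathbb R}\frac{1-\cos(\sqrt\lambda\,t)}{\lambda}\,d\tau(\lambda),\quad t\in[0,2\ell),$$ where the integrand is understood as an entire function of $\lambda$ (so it equals $t^2/2$ at $\lambda=0$, and $\cos(\sqrt\lambda\,t)=\cosh(\sqrt{|\lambda|}\,t)$ for $\lambda<0$). The integral exists for all $t\in[0,2\ell)$, and on $[0,2\ell)$ its value does not depend on the choice of the spectral measure $\tau$ of $( * )$. *)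

theory Defs
  imports "HOL-Analysis.Analysis"
begin

(* The interval [0,l), where l may be infinite. *)
definition half_open :: "ereal \<Rightarrow> real set" where
  "half_open l = {x. 0 \<le> x \<and> ereal x < l}"

(* q is locally integrable on [0,l): the integrability is up to and including the end point 0. *)
definition locally_integrable :: "ereal \<Rightarrow> (real \<Rightarrow> real) \<Rightarrow> bool" where
  "locally_integrable l q \<longleftrightarrow> (\<forall>b\<in>half_open l. q absolutely_integrable_on {0..b})"

(* The epsilon-delta definition of absolute continuity, for functions of a real variable.
   D ranges over the finite families of nonoverlapping compact intervals contained in S
   (degenerate intervals, which are allowed, contribute 0 to both sums). *)
definition abs_continuous_on :: "real set \<Rightarrow> (real \<Rightarrow> 'a::real_normed_vector) \<Rightarrow> bool" where
  "abs_continuous_on S f \<longleftrightarrow>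
    (\<forall>\<epsilon>>0. \<exists>\<delta>>0. \<forall>D. D division_of \<Union>D \<and> \<Union>D \<subseteq> S \<and> (\<Sum>K\<in>D. Sup K - Inf K) < \<delta> \<longrightarrow>
       (\<Sum>K\<in>D. norm (f (Sup K) - f (Inf K))) < \<epsilon>)"

definition locally_abs_continuous :: "ereal \<Rightarrow> (real \<Rightarrow> 'a::real_normed_vector) \<Rightarrow> bool" where
  "locally_abs_continuous l f \<longleftrightarrow> (\<forall>b\<in>half_open l. abs_continuous_on {0..b} f)"

(* y solves -y'' + q y - z y = 0 on [0,l) in the sense appropriate for locally integrable q:
   y is differentiable (one-sidedly at 0) with derivative dy, both are locally absolutely
   continuous, and the equation holds almost everywhere. *)
definition sl_solution ::
  "ereal \<Rightarrow> (real \<Rightarrow> real) \<Rightarrow> complex \<Rightarrow> (real \<Rightarrow> complex) \<Rightarrow> (real \<Rightarrow> complex) \<Rightarrow> bool" where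
  "sl_solution l q z y dy \<longleftrightarrow>
    (\<forall>x\<in>half_open l. (y has_vector_derivative dy x) (at x within half_open l)) \<and>
    locally_abs_continuous l y \<and> locally_abs_continuous l dy \<and>
    (AE x in lebesgue. x \<in> half_open l \<longrightarrow>
       dy differentiable (at x) \<and>
       - vector_derivative dy (at x) + complex_of_real (q x) * y x - z * y x = 0)"

(* \<phi> x z is the solution with initial values sin \<alpha> and cos \<alpha>, where h = cot \<alpha>;
   \<alpha> is determined by h, and \<phi> is determined for x in [0,l). *)
definition fundamental_solution ::
  "ereal \<Rightarrow> (real \<Rightarrow> real) \<Rightarrow> real \<Rightarrow> (real \<Rightarrow> complex \<Rightarrow> complex) \<Rightarrow> bool" where
  "fundamental_solution l q h \<phi> \<longleftrightarrow>
    (\<exists>\<alpha>. 0 < \<alpha> \<and> \<alpha> < pi \<and> h = cot \<alpha> \<and>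
      (\<forall>z. \<exists>d\<phi>. sl_solution l q z (\<lambda>x. \<phi> x z) d\<phi> \<and>
         \<phi> 0 z = complex_of_real (sin \<alpha>) \<and> d\<phi> 0 = complex_of_real (cos \<alpha>)))"

definition L2_vanishing_near :: "ereal \<Rightarrow> (real \<Rightarrow> complex) set" where
  "L2_vanishing_near l = {y.
     set_borel_measurable lebesgue (half_open l) y \<and>
     (\<integral>\<^sup>+x\<in>half_open l. ennreal ((cmod (y x))\<^sup>2) \<partial>lebesgue) < \<infinity> \<and>
     (\<exists>c\<in>half_open l. AE x in lebesgue. x \<in> half_open l \<and> c < x \<longrightarrow> y x = 0)}"

definition sl_transform ::
  "ereal \<Rightarrow> (real \<Rightarrow> complex \<Rightarrow> complex) \<Rightarrow> (real \<Rightarrow> complex) \<Rightarrow> real \<Rightarrow> complex" where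
  "sl_transform l \<phi> y \<mu> = (LINT x:half_open l|lebesgue. y x * \<phi> x (complex_of_real \<mu>))"

definition spectral_measure ::
  "ereal \<Rightarrow> (real \<Rightarrow> real) \<Rightarrow> real \<Rightarrow> real measure \<Rightarrow> bool" where
  "spectral_measure l q h \<tau> \<longleftrightarrow>
    sets \<tau> = sets borel \<and>
    (\<exists>\<phi>. fundamental_solution l q h \<phi> \<and>
      (\<forall>y\<in>L2_vanishing_near l.
        (\<integral>\<^sup>+x\<in>half_open l. ennreal ((cmod (y x))\<^sup>2) \<partial>lebesgue) =
        (\<integral>\<^sup>+\<mu>. ennreal ((cmod (sl_transform l \<phi> y \<mu>))\<^sup>2) \<partial>\<tau>)))"

(* The entire function (1 - cos (sqrt \<mu> * t)) / \<mu> of \<mu>, evaluated at real \<mu>. *)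
definition transfer_kernel :: "real \<Rightarrow> real \<Rightarrow> real" where
  "transfer_kernel t \<mu> =
    (if \<mu> > 0 then (1 - cos (sqrt \<mu> * t)) / \<mu>
     else if \<mu> = 0 then t\<^sup>2 / 2
     else (1 - cosh (sqrt \<bar>\<mu>\<bar> * t)) / \<mu>)"

definition transfer_function_of :: "real measure \<Rightarrow> real \<Rightarrow> real" where
  "transfer_function_of \<tau> t = (LINT \<mu>|\<tau>. transfer_kernel t \<mu>)"

definition is_transfer_function ::
  "ereal \<Rightarrow> (real \<Rightarrow> real) \<Rightarrow> real \<Rightarrow> (real \<Rightarrow> real) \<Rightarrow> bool" where
  "is_transfer_function l q h \<Phi> \<longleftrightarrow>
    (\<exists>\<tau>. spectral_measure l q h \<tau> \<and> (\<forall>t\<in>half_open (2 * l). \<Phi> t = transfer_function_of \<tau> t))"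

end

theory Submission
  imports Defs
begin

text \<open>Write \<open>\<psi> = \<phi> / sin \<alpha>\<close>. A transformation operator gives
  \<open>\<psi>(x,\<mu>) = cos \<surd>\<mu> x + \<integral> K(x,t) cos (\<surd>\<mu> t) dt\<close> on \<open>[0,x]\<close>, and its resolvent \<open>H\<close> inverts this to
  \<open>cos \<surd>\<mu> r = \<psi>(r,\<mu>) + \<integral> H(r,x) \<psi>(x,\<mu>) dx\<close>. Integrating over \<open>r \<in> [0,s]\<close> exhibits
  \<open>sin (\<surd>\<mu> s) / \<surd>\<mu>\<close> as the transform of an explicit function \<open>Y_s\<close> supported in \<open>[0,s]\<close>. The product
  of \<open>sin (\<surd>\<mu> s) / \<surd>\<mu>\<close> and \<open>sin (\<surd>\<mu> t) / \<surd>\<mu>\<close> is half the difference of the transfer kernels at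
  \<open>s + t\<close> and \<open>s - t\<close>, so by Parseval's identity the transfer function determines all inner products
  of \<open>Y_s\<close> and \<open>Y_t\<close>. As \<open>Y\<close> is triangular, this is a Cholesky factorization and determines \<open>sin \<alpha>\<close>
  and \<open>H\<close>, by a Gronwall argument. Then \<open>\<psi>\<close>, and with it \<open>q\<close> and \<open>h\<close>, is determined.\<close>

section \<open>Cosine and sine of a square root\<close>

text \<open>\<open>cos_sqrt \<mu> r\<close> itself is the transform of a point mass at
  \<open>r\<close> plus a continuous density, which Parseval's identity cannot handle; integrating
  over \<open>r\<close> replaces it by a bounded function supported in [0,s]. Besides being Borel,
  \<tau> enters only through Parseval's identity, and only for functions supported in some [0,b]
  with b < l, so the behaviour at l never matters and all kernels live on compact triangles. Since q
  is merely integrable, the kernel K need not have second derivatives; the Goursat problem for its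
  wave equation is used only in integrated form. Three points need separate care. The inner products
  carry the unknown factor 1 / (sin \<alpha>)^2, which is split off by letting s tend to 0.
  One-sided derivatives on a degenerate interval carry no information, so data on [0,2b] are used
  for equality on [0,b'] with b' < b, and then b' exhausts [0,a). Finally, q can be read off only
  where a solution is nonzero, so a negative \<mu> is chosen for which \<psi> is positive on all of
  [0,b].\<close>

definition cos_sqrt :: "real \<Rightarrow> real \<Rightarrow> real" where
  "cos_sqrt \<mu> x = (if \<mu> \<ge> 0 then cos (sqrt \<mu> * x) else cosh (sqrt \<bar>\<mu>\<bar> * x))"

text \<open>With \<open>cos_sqrt\<close> this is the fundamental system of -y'' = \<mu> y with data
  (1, 0) and (0, 1) at 0, kept real valued for every real \<mu>. Negative \<mu> cannot be avoided: a
  spectral measure may charge the negative half-line, and a positive solution is later found for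
  some \<mu> < 0.\<close>

definition sin_sqrt :: "real \<Rightarrow> real \<Rightarrow> real" where
  "sin_sqrt \<mu> x = (if \<mu> > 0 then sin (sqrt \<mu> * x) / sqrt \<mu> else if \<mu> = 0 then x
     else sinh (sqrt \<bar>\<mu>\<bar> * x) / sqrt \<bar>\<mu>\<bar>)"

lemma cos_sqrt_0 [simp]: "cos_sqrt \<mu> 0 = 1"
  by (simp add: cos_sqrt_def)

lemma sin_sqrt_0 [simp]: "sin_sqrt \<mu> 0 = 0"
  by (simp add: sin_sqrt_def)

lemma has_real_derivative_sin_sqrt: "(sin_sqrt \<mu> has_real_derivative cos_sqrt \<mu> x) (at x within A)"
proof -
  consider "\<mu> > 0" | "\<mu> = 0" | "\<mu> < 0" by linarith
  then show ?thesis
  proof cases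
    case 1
    have "((\<lambda>x. sin (sqrt \<mu> * x) / sqrt \<mu>) has_real_derivative cos (sqrt \<mu> * x)) (at x within A)"
      using 1 by (auto intro!: derivative_eq_intros simp: mult.assoc)
    then show ?thesis
      using 1 by (simp add: sin_sqrt_def [abs_def] cos_sqrt_def)
  next
    case 2
    then show ?thesis
      by (simp add: sin_sqrt_def [abs_def] cos_sqrt_def)
  next
    case 3
    have "((\<lambda>x. sinh (sqrt \<bar>\<mu>\<bar> * x) / sqrt \<bar>\<mu>\<bar>) has_real_derivative cosh (sqrt \<bar>\<mu>\<bar> * x)) (at x within A)"
      using 3 by (auto intro!: derivative_eq_intros simp: mult.assoc)
    then show ?thesis
      using 3 by (simp add: sin_sqrt_def [abs_def] cos_sqrt_def)
  qed
qed

lemma has_real_derivative_cos_sqrt: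
  "(cos_sqrt \<mu> has_real_derivative - \<mu> * sin_sqrt \<mu> x) (at x within A)"
proof -
  consider "\<mu> > 0" | "\<mu> = 0" | "\<mu> < 0" by linarith
  then show ?thesis
  proof cases
    case 1
    have "((\<lambda>x. cos (sqrt \<mu> * x)) has_real_derivative - \<mu> * (sin (sqrt \<mu> * x) / sqrt \<mu>)) (at x within A)"
      using 1 by (auto intro!: derivative_eq_intros simp: field_simps)
    then show ?thesis
      using 1 by (simp add: sin_sqrt_def cos_sqrt_def [abs_def])
  next
    case 2
    then show ?thesis
      by (simp add: sin_sqrt_def cos_sqrt_def [abs_def])
  next
    case 3
    have "((\<lambda>x. cosh (sqrt \<bar>\<mu>\<bar> * x)) has_real_derivative sqrt \<bar>\<mu>\<bar> * sinh (sqrt \<bar>\<mu>\<bar> * x)) (at x within A)"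
      by (auto intro!: derivative_eq_intros)
    also have "sqrt \<bar>\<mu>\<bar> * sinh (sqrt \<bar>\<mu>\<bar> * x) = - \<mu> * (sinh (sqrt \<bar>\<mu>\<bar> * x) / sqrt \<bar>\<mu>\<bar>)"
      using 3 by (simp add: field_simps flip: mult.assoc)
    finally have "((\<lambda>x. cosh (sqrt \<bar>\<mu>\<bar> * x)) has_real_derivative - \<mu> * (sinh (sqrt \<bar>\<mu>\<bar> * x) / sqrt \<bar>\<mu>\<bar>)) (at x within A)" .
    then show ?thesis
      using 3 by (simp add: sin_sqrt_def cos_sqrt_def [abs_def])
  qed
qed

lemma continuous_on_cos_sqrt [continuous_intros]:
  "continuous_on A f \<Longrightarrow> continuous_on A (\<lambda>x. cos_sqrt \<mu> (f x))"
  by (rule continuous_on_compose2[where t = UNIV])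
     (auto intro!: DERIV_continuous_on has_real_derivative_cos_sqrt)

lemma continuous_on_sin_sqrt [continuous_intros]:
  "continuous_on A f \<Longrightarrow> continuous_on A (\<lambda>x. sin_sqrt \<mu> (f x))"
  by (rule continuous_on_compose2[where t = UNIV])
     (auto intro!: DERIV_continuous_on has_real_derivative_sin_sqrt)

lemma integral_cos_sqrt:
  assumes "u \<le> v"
  shows "(cos_sqrt \<mu> has_integral sin_sqrt \<mu> v - sin_sqrt \<mu> u) {u..v}"
  using assms
  by (intro fundamental_theorem_of_calculus)
     (auto simp: has_real_derivative_sin_sqrt simp flip: has_real_derivative_iff_has_vector_derivative)

lemma sin_sqrt_times_cos_sqrt:
  "sin_sqrt \<mu> w * cos_sqrt \<mu> s = (sin_sqrt \<mu> (s + w) - sin_sqrt \<mu> (s - w)) / 2"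
proof -
  consider "\<mu> > 0" | "\<mu> = 0" | "\<mu> < 0" by linarith
  then show ?thesis
    by cases (simp_all add: sin_sqrt_def cos_sqrt_def distrib_left right_diff_distrib sin_add sin_diff
      sinh_add sinh_diff flip: diff_divide_distrib)
qed

text \<open>The transfer kernel is even in its first argument, so the order of s and t is free. The
  case s = t shows that the kernel is twice a square, which is how its \<tau>-integrability is
  obtained later.\<close>

lemma sin_sqrt_times_sin_sqrt:
  "sin_sqrt \<mu> s * sin_sqrt \<mu> t = (transfer_kernel (s + t) \<mu> - transfer_kernel (s - t) \<mu>) / 2"
proof -
  consider "\<mu> > 0" | "\<mu> = 0" | "\<mu> < 0" by linarith
  then show ?thesis
  proof cases
    case 1
    then show ?thesis
      by (simp add: sin_sqrt_def transfer_kernel_def distrib_left right_diff_distrib cos_add cos_diff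
          field_simps)
  next
    case 2
    then show ?thesis
      by (simp add: sin_sqrt_def transfer_kernel_def power2_eq_square field_simps)
  next
    case 3
    then have "sqrt (- \<mu>) * sqrt (- \<mu>) = - \<mu>" by simp
    with 3 show ?thesis
      by (simp add: sin_sqrt_def transfer_kernel_def distrib_left right_diff_distrib cosh_add cosh_diff
          field_simps)
  qed
qed

lemma transfer_kernel_0 [simp]: "transfer_kernel 0 \<mu> = 0"
  by (simp add: transfer_kernel_def)

lemma borel_measurable_sin_sqrt [measurable]: "(\<lambda>\<mu>. sin_sqrt \<mu> s) \<in> borel_measurable borel"
proof -
  have [measurable]: "(sinh :: real \<Rightarrow> real) \<in> borel_measurable borel"
    by (intro borel_measurable_continuous_onI continuous_intros)
  show ?thesis
    unfolding sin_sqrt_def by measurable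
qed

section \<open>Absolute continuity and variation of constants\<close>

lemma abs_continuous_onE:
  assumes "abs_continuous_on S f" "e > 0"
  obtains d where "d > 0" "\<And>D. D division_of \<Union>D \<Longrightarrow> \<Union>D \<subseteq> S \<Longrightarrow> (\<Sum>K\<in>D. Sup K - Inf K) < d \<Longrightarrow>
    (\<Sum>K\<in>D. norm (f (Sup K) - f (Inf K))) < e"
proof -
  obtain d where "d > 0" "\<forall>D. D division_of \<Union>D \<and> \<Union>D \<subseteq> S \<and> (\<Sum>K\<in>D. Sup K - Inf K) < d \<longrightarrow>
       (\<Sum>K\<in>D. norm (f (Sup K) - f (Inf K))) < e"
    using assms unfolding abs_continuous_on_def by blast
  then show ?thesis by (intro that[of d]) simp_all
qed

lemma abs_continuous_on_imp_continuous_on: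
  fixes f :: "real \<Rightarrow> 'a::real_normed_vector"
  assumes "abs_continuous_on {a..b} f"
  shows "continuous_on {a..b} f"
proof (rule uniformly_continuous_imp_continuous, unfold uniformly_continuous_on_def, intro allI impI)
  fix e :: real assume "e > 0"
  obtain d where d: "d > 0" "\<And>D. D division_of \<Union>D \<Longrightarrow> \<Union>D \<subseteq> {a..b} \<Longrightarrow> (\<Sum>K\<in>D. Sup K - Inf K) < d \<Longrightarrow>
    (\<Sum>K\<in>D. norm (f (Sup K) - f (Inf K))) < e"
    using abs_continuous_onE[OF assms \<open>e > 0\<close>] by blast
  have *: "dist (f y) (f x) < e" if "x \<in> {a..b}" "y \<in> {a..b}" "x \<le> y" "dist y x < d" for x y
    using d(2)[of "{{x..y}}"] that by (auto simp: dist_norm division_of_def)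
  have "dist (f x') (f x) < e" if "x \<in> {a..b}" "x' \<in> {a..b}" "dist x' x < d" for x x'
    using *[of x x'] *[of x' x] that by (cases "x \<le> x'") (auto simp: dist_commute)
  with d(1) show "\<exists>d>0. \<forall>x\<in>{a..b}. \<forall>x'\<in>{a..b}. dist x' x < d \<longrightarrow> dist (f x') (f x) < e"
    by blast
qed

lemma abs_continuous_on_add:
  assumes "abs_continuous_on S f" "abs_continuous_on S g"
  shows "abs_continuous_on S (\<lambda>x. f x + g x)"
  unfolding abs_continuous_on_def
proof (intro allI impI)
  fix e :: real assume e: "e > 0"
  obtain d1 where d1: "d1 > 0" "\<And>D. D division_of \<Union>D \<Longrightarrow> \<Union>D \<subseteq> S \<Longrightarrow> (\<Sum>K\<in>D. Sup K - Inf K) < d1 \<Longrightarrow>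
    (\<Sum>K\<in>D. norm (f (Sup K) - f (Inf K))) < e / 2"
    using abs_continuous_onE[OF assms(1) half_gt_zero[OF e]] by blast
  obtain d2 where d2: "d2 > 0" "\<And>D. D division_of \<Union>D \<Longrightarrow> \<Union>D \<subseteq> S \<Longrightarrow> (\<Sum>K\<in>D. Sup K - Inf K) < d2 \<Longrightarrow>
    (\<Sum>K\<in>D. norm (g (Sup K) - g (Inf K))) < e / 2"
    using abs_continuous_onE[OF assms(2) half_gt_zero[OF e]] by blast
  have "(\<Sum>K\<in>D. norm ((f (Sup K) + g (Sup K)) - (f (Inf K) + g (Inf K)))) < e"
    if D: "D division_of \<Union>D" "\<Union>D \<subseteq> S" "(\<Sum>K\<in>D. Sup K - Inf K) < min d1 d2" for D
  proof -
    have "(\<Sum>K\<in>D. norm ((f (Sup K) + g (Sup K)) - (f (Inf K) + g (Inf K))))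
        \<le> (\<Sum>K\<in>D. norm (f (Sup K) - f (Inf K))) + (\<Sum>K\<in>D. norm (g (Sup K) - g (Inf K)))"
      unfolding sum.distrib[symmetric] by (intro sum_mono) (metis add_diff_add norm_triangle_ineq)
    with d1(2)[OF D(1,2)] d2(2)[OF D(1,2)] D(3) show ?thesis by simp
  qed
  with d1(1) d2(1) show "\<exists>d>0. \<forall>D. D division_of \<Union>D \<and> \<Union>D \<subseteq> S \<and> (\<Sum>K\<in>D. Sup K - Inf K) < d \<longrightarrow>
    (\<Sum>K\<in>D. norm (f (Sup K) + g (Sup K) - (f (Inf K) + g (Inf K)))) < e"
    by (intro exI[of _ "min d1 d2"]) auto
qed

lemma continuous_on_compact_norm_bound:
  fixes f :: "'a::topological_space \<Rightarrow> 'b::real_normed_vector"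
  assumes "compact S" "continuous_on S f"
  obtains B where "B > 0" "\<And>x. x \<in> S \<Longrightarrow> norm (f x) \<le> B"
proof -
  have "bounded (f ` S)"
    using assms by (intro compact_imp_bounded compact_continuous_image)
  then obtain B where "B > 0" "\<forall>x\<in>f ` S. norm x \<le> B"
    unfolding bounded_pos by blast
  then show ?thesis by (intro that[of B]) simp_all
qed

text \<open>On a compact interval a C1 factor is bounded and Lipschitz. The variation of the product
  is therefore at most sup |u| times the variation of \<open>f\<close> plus a constant times the
  total length; each part is given half of the tolerance.\<close>

lemma abs_continuous_on_scaleR:
  fixes f :: "real \<Rightarrow> 'a::real_normed_vector" and u u' :: "real \<Rightarrow> real"
  assumes f: "abs_continuous_on {a..b} f"
    and u: "\<And>x. x \<in> {a..b} \<Longrightarrow> (u has_real_derivative u' x) (at x within {a..b})"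
    and u': "continuous_on {a..b} u'"
  shows "abs_continuous_on {a..b} (\<lambda>x. u x *\<^sub>R f x)"
  unfolding abs_continuous_on_def
proof (intro allI impI)
  fix e :: real assume e: "e > 0"
  obtain Bf where Bf: "Bf > 0" "\<And>x. x \<in> {a..b} \<Longrightarrow> norm (f x) \<le> Bf"
    using continuous_on_compact_norm_bound[OF _ abs_continuous_on_imp_continuous_on[OF f]] by auto
  obtain Bu where Bu: "Bu > 0" "\<And>x. x \<in> {a..b} \<Longrightarrow> norm (u x) \<le> Bu"
    using continuous_on_compact_norm_bound[OF _ DERIV_continuous_on[OF u]] by auto
  obtain Bu' where Bu': "Bu' > 0" "\<And>x. x \<in> {a..b} \<Longrightarrow> norm (u' x) \<le> Bu'"
    using continuous_on_compact_norm_bound[OF _ u'] by auto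
  have lip: "norm (u y - u x) \<le> Bu' * norm (y - x)" if "x \<in> {a..b}" "y \<in> {a..b}" for x y
    by (rule field_differentiable_bound[OF _ u Bu'(2)]) (use that in auto)
  obtain d where d: "d > 0" "\<And>D. D division_of \<Union>D \<Longrightarrow> \<Union>D \<subseteq> {a..b} \<Longrightarrow> (\<Sum>K\<in>D. Sup K - Inf K) < d \<Longrightarrow>
    (\<Sum>K\<in>D. norm (f (Sup K) - f (Inf K))) < e / (2 * Bu)"
    by (rule abs_continuous_onE[OF f, of "e / (2 * Bu)"]) (use e Bu(1) in auto)
  define d' where "d' = min d (e / (2 * Bu' * Bf))"
  have "d' > 0"
    using d(1) e Bf(1) Bu'(1) by (auto simp: d'_def)
  moreover have "(\<Sum>K\<in>D. norm (u (Sup K) *\<^sub>R f (Sup K) - u (Inf K) *\<^sub>R f (Inf K))) < e"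
    if D: "D division_of \<Union>D" "\<Union>D \<subseteq> {a..b}" "(\<Sum>K\<in>D. Sup K - Inf K) < d'" for D
  proof -
    have "norm (u (Sup K) *\<^sub>R f (Sup K) - u (Inf K) *\<^sub>R f (Inf K))
        \<le> Bu * norm (f (Sup K) - f (Inf K)) + Bu' * Bf * (Sup K - Inf K)" if K: "K \<in> D" for K
    proof -
      obtain p r where "K = cbox p r" using division_ofD(4)[OF D(1) K] by blast
      moreover have "K \<noteq> {}" using division_ofD(3)[OF D(1) K] .
      ultimately have pr: "K = {p..r}" "p \<le> r" by auto
      then have mem: "p \<in> {a..b}" "r \<in> {a..b}" using D(2) K by force+
      have "u r *\<^sub>R f r - u p *\<^sub>R f p = u r *\<^sub>R (f r - f p) + (u r - u p) *\<^sub>R f p"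
        by (simp add: algebra_simps)
      also have "norm \<dots> \<le> norm (u r) * norm (f r - f p) + norm (u r - u p) * norm (f p)"
        by (metis norm_scaleR norm_triangle_ineq real_norm_def)
      also have "\<dots> \<le> Bu * norm (f r - f p) + (Bu' * norm (r - p)) * Bf"
        using Bu(2)[OF mem(2)] Bf(2)[OF mem(1)] lip[OF mem] Bu'(1)
        by (intro add_mono mult_mono) auto
      finally show ?thesis using pr by (simp add: algebra_simps)
    qed
    then have "(\<Sum>K\<in>D. norm (u (Sup K) *\<^sub>R f (Sup K) - u (Inf K) *\<^sub>R f (Inf K)))
        \<le> Bu * (\<Sum>K\<in>D. norm (f (Sup K) - f (Inf K))) + Bu' * Bf * (\<Sum>K\<in>D. Sup K - Inf K)"
      unfolding sum_distrib_left sum.distrib[symmetric] by (rule sum_mono)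
    also have "\<dots> < Bu * (e / (2 * Bu)) + Bu' * Bf * (e / (2 * Bu' * Bf))"
      using d(2)[OF D(1,2)] D(3) Bu(1) Bu'(1) Bf(1)
      by (intro add_strict_mono mult_strict_left_mono) (auto simp: d'_def)
    also have "\<dots> = e"
      using Bu(1) Bu'(1) Bf(1) by (simp add: field_simps)
    finally show ?thesis .
  qed
  ultimately show "\<exists>d>0. \<forall>D. D division_of \<Union>D \<and> \<Union>D \<subseteq> {a..b} \<and> (\<Sum>K\<in>D. Sup K - Inf K) < d \<longrightarrow>
    (\<Sum>K\<in>D. norm (u (Sup K) *\<^sub>R f (Sup K) - u (Inf K) *\<^sub>R f (Inf K))) < e"
    by blast
qed

text \<open>A direct gauge argument. Tags outside \<open>N\<close> are handled by differentiability,
  as in the classical theorem. Tags in \<open>N\<close> receive as gauge an open superset of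
  \<open>N\<close> of small measure, so the intervals they tag have small total length and absolute
  continuity makes the increments of \<open>f\<close> over them small. Integrability of
  \<open>g\<close> comes out as part of the conclusion.\<close>

lemma fundamental_theorem_of_calculus_abs_continuous:
  fixes f g :: "real \<Rightarrow> 'a::banach"
  assumes "a \<le> b" and f: "abs_continuous_on {a..b} f" and N: "negligible N"
    and deriv: "\<And>x. x \<in> {a..b} - N \<Longrightarrow> (f has_vector_derivative g x) (at x within {a..b})"
  shows "(g has_integral f b - f a) {a..b}"
proof -
  \<comment> \<open>Zero on \<open>N\<close>, so intervals tagged there contribute nothing to the
    Riemann sum and only their increments of \<open>f\<close> have to be estimated.\<close>
  define g0 where "g0 x = (if x \<in> N then 0 else g x)" for x
  have "(g0 has_integral f b - f a) {a..b}"
    unfolding has_integral_real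
  proof (intro allI impI)
    fix e :: real assume e: "e > 0"
    obtain \<delta> where \<delta>: "\<delta> > 0" "\<And>D. D division_of \<Union>D \<Longrightarrow> \<Union>D \<subseteq> {a..b} \<Longrightarrow> (\<Sum>K\<in>D. Sup K - Inf K) < \<delta> \<Longrightarrow>
      (\<Sum>K\<in>D. norm (f (Sup K) - f (Inf K))) < e / 2"
      using abs_continuous_onE[OF f half_gt_zero[OF e]] by blast
    have N0: "N \<in> null_sets lebesgue"
      using N by (simp add: negligible_iff_null_sets)
    then have "N \<in> sets lebesgue" by auto
    from sets_lebesgue_outer_open[OF this \<delta>(1)] obtain T where
      T: "open T" "N \<subseteq> T" "T - N \<in> lmeasurable" "emeasure lebesgue (T - N) < ennreal \<delta>"
      by blast
    have T': "T \<in> lmeasurable" "measure lebesgue T < \<delta>"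
    proof -
      have eq: "emeasure lebesgue T = emeasure lebesgue (T - N)"
        using N0 T(1) by (metis borel_open emeasure_Diff_null_set sets_completionI_sets sets_lborel)
      then show 1: "T \<in> lmeasurable"
        using T(1,4) by (intro fmeasurableI) (auto intro: less_trans)
      show "measure lebesgue T < \<delta>"
        using T(4) eq \<delta>(1) emeasure_eq_measure2[OF 1]
        by (metis ennreal_less_iff measure_nonneg)
    qed
    \<comment> \<open>The estimates at tags outside \<open>N\<close> add up to at most
      \<open>\<eta> * (b - a)\<close>, hence at most e / 2; the summand 1 covers a = b.\<close>
    define \<eta> where "\<eta> = e / (2 * (b - a + 1))"
    have \<eta>: "\<eta> > 0" using e \<open>a \<le> b\<close> by (simp add: \<eta>_def)
    have "\<exists>d>0. x \<in> {a..b} - N \<longrightarrow>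
         (\<forall>y\<in>{a..b}. norm (y-x) < d \<longrightarrow> norm (f y - f x - (y-x) *\<^sub>R g x) \<le> \<eta> * norm (y-x))" for x
    proof (cases "x \<in> {a..b} - N")
      case True
      then show ?thesis
        using deriv[OF True] \<eta> unfolding has_vector_derivative_def has_derivative_within_alt by blast
    qed (auto intro: exI[of _ 1])
    then obtain d where d: "\<And>x. 0 < d x"
      "\<And>x y. \<lbrakk>x \<in> {a..b} - N; y \<in> {a..b}; norm (y-x) < d x\<rbrakk>
                        \<Longrightarrow> norm (f y - f x - (y-x) *\<^sub>R g x) \<le> \<eta> * norm (y-x)"
      by metis
    define \<gamma> where "\<gamma> x = (if x \<in> N then T else ball x (d x))" for x
    have "gauge \<gamma>"
      using T d(1) by (auto simp: gauge_def \<gamma>_def)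
    moreover have "norm ((\<Sum>(x, K)\<in>p. measure lborel K *\<^sub>R g0 x) - (f b - f a)) < e"
      if p: "p tagged_division_of {a..b}" "\<gamma> fine p" for p
    proof -
      have fin: "finite p" using p(1) by (rule tagged_division_of_finite)
      have K: "\<exists>u v. K = {u..v} \<and> u \<le> v \<and> x \<in> K \<and> u \<in> {a..b} \<and> v \<in> {a..b} \<and> K \<subseteq> \<gamma> x"
        if xK: "(x, K) \<in> p" for x K
      proof -
        obtain u v where "K = cbox u v" "x \<in> K" "K \<subseteq> {a..b}"
          using p(1) xK by (meson tagged_division_ofD(2,3,4))
        then show ?thesis using p(2) xK by (intro exI[of _ u] exI[of _ v]) (auto simp: fine_def)
      qed
      have fsum: "f b - f a = (\<Sum>(x,K)\<in>p. f (Sup K) - f (Inf K))"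
        using additive_tagged_division_1[OF \<open>a \<le> b\<close> p(1), of f] by simp
      have lsum: "b - a = (\<Sum>(x,K)\<in>p. Sup K - Inf K)"
        using additive_tagged_division_1[OF \<open>a \<le> b\<close> p(1), of "\<lambda>x. x"] by simp
      define pN where "pN = {(x, K). (x, K) \<in> p \<and> x \<in> N}"
      have pN: "pN \<subseteq> p" by (auto simp: pN_def)
      have "norm ((\<Sum>(x, K)\<in>p. measure lborel K *\<^sub>R g0 x) - (f b - f a))
          = norm (\<Sum>(x, K)\<in>p. measure lborel K *\<^sub>R g0 x - (f (Sup K) - f (Inf K)))"
        unfolding fsum by (simp add: split_beta sum_subtractf)
      also have "\<dots> \<le> (\<Sum>(x, K)\<in>p. norm (measure lborel K *\<^sub>R g0 x - (f (Sup K) - f (Inf K))))"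
        by (simp add: split_beta sum_norm_le)
      also have "\<dots> = (\<Sum>(x, K)\<in>p - pN. norm (measure lborel K *\<^sub>R g0 x - (f (Sup K) - f (Inf K))))
          + (\<Sum>(x, K)\<in>pN. norm (measure lborel K *\<^sub>R g0 x - (f (Sup K) - f (Inf K))))"
        using sum.subset_diff[OF pN fin] by blast
      also have "\<dots> < e / 2 + e / 2"
      proof (rule add_le_less_mono)
        have "(\<Sum>(x, K)\<in>p - pN. norm (measure lborel K *\<^sub>R g0 x - (f (Sup K) - f (Inf K))))
            \<le> (\<Sum>(x, K)\<in>p - pN. \<eta> * (Sup K - Inf K))"
        proof (intro sum_mono, clarify)
          fix x K assume xK: "(x, K) \<in> p" "(x, K) \<notin> pN"
          then have xN: "x \<notin> N" by (auto simp: pN_def)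
          obtain u v where uv: "K = {u..v}" "u \<le> v" "x \<in> K" "u \<in> {a..b}" "v \<in> {a..b}" "K \<subseteq> \<gamma> x"
            using K[OF xK(1)] by blast
          have x: "x \<in> {a..b} - N" using uv xN by auto
          have "{u..v} \<subseteq> ball x (d x)" using uv xN by (simp add: \<gamma>_def)
          then have "u \<in> ball x (d x)" "v \<in> ball x (d x)"
            using uv(2) by (meson atLeastAtMost_iff order_refl subsetD)+
          then have du: "norm (f u - f x - (u - x) *\<^sub>R g x) \<le> \<eta> * norm (u - x)"
            and dv: "norm (f v - f x - (v - x) *\<^sub>R g x) \<le> \<eta> * norm (v - x)"
            using d(2)[OF x uv(4)] d(2)[OF x uv(5)] by (auto simp: dist_norm norm_minus_commute)
          have "norm ((v - u) *\<^sub>R g x - (f v - f u))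
              = norm ((f u - f x - (u - x) *\<^sub>R g x) - (f v - f x - (v - x) *\<^sub>R g x))"
            by (simp add: algebra_simps)
          also have "\<dots> \<le> \<eta> * norm (u - x) + \<eta> * norm (v - x)"
            using norm_triangle_ineq4 du dv by (rule order_trans[OF _ add_mono])
          also have "\<dots> = \<eta> * (v - u)" using uv by (auto simp: algebra_simps)
          finally show "norm (measure lborel K *\<^sub>R g0 x - (f (Sup K) - f (Inf K))) \<le> \<eta> * (Sup K - Inf K)"
            using uv xN by (simp add: g0_def)
        qed
        also have "\<dots> \<le> (\<Sum>(x, K)\<in>p. \<eta> * (Sup K - Inf K))"
          using K \<eta> fin by (intro sum_mono2) fastforce+
        also have "\<dots> = \<eta> * (b - a)"
          by (simp add: lsum sum_distrib_left split_beta)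
        also have "\<dots> \<le> e / 2"
          using e \<open>a \<le> b\<close> by (simp add: \<eta>_def field_simps)
        finally show "(\<Sum>(x, K)\<in>p - pN. norm (measure lborel K *\<^sub>R g0 x - (f (Sup K) - f (Inf K)))) \<le> e / 2" .
      next
        define D where "D = snd ` pN"
        have "pN tagged_partial_division_of {a..b}"
          using p(1) pN tagged_partial_division_subset unfolding tagged_division_of_def by blast
        then have tag: "pN tagged_division_of \<Union>D"
          unfolding D_def by (rule tagged_partial_division_of_Union_self)
        then have D: "D division_of \<Union>D"
          unfolding D_def by (rule division_of_tagged_division)
        have sub: "\<Union>D \<subseteq> {a..b} \<inter> T"
        proof
          fix y assume "y \<in> \<Union>D"
          then obtain x L where L: "(x, L) \<in> p" "x \<in> N" "y \<in> L" by (auto simp: D_def pN_def)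
          then show "y \<in> {a..b} \<inter> T" using K[OF L(1)] by (auto simp: \<gamma>_def)
        qed
        have "(\<Sum>K\<in>D. Sup K - Inf K) = (\<Sum>K\<in>D. measure lebesgue K)"
        proof (rule sum.cong[OF refl])
          fix L assume "L \<in> D"
          then obtain x where "(x, L) \<in> p" by (auto simp: D_def pN_def)
          then show "Sup L - Inf L = measure lebesgue L" using K by fastforce
        qed
        also have "\<dots> = measure lebesgue (\<Union>D)"
          using content_division[OF D] by simp
        also have "\<dots> \<le> measure lebesgue T"
          using sub T' D by (intro measure_mono_fmeasurable lmeasurable_division[THEN fmeasurableD]) auto
        also note T'(2)
        finally have "(\<Sum>K\<in>D. norm (f (Sup K) - f (Inf K))) < e / 2"
          using \<delta>(2)[OF D] sub by auto
        moreover have "(\<Sum>(x, K)\<in>pN. norm (measure lborel K *\<^sub>R g0 x - (f (Sup K) - f (Inf K))))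
            = (\<Sum>(x, K)\<in>pN. norm (f (Sup K) - f (Inf K)))"
          by (intro sum.cong refl) (auto simp: pN_def g0_def norm_minus_commute)
        moreover have "(\<Sum>(x, K)\<in>pN. norm (f (Sup K) - f (Inf K))) = (\<Sum>K\<in>D. norm (f (Sup K) - f (Inf K)))"
        proof -
          \<comment> \<open>Two tagged pairs can share an interval only if it is degenerate.
            \<open>h\<close> vanishes on degenerate intervals and, by fiat, on the empty set, so
            summing over pairs and over intervals gives the same value.\<close>
          define h where "h K = (if K = {} then 0 else norm (f (Sup K) - f (Inf K)))" for K
          have "(\<Sum>(x, K)\<in>pN. norm (f (Sup K) - f (Inf K))) = (\<Sum>(x, K)\<in>pN. h K)"
            using K pN by (intro sum.cong refl) (fastforce simp: h_def)
          also have "\<dots> = (\<Sum>K\<in>D. h K)"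
            unfolding D_def
            by (rule sum.over_tagged_division_lemma[OF tag]) (auto simp: h_def box_eq_empty)
          also have "\<dots> = (\<Sum>K\<in>D. norm (f (Sup K) - f (Inf K)))"
            using division_ofD(3)[OF D] by (intro sum.cong refl) (auto simp: h_def)
          finally show ?thesis .
        qed
        ultimately show "(\<Sum>(x, K)\<in>pN. norm (measure lborel K *\<^sub>R g0 x - (f (Sup K) - f (Inf K)))) < e / 2"
          by simp
      qed
      finally show ?thesis by simp
    qed
    ultimately show "\<exists>\<gamma>. gauge \<gamma> \<and> (\<forall>p. p tagged_division_of {a..b} \<and> \<gamma> fine p \<longrightarrow>
        norm ((\<Sum>(x, K)\<in>p. measure lborel K *\<^sub>R g0 x) - (f b - f a)) < e)"
      by (intro exI[of _ \<gamma>] conjI allI impI) simp_all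
  qed
  then show ?thesis
    by (rule has_integral_spike[OF N, rotated]) (simp add: g0_def)
qed

text \<open>Trades the differential equation, which holds only almost everywhere, for an integral
  equation. Everything up to the final recovery of the potential works with the latter.\<close>

lemma sl_solution_variation_of_constants:
  assumes y: "sl_solution l q (complex_of_real \<mu>) y dy" and x: "x \<in> half_open l"
  shows "((\<lambda>t. sin_sqrt \<mu> (x - t) *\<^sub>R (q t *\<^sub>R y t)) has_integral
      y x - (cos_sqrt \<mu> x *\<^sub>R y 0 + sin_sqrt \<mu> x *\<^sub>R dy 0)) {0..x}"
proof -
  have sub: "{0..x} \<subseteq> half_open l" and "0 \<le> x"
    using x unfolding half_open_def
    by (auto intro: le_less_trans[of "ereal _" "ereal x" l])
  have AC: "abs_continuous_on {0..x} y" "abs_continuous_on {0..x} dy"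
    using y x by (auto simp: sl_solution_def locally_abs_continuous_def)
  obtain N where N: "N \<in> null_sets lebesgue" and N': "{t. \<not> (t \<in> half_open l \<longrightarrow>
       dy differentiable (at t) \<and>
       - vector_derivative dy (at t) + complex_of_real (q t) * y t - complex_of_real \<mu> * y t = 0)} \<subseteq> N"
    using y unfolding sl_solution_def eventually_ae_filter by auto
  \<comment> \<open>The free propagator from t to x applied to the data of y at t. It equals y x at
    t = x, and in its derivative the terms with \<mu> and those with \<open>cos_sqrt\<close> cancel,
    so that only the potential remains.\<close>
  define g where "g t = sin_sqrt \<mu> (x - t) *\<^sub>R dy t + cos_sqrt \<mu> (x - t) *\<^sub>R y t" for t
  have dS: "((\<lambda>t. sin_sqrt \<mu> (x - t)) has_real_derivative - cos_sqrt \<mu> (x - t)) (at t within A)"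
    and dC: "((\<lambda>t. cos_sqrt \<mu> (x - t)) has_real_derivative \<mu> * sin_sqrt \<mu> (x - t)) (at t within A)" for t A
    by (rule DERIV_cong[OF DERIV_chain2[OF has_real_derivative_sin_sqrt]] 
             DERIV_cong[OF DERIV_chain2[OF has_real_derivative_cos_sqrt]],
        auto intro!: derivative_eq_intros)+
  have "abs_continuous_on {0..x} g"
    unfolding g_def
    by (intro abs_continuous_on_add abs_continuous_on_scaleR[OF AC(2) dS]
        abs_continuous_on_scaleR[OF AC(1) dC] continuous_intros)
  moreover have "(g has_vector_derivative sin_sqrt \<mu> (x - t) *\<^sub>R (q t *\<^sub>R y t)) (at t within {0..x})"
    if t: "t \<in> {0..x} - N" for t
  proof -
    have tl: "t \<in> half_open l" using t sub by auto
    have "dy differentiable (at t)"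
      and eq: "- vector_derivative dy (at t) + complex_of_real (q t) * y t - complex_of_real \<mu> * y t = 0"
      using t tl N' by auto
    then have ddy: "(dy has_vector_derivative vector_derivative dy (at t)) (at t within {0..x})"
      by (simp add: vector_derivative_works has_vector_derivative_at_within)
    have vd: "vector_derivative dy (at t) = q t *\<^sub>R y t - \<mu> *\<^sub>R y t"
      using eq by (simp add: scaleR_conv_of_real algebra_simps)
    have dy: "(y has_vector_derivative dy t) (at t within {0..x})"
      using y tl sub by (auto simp: sl_solution_def intro: has_vector_derivative_within_subset)
    show ?thesis
      unfolding g_def
      by (rule has_vector_derivative_eq_rhs[OF has_vector_derivative_add[OF 
            has_vector_derivative_scaleR[OF dS ddy] has_vector_derivative_scaleR[OF dC dy]]])
         (simp add: vd algebra_simps)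
  qed
  ultimately have "((\<lambda>t. sin_sqrt \<mu> (x - t) *\<^sub>R (q t *\<^sub>R y t)) has_integral g x - g 0) {0..x}"
    using \<open>0 \<le> x\<close> N
    by (intro fundamental_theorem_of_calculus_abs_continuous) (auto simp: negligible_iff_null_sets)
  also have "g x - g 0 = y x - (cos_sqrt \<mu> x *\<^sub>R y 0 + sin_sqrt \<mu> x *\<^sub>R dy 0)"
    by (simp add: g_def)
  finally show ?thesis .
qed

section \<open>Volterra contractions and parameter integrals\<close>

lemma absolutely_integrable_scaleR_continuous:
  fixes f :: "real \<Rightarrow> 'b::euclidean_space" and q :: "real \<Rightarrow> real"
  assumes q: "q absolutely_integrable_on {a..b}" and f: "continuous_on {a..b} f"
  shows "(\<lambda>t. q t *\<^sub>R f t) absolutely_integrable_on {a..b}"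
proof (rule absolutely_integrable_bounded_measurable_product[where h = "\<lambda>x y. y *\<^sub>R x", OF _ _ _ _ q])
  show "bilinear (\<lambda>(x::'b) (y::real). y *\<^sub>R x)"
    unfolding bilinear_conv_bounded_bilinear
    by (rule bounded_bilinear.flip[OF bounded_bilinear_scaleR])
  show "f \<in> borel_measurable (lebesgue_on {a..b})"
    by (rule continuous_imp_measurable_on_sets_lebesgue[OF f]) simp
  show "bounded (f ` {a..b})"
    by (intro compact_imp_bounded compact_continuous_image f compact_Icc)
qed simp

text \<open>Serves in place of Gronwall's inequality: by compactness the least M with norm (d p)
  \<le> M w(p) is attained, and the halving hypothesis gives M \<le> M / 2. In the applications w is
  an exponential whose rate is chosen large enough to produce the factor 1 / 2.\<close>

lemma zero_if_weighted_contraction: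
  fixes d :: "'p::metric_space \<Rightarrow> 'b::real_normed_vector" and w :: "'p \<Rightarrow> real"
  assumes D: "compact D" and d: "continuous_on D d" and w: "continuous_on D w"
    and pos: "\<And>p. p \<in> D \<Longrightarrow> w p > 0"
    and contr: "\<And>M p. 0 \<le> M \<Longrightarrow> (\<And>p. p \<in> D \<Longrightarrow> norm (d p) \<le> M * w p) \<Longrightarrow> p \<in> D
      \<Longrightarrow> norm (d p) \<le> M / 2 * w p"
    and p: "p \<in> D"
  shows "d p = 0"
proof -
  have cont: "continuous_on D (\<lambda>p. norm (d p) / w p)"
    using pos by (intro continuous_intros d w) force
  then obtain m where m: "m \<in> D" "\<And>p. p \<in> D \<Longrightarrow> norm (d p) / w p \<le> norm (d m) / w m"
    using continuous_attains_sup[OF D _ cont] p by blast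
  define M where "M = norm (d m) / w m"
  have M: "0 \<le> M" "norm (d p) \<le> M * w p" if "p \<in> D" for p
    using m(2)[OF that] pos[OF that] pos[OF m(1)] by (auto simp: M_def field_simps)
  have "norm (d m) \<le> M / 2 * w m"
    by (rule contr[OF M(1)[OF m(1)] M(2) m(1)])
  then have "M \<le> M / 2"
    using pos[OF m(1)] by (simp add: M_def field_simps)
  then have "M = 0" using M(1)[OF m(1)] by simp
  then show ?thesis using M(2)[OF p] by simp
qed

text \<open>Banach's fixed point theorem for the norm sup |f| / w. Successive Picard iterates differ
  by at most a geometric sequence, so their telescoping series converges uniformly and the limit is
  continuous.\<close>

lemma weighted_contraction_fixpoint:
  fixes T :: "('p::metric_space \<Rightarrow> real) \<Rightarrow> 'p \<Rightarrow> real" and w :: "'p \<Rightarrow> real"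
  assumes D: "compact D" and w: "continuous_on D w" and pos: "\<And>p. p \<in> D \<Longrightarrow> w p > 0"
    and cont: "\<And>f. continuous_on D f \<Longrightarrow> continuous_on D (T f)"
    and contr: "\<And>f g M p. continuous_on D f \<Longrightarrow> continuous_on D g \<Longrightarrow> 0 \<le> M \<Longrightarrow>
      (\<And>p. p \<in> D \<Longrightarrow> \<bar>f p - g p\<bar> \<le> M * w p) \<Longrightarrow> p \<in> D \<Longrightarrow> \<bar>T f p - T g p\<bar> \<le> M / 2 * w p"
  obtains f where "continuous_on D f" "\<And>p. p \<in> D \<Longrightarrow> f p = T f p"
proof -
  define F where "F n = (T ^^ n) (\<lambda>_. 0)" for n
  have F_Suc: "F (Suc n) = T (F n)" for n by (simp add: F_def)
  have contF: "continuous_on D (F n)" for n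
    by (induction n) (auto simp: F_Suc cont, simp add: F_def)
  obtain B where B: "B > 0" "\<And>p. p \<in> D \<Longrightarrow> norm (F 1 p - F 0 p) \<le> B"
    using continuous_on_compact_norm_bound[OF D continuous_on_diff[OF contF[of 1] contF[of 0]]] by auto
  obtain W where W: "W > 0" "\<And>p. p \<in> D \<Longrightarrow> norm (w p) \<le> W"
    using continuous_on_compact_norm_bound[OF D w] by auto
  \<comment> \<open>\<open>V\<close> bounds 1 / w and \<open>W\<close> bounds w; they convert
    between uniform and weighted estimates.\<close>
  obtain V where V: "V > 0" "\<And>p. p \<in> D \<Longrightarrow> norm (1 / w p) \<le> V"
    by (rule continuous_on_compact_norm_bound[OF D, of "\<lambda>p. 1 / w p"])
       (use pos w in \<open>force intro!: continuous_intros\<close>)+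
  have wV: "1 \<le> V * w p" if "p \<in> D" for p
    using V(2)[OF that] pos[OF that] by (simp add: field_simps)
  have step: "\<bar>F (Suc n) p - F n p\<bar> \<le> B * V / 2 ^ n * w p" if "p \<in> D" for n p
    using that
  proof (induction n arbitrary: p)
    case 0
    have "\<bar>F 1 p - F 0 p\<bar> \<le> B * 1" using B(2)[OF 0] by simp
    also have "\<dots> \<le> B * (V * w p)" using wV[OF 0] B(1) by (intro mult_left_mono) auto
    finally show ?case by (simp add: mult.assoc)
  next
    case (Suc n)
    have "\<bar>T (F (Suc n)) p - T (F n) p\<bar> \<le> (B * V / 2 ^ n) / 2 * w p"
      using B(1) V(1) Suc by (intro contr contF) auto
    then show ?case by (simp add: F_Suc mult.commute)
  qed
  have bound: "norm (F (Suc n) p - F n p) \<le> B * V * W * (1 / 2) ^ n" if "p \<in> D" for n p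
  proof -
    have "norm (F (Suc n) p - F n p) \<le> B * V / 2 ^ n * w p" using step[OF that] by simp
    also have "\<dots> \<le> B * V / 2 ^ n * W"
      using W(2)[OF that] B(1) V(1) by (intro mult_left_mono) auto
    finally show ?thesis by (simp add: field_simps)
  qed
  define f where "f p = suminf (\<lambda>i. F (Suc i) p - F i p)" for p
  have "uniform_limit D (\<lambda>n p. \<Sum>i<n. F (Suc i) p - F i p) f sequentially"
    unfolding f_def
    by (rule Weierstrass_m_test[OF bound]) (auto intro!: summable_mult summable_geometric)
  moreover have "(\<lambda>n p. \<Sum>i<n. F (Suc i) p - F i p) = F"
  proof (intro ext)
    show "(\<Sum>i<n. F (Suc i) p - F i p) = F n p" for n p
      using sum_lessThan_telescope[of "\<lambda>i. F i p" n] by (simp add: F_def)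
  qed
  ultimately have ul: "uniform_limit D F f sequentially"
    by metis
  have contf: "continuous_on D f"
    by (rule uniform_limit_theorem[OF _ ul]) (auto simp: contF)
  have "\<bar>f p - T f p\<bar> \<le> e" if p: "p \<in> D" and e: "e > 0" for p e
  proof -
    \<comment> \<open>The distance \<open>e'\<close> of the iterate from the limit and its image
      under \<open>T\<close>, at most e' V W, must add up to e.\<close>
    define e' where "e' = e / (1 + V * W)"
    have e': "e' > 0" using e V(1) W(1) by (simp add: e'_def add_pos_pos)
    obtain n where n: "\<And>k p. k \<ge> n \<Longrightarrow> p \<in> D \<Longrightarrow> \<bar>F k p - f p\<bar> < e'"
      using uniform_limitD[OF ul e'] unfolding eventually_sequentially dist_real_def by blast
    have "\<bar>f p - F n p\<bar> \<le> e' * V * w p" if "p \<in> D" for p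
    proof -
      have "\<bar>f p - F n p\<bar> \<le> e' * 1" using n[OF order_refl that] by (simp add: abs_minus_commute)
      also have "\<dots> \<le> e' * (V * w p)" using wV[OF that] e' by (intro mult_left_mono) auto
      finally show ?thesis by (simp add: mult.assoc)
    qed
    then have "\<bar>T f p - T (F n) p\<bar> \<le> (e' * V) / 2 * w p"
      using e' V(1) p by (intro contr contf contF) auto
    also have "\<dots> \<le> (e' * V) * W"
      using W(2)[OF p] e' V(1) pos[OF p] by (intro mult_mono) auto
    finally have "\<bar>T f p - T (F n) p\<bar> \<le> e' * V * W" .
    moreover have "\<bar>F (Suc n) p - f p\<bar> < e'" using n[of "Suc n"] p by simp
    ultimately have "\<bar>f p - T f p\<bar> \<le> e' + e' * V * W"
      unfolding F_Suc by linarith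
    also have "\<dots> = e' * (1 + V * W)" by (simp add: algebra_simps)
    also have "\<dots> = e" using V(1) W(1) by (simp add: e'_def add_pos_pos less_imp_neq[symmetric])
    finally show ?thesis .
  qed
  then have "f p = T f p" if "p \<in> D" for p
    using that field_le_epsilon[of "\<bar>f p - T f p\<bar>" 0] by force
  with contf show thesis by (rule that)
qed

lemma has_integral_exp_linear:
  fixes c :: real
  assumes "c \<noteq> 0" "a \<le> b"
  shows "((\<lambda>t. exp (c * t)) has_integral (exp (c * b) - exp (c * a)) / c) {a..b}"
  unfolding diff_divide_distrib
  by (rule fundamental_theorem_of_calculus[OF assms(2)])
     (use assms(1) in \<open>auto intro!: derivative_eq_intros
        simp flip: has_real_derivative_iff_has_vector_derivative\<close>)

text \<open>Integrating the exponential gains 1 / N only against a bounded weight. As q is merely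
  integrable, the gain has to be pointwise: it comes from the factor x - t, because u exp (- N u)
  \<le> 1 / N.\<close>

lemma norm_integral_weighted:
  fixes g :: "real \<Rightarrow> 'b::euclidean_space"
  assumes q: "q absolutely_integrable_on {0..b}" and x: "x \<in> {0..b}" and N: "N > 0" and M: "M \<ge> 0"
    and g: "continuous_on {0..x} g" "\<And>t. t \<in> {0..x} \<Longrightarrow> norm (g t) \<le> (x - t) * (M * exp (N * t))"
  shows "norm (integral {0..x} (\<lambda>t. q t *\<^sub>R g t)) \<le> M * exp (N * x) / N * integral {0..b} (\<lambda>t. \<bar>q t\<bar>)"
proof -
  have q': "q absolutely_integrable_on {0..x}"
    by (rule absolutely_integrable_on_subinterval[OF q]) (use x in auto)
  have qb: "(\<lambda>t. \<bar>q t\<bar>) integrable_on {0..b}" and qx: "(\<lambda>t. \<bar>q t\<bar>) integrable_on {0..x}"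
    using q q' by (simp_all add: absolutely_integrable_on_def)
  have "norm (integral {0..x} (\<lambda>t. q t *\<^sub>R g t)) \<le> integral {0..x} (\<lambda>t. M * exp (N * x) / N * \<bar>q t\<bar>)"
  proof (rule Henstock_Kurzweil_Integration.integral_norm_bound_integral)
    show "(\<lambda>t. q t *\<^sub>R g t) integrable_on {0..x}"
      using absolutely_integrable_scaleR_continuous[OF q' g(1)] by (simp add: absolutely_integrable_on_def)
    show "(\<lambda>t. M * exp (N * x) / N * \<bar>q t\<bar>) integrable_on {0..x}"
      using qx by (intro integrable_on_mult_right)
    fix t assume t: "t \<in> {0..x}"
    have "N * (x - t) \<le> exp (N * (x - t))"
      using exp_ge_add_one_self[of "N * (x - t)"] by linarith
    then have "N * (x - t) * exp (N * t) \<le> exp (N * (x - t)) * exp (N * t)"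
      by (intro mult_right_mono) auto
    also have "\<dots> = exp (N * x)"
      by (simp add: algebra_simps flip: exp_add)
    finally have "(x - t) * exp (N * t) \<le> exp (N * x) / N"
      using N by (simp add: field_simps)
    then have "M * ((x - t) * exp (N * t)) \<le> M * (exp (N * x) / N)"
      using M by (rule mult_left_mono)
    then have "norm (g t) \<le> M * exp (N * x) / N"
      using g(2)[OF t] by (simp add: algebra_simps)
    then have "\<bar>q t\<bar> * norm (g t) \<le> \<bar>q t\<bar> * (M * exp (N * x) / N)"
      by (rule mult_left_mono) simp
    then show "norm (q t *\<^sub>R g t) \<le> M * exp (N * x) / N * \<bar>q t\<bar>"
      by (simp add: mult.commute)
  qed
  also have "\<dots> = M * exp (N * x) / N * integral {0..x} (\<lambda>t. \<bar>q t\<bar>)"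
    by simp
  also have "\<dots> \<le> M * exp (N * x) / N * integral {0..b} (\<lambda>t. \<bar>q t\<bar>)"
    using M N x qb qx by (intro mult_left_mono integral_subset_le) auto
  finally show ?thesis .
qed

section \<open>Continuity of parameter integrals and Fubini's theorem with an integrable
  weight\<close>

lemma continuous_on_integral_weighted_param:
  fixes F :: "'p::metric_space \<Rightarrow> real \<Rightarrow> real"
  assumes P: "compact P" and q: "q absolutely_integrable_on {a..b}"
    and F: "continuous_on (P \<times> {a..b}) (\<lambda>(p, t). F p t)"
  shows "continuous_on P (\<lambda>p. integral {a..b} (\<lambda>t. q t * F p t))"
  unfolding continuous_on_iff
proof (intro ballI allI impI)
  fix p e assume p: "p \<in> P" and e: "(e::real) > 0"
  define I where "I = integral {a..b} (\<lambda>t. \<bar>q t\<bar>)"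
  have qi: "(\<lambda>t. \<bar>q t\<bar>) integrable_on {a..b}"
    using q by (simp add: absolutely_integrable_on_def)
  have I: "I \<ge> 0" unfolding I_def by (rule Henstock_Kurzweil_Integration.integral_nonneg[OF qi]) auto
  have contF: "continuous_on {a..b} (F p)" if "p \<in> P" for p
    using continuous_on_compose2[OF F, of "{a..b}" "\<lambda>t. (p, t)"] that
    by (simp add: continuous_on_Pair continuous_on_id continuous_on_const image_subset_iff)
  have int: "(\<lambda>t. q t * F p t) integrable_on {a..b}" if "p \<in> P" for p
    using absolutely_integrable_scaleR_continuous[OF q contF[OF that]]
    by (simp add: absolutely_integrable_on_def)
  have "uniformly_continuous_on (P \<times> {a..b}) (\<lambda>(p, t). F p t)"
    by (rule compact_uniformly_continuous[OF F]) (intro compact_Times P compact_Icc)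
  then obtain d where d: "d > 0"
    "\<And>u v. u \<in> P \<times> {a..b} \<Longrightarrow> v \<in> P \<times> {a..b} \<Longrightarrow> dist v u < d \<Longrightarrow>
       dist ((\<lambda>(p, t). F p t) v) ((\<lambda>(p, t). F p t) u) < e / (I + 1)"
    unfolding uniformly_continuous_on_def using e I by (metis add_nonneg_pos divide_pos_pos zero_less_one)
  have "dist (integral {a..b} (\<lambda>t. q t * F p' t)) (integral {a..b} (\<lambda>t. q t * F p t)) < e"
    if p': "p' \<in> P" "dist p' p < d" for p'
  proof -
    have "dist (integral {a..b} (\<lambda>t. q t * F p' t)) (integral {a..b} (\<lambda>t. q t * F p t))
        = norm (integral {a..b} (\<lambda>t. q t * F p' t - q t * F p t))"
      using int p p' by (simp add: dist_norm Henstock_Kurzweil_Integration.integral_diff)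
    also have "\<dots> \<le> integral {a..b} (\<lambda>t. e / (I + 1) * \<bar>q t\<bar>)"
    proof (rule Henstock_Kurzweil_Integration.integral_norm_bound_integral)
      show "(\<lambda>t. q t * F p' t - q t * F p t) integrable_on {a..b}"
        by (intro Henstock_Kurzweil_Integration.integrable_diff int p p')
      show "(\<lambda>t. e / (I + 1) * \<bar>q t\<bar>) integrable_on {a..b}"
        using qi by (rule integrable_on_mult_right)
      fix t assume t: "t \<in> {a..b}"
      have "\<bar>F p' t - F p t\<bar> \<le> e / (I + 1)"
        using d(2)[of "(p, t)" "(p', t)"] p p' t by (simp add: dist_Pair_Pair dist_real_def)
      then have "\<bar>q t\<bar> * \<bar>F p' t - F p t\<bar> \<le> \<bar>q t\<bar> * (e / (I + 1))"
        by (rule mult_left_mono) simp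
      then show "norm (q t * F p' t - q t * F p t) \<le> e / (I + 1) * \<bar>q t\<bar>"
        by (simp add: mult.commute flip: right_diff_distrib abs_mult)
    qed
    also have "\<dots> = e * (I / (I + 1))" by (simp add: I_def)
    also have "\<dots> < e * 1" using e I by (intro mult_strict_left_mono) auto
    finally show ?thesis by simp
  qed
  with d(1) show "\<exists>d>0. \<forall>p'\<in>P. dist p' p < d \<longrightarrow>
      dist (integral {a..b} (\<lambda>t. q t * F p' t)) (integral {a..b} (\<lambda>t. q t * F p t)) < e"
    by blast
qed

lemma integral_affine_unit:
  fixes f :: "real \<Rightarrow> real"
  assumes "u \<le> v" "continuous_on {u..v} f"
  shows "integral {u..v} f = (v - u) * integral {0..1} (\<lambda>\<theta>. f (u + \<theta> * (v - u)))"
proof -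
  have *: "u + \<theta> * (v - u) \<in> {u..v}" if "\<theta> \<in> {0..1}" for \<theta>
  proof -
    have "\<theta> * (v - u) \<le> 1 * (v - u)" using assms(1) that by (intro mult_right_mono) auto
    then show ?thesis using assms(1) that by simp
  qed
  have "((\<lambda>\<theta>. (v - u) *\<^sub>R f (u + \<theta> * (v - u))) has_integral
      integral {u + 0 * (v - u)..u + 1 * (v - u)} f) {0..1}"
    using assms * by (intro has_integral_substitution[where c = u and d = v])
      (auto intro!: derivative_eq_intros)
  then show ?thesis
    by (simp add: has_integral_iff)
qed

text \<open>The substitution s = l + \<theta> (u - l) moves the integral to the fixed interval
  [0,1]. Thus \<open>f\<close> is needed only between the bounds, and kernels on triangles never
  have to be extended continuously.\<close>

lemma continuous_on_integral_bounds:
  fixes f :: "'p::topological_space \<Rightarrow> real \<Rightarrow> real"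
  assumes l: "continuous_on S l" and u: "continuous_on S u"
    and le: "\<And>p. p \<in> S \<Longrightarrow> l p \<le> u p"
    and f: "continuous_on {(p, s). p \<in> S \<and> l p \<le> s \<and> s \<le> u p} (\<lambda>(p, s). f p s)"
  shows "continuous_on S (\<lambda>p. integral {l p..u p} (f p))"
proof -
  have mem: "l p + \<theta> * (u p - l p) \<in> {l p..u p}" if "p \<in> S" "\<theta> \<in> {0..1}" for p \<theta>
  proof -
    have "\<theta> * (u p - l p) \<le> 1 * (u p - l p)" using le that by (intro mult_right_mono) auto
    then show ?thesis using le that by simp
  qed
  have "continuous_on (S \<times> cbox 0 1) (\<lambda>x. (\<lambda>(p, s). f p s) (fst x, l (fst x) + snd x * (u (fst x) - l (fst x))))"
    by (rule continuous_on_compose2[OF f])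
       (use mem in \<open>force intro!: continuous_intros continuous_on_compose2[OF l] continuous_on_compose2[OF u]\<close>)+
  then have "continuous_on (S \<times> cbox 0 1) (\<lambda>(p, \<theta>). f p (l p + \<theta> * (u p - l p)))"
    by (simp add: case_prod_unfold)
  then have "continuous_on S (\<lambda>p. integral (cbox 0 1) (\<lambda>\<theta>. f p (l p + \<theta> * (u p - l p))))"
    by (rule integral_continuous_on_param)
  then have "continuous_on S (\<lambda>p. (u p - l p) * integral {0..1} (\<lambda>\<theta>. f p (l p + \<theta> * (u p - l p))))"
    by (intro continuous_intros l u) simp
  then show ?thesis
  proof (rule continuous_on_eq)
    fix p assume p: "p \<in> S"
    have "continuous_on {l p..u p} (\<lambda>s. (\<lambda>(p, s). f p s) (p, s))"
      by (rule continuous_on_compose2[OF f]) (use p in \<open>auto intro!: continuous_intros\<close>)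
    then show "(u p - l p) * integral {0..1} (\<lambda>\<theta>. f p (l p + \<theta> * (u p - l p))) = integral {l p..u p} (f p)"
      using integral_affine_unit[OF le[OF p], of "f p"] by simp
  qed
qed

text \<open>The weight \<open>q\<close> is only Lebesgue measurable, whereas Fubini's theorem is
  applied to the product of \<open>lborel\<close> with itself; so \<open>q\<close> is replaced by a
  Borel function equal to it almost everywhere. The cut-offs of the applications are built into
  \<open>G\<close>, which is why \<open>G\<close> is Borel and bounded on the whole plane.\<close>

lemma integral_swap_weighted:
  fixes G :: "real \<Rightarrow> real \<Rightarrow> real"
  assumes q: "q absolutely_integrable_on {a..b}"
    and G: "(\<lambda>(t, s). G t s) \<in> borel_measurable borel" and B: "\<And>t s. \<bar>G t s\<bar> \<le> B"
  shows "integral {a..b} (\<lambda>t. q t * integral {c..d} (G t)) =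
    integral {c..d} (\<lambda>s. integral {a..b} (\<lambda>t. q t * G t s))"
proof -
  have G2 [measurable]: "(\<lambda>(t, s). G t s) \<in> borel_measurable (lborel \<Otimes>\<^sub>M lborel)"
    using G by (simp add: borel_prod cong: measurable_cong_sets) (metis borel_prod measurable_cong_sets sets_lborel sets_pair_measure_cong)
  have G1 [measurable]: "G t \<in> borel_measurable borel" "(\<lambda>t. G t s) \<in> borel_measurable borel" for t s
    using measurable_compose[OF measurable_Pair1' G2, of t] measurable_compose[OF measurable_Pair2' G2, of s]
    by auto
  have intq: "integrable lebesgue (\<lambda>t. indicator {a..b} t * q t)"
    using q by (simp add: set_integrable_def)
  then obtain q' where q' [measurable]: "q' \<in> borel_measurable lborel"
    and ae: "AE t in lborel. indicator {a..b} t * q t = q' t"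
    using completion_ex_borel_measurable_real[OF borel_measurable_integrable] by blast
  have ae': "AE t in lebesgue. indicator {a..b} t * q t = q' t"
    using ae by (rule AE_completion)
  have "integrable lebesgue q'"
    using intq ae' q' by (subst integrable_cong_AE[symmetric]) (auto intro: measurable_completion)
  then have intq': "integrable lborel q'"
    by (simp add: integrable_completion)
  have q_eq: "integral {a..b} (\<lambda>t. q t * g t) = (LINT t|lborel. q' t * g t)"
    if [measurable]: "g \<in> borel_measurable borel" and g: "\<And>t. \<bar>g t\<bar> \<le> C" for g C
  proof -
    have int: "integrable lborel (\<lambda>t. q' t * g t)"
      by (rule Bochner_Integration.integrable_bound[OF integrable_mult_left[OF intq', of C]])
         (auto simp: abs_mult intro!: AE_I2 mult_left_mono order_trans[OF g abs_ge_self])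
    then have int': "integrable lebesgue (\<lambda>t. q' t * g t)"
      by (simp add: integrable_completion)
    have ae2: "AE t in lebesgue. indicator {a..b} t *\<^sub>R (q t * g t) = q' t * g t"
      using ae' by eventually_elim (simp flip: mult.assoc)
    have meas: "(\<lambda>t. indicator {a..b} t *\<^sub>R (q t * g t)) \<in> borel_measurable lebesgue"
    proof -
      have "(\<lambda>t. (indicator {a..b} t * q t) * g t) \<in> borel_measurable lebesgue"
        by (intro borel_measurable_times borel_measurable_integrable[OF intq] measurable_completion) simp
      then show ?thesis by (simp add: mult.assoc)
    qed
    have "integrable lebesgue (\<lambda>t. indicator {a..b} t *\<^sub>R (q t * g t))"
      using int' ae2 meas by (subst integrable_cong_AE) auto
    then have "integral {a..b} (\<lambda>t. q t * g t) = (LINT t|lebesgue. indicator {a..b} t *\<^sub>R (q t * g t))"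
      using set_lebesgue_integral_eq_integral(2)[of "{a..b}" "\<lambda>t. q t * g t"]
      by (simp add: set_integrable_def set_lebesgue_integral_def)
    also have "\<dots> = (LINT t|lebesgue. q' t * g t)"
      using ae2 meas int' by (intro integral_cong_AE) auto
    also have "\<dots> = (LINT t|lborel. q' t * g t)"
      by (simp add: integral_completion)
    finally show ?thesis .
  qed
  have ind: "integrable lborel (indicat_real {c..d})"
    by (rule integrable_real_indicator) (auto simp: emeasure_lborel_Icc_eq)
  have s_eq: "integral {c..d} g = (LINT s|lborel. indicator {c..d} s * g s)"
    if [measurable]: "g \<in> borel_measurable borel" and g: "\<And>t. \<bar>g t\<bar> \<le> C" for g :: "real \<Rightarrow> real" and C
  proof -
    have "integrable lborel (\<lambda>s. indicator {c..d} s * C)"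
      by (intro integrable_mult_left ind)
    then have "set_integrable lborel {c..d} g"
      unfolding set_integrable_def
      by (rule Bochner_Integration.integrable_bound)
         (auto simp: indicator_def intro!: AE_I2 order_trans[OF g abs_ge_self])
    then show ?thesis
      using set_borel_integral_eq_integral(2)[of "{c..d}" g] by (simp add: set_lebesgue_integral_def)
  qed
  define F where "F t s = q' t * (indicator {c..d} s * G t s)" for t s
  have B0: "B \<ge> 0" using B[of 0 0] by linarith
  have "integrable (lborel \<Otimes>\<^sub>M lborel) (\<lambda>(t, s). q' t * (indicator {c..d} s * B))"
  proof (rule lborel_pair.Fubini_integrable)
    show "integrable lborel (\<lambda>t. LINT s|lborel. norm ((\<lambda>(t, s). q' t * (indicator {c..d} s * B)) (t, s)))"
      using intq' by (simp add: abs_mult)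
  qed (use ind in auto)
  then have intF: "integrable (lborel \<Otimes>\<^sub>M lborel) (case_prod F)"
  proof (rule Bochner_Integration.integrable_bound)
    show "case_prod F \<in> borel_measurable (lborel \<Otimes>\<^sub>M lborel)"
      unfolding F_def by measurable
    show "AE x in lborel \<Otimes>\<^sub>M lborel. norm (case_prod F x) \<le> norm ((\<lambda>(t, s). q' t * (indicator {c..d} s * B)) x)"
      using B0 by (auto simp: F_def abs_mult indicator_def intro!: AE_I2 mult_left_mono B)
  qed
  have intB: "integrable lborel (\<lambda>s. indicator {c..d} s * B)"
    by (intro integrable_mult_left ind)
  have intG: "integrable lborel (\<lambda>s. indicator {c..d} s * G t s)" for t
    by (rule Bochner_Integration.integrable_bound[OF intB])
       (auto simp: indicator_def intro!: AE_I2 order_trans[OF B abs_ge_self])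
  have bd1: "\<bar>LINT s|lborel. indicator {c..d} s * G t s\<bar> \<le> (LINT s|lborel. indicator {c..d} s * B)" for t
    by (rule integral_abs_bound_integral[OF intG intB]) (auto simp: indicator_def B)
  have intq'B: "integrable lborel (\<lambda>t. \<bar>q' t\<bar> * B)"
    using intq' by (intro integrable_mult_left) auto
  have bd2: "\<bar>LINT t|lborel. q' t * G t s\<bar> \<le> (LINT t|lborel. \<bar>q' t\<bar> * B)" for s
    by (rule integral_abs_bound_integral[OF _ intq'B])
       (auto simp: abs_mult intro!: Bochner_Integration.integrable_bound[OF intq'B] AE_I2 mult_left_mono
          order_trans[OF B abs_ge_self] B)
  have "integral {a..b} (\<lambda>t. q t * integral {c..d} (G t))
      = integral {a..b} (\<lambda>t. q t * (LINT s|lborel. indicator {c..d} s * G t s))"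
    by (subst s_eq[OF G1(1) B]) simp
  also have "\<dots> = (LINT t|lborel. q' t * (LINT s|lborel. indicator {c..d} s * G t s))"
    by (rule q_eq[OF _ bd1]) measurable
  also have "\<dots> = (LINT t|lborel. (LINT s|lborel. F t s))"
    by (simp add: F_def)
  also have "\<dots> = (LINT s|lborel. (LINT t|lborel. F t s))"
    by (rule lborel_pair.Fubini_integral[OF intF, symmetric])
  also have "\<dots> = (LINT s|lborel. indicator {c..d} s * (LINT t|lborel. q' t * G t s))"
    unfolding F_def by (simp add: mult.left_commute[of "q' _"])
  also have "\<dots> = integral {c..d} (\<lambda>s. LINT t|lborel. q' t * G t s)"
    by (rule s_eq[OF _ bd2, symmetric]) measurable
  also have "\<dots> = integral {c..d} (\<lambda>s. integral {a..b} (\<lambda>t. q t * G t s))"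
    by (subst q_eq[OF G1(2) B]) simp
  finally show ?thesis .
qed

section \<open>The transformation operator\<close>

lemma sin_sqrt_minus [simp]: "sin_sqrt \<mu> (- x) = - sin_sqrt \<mu> x"
  by (simp add: sin_sqrt_def)

lemma cos_sqrt_minus [simp]: "cos_sqrt \<mu> (- x) = cos_sqrt \<mu> x"
  by (simp add: cos_sqrt_def)

lemma borel_measurable_cos_sqrt [measurable]: "cos_sqrt \<mu> \<in> borel_measurable borel"
  by (intro borel_measurable_continuous_onI continuous_intros)

definition lower_triangle :: "real \<Rightarrow> (real \<times> real) set" where
  "lower_triangle b = {(x, t). 0 \<le> t \<and> t \<le> x \<and> x \<le> b}"

text \<open>A kernel with two-sided argument r is the natural unknown: the interval [s - w, s + w]
  produced by the product formula may reach below 0. Evenness of \<open>cos_sqrt\<close> later folds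
  the kernel onto \<open>lower_triangle\<close>.\<close>

definition double_triangle :: "real \<Rightarrow> (real \<times> real) set" where
  "double_triangle b = {(x, r). \<bar>r\<bar> \<le> x \<and> x \<le> b}"

lemma compact_double_triangle: "compact (double_triangle b)"
proof -
  have "double_triangle b = ({0..b} \<times> {-b..b}) \<inter> {p. \<bar>snd p\<bar> \<le> fst p}"
    by (auto simp: double_triangle_def)
  moreover have "closed {p :: real \<times> real. \<bar>snd p\<bar> \<le> fst p}"
    by (intro closed_Collect_le continuous_intros)
  ultimately show ?thesis
    by (simp add: compact_Int_closed compact_Times)
qed

lemma compact_lower_triangle: "compact (lower_triangle b)"
proof -
  have "lower_triangle b = ({0..b} \<times> {0..b}) \<inter> {p. snd p \<le> fst p}"
    by (auto simp: lower_triangle_def)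
  moreover have "closed {p :: real \<times> real. snd p \<le> fst p}"
    by (intro closed_Collect_le continuous_intros)
  ultimately show ?thesis
    by (simp add: compact_Int_closed compact_Times)
qed

lemma integral_Icc_if:
  fixes f :: "real \<Rightarrow> 'a::banach"
  assumes "{c..d} \<subseteq> {a..b}"
  shows "integral {a..b} (\<lambda>t. if c \<le> t \<and> t \<le> d then f t else 0) = integral {c..d} f"
proof -
  have "integral {a..b} (\<lambda>t. if t \<in> {c..d} then f t else 0) = integral {c..d} f"
    by (simp only: integral_restrict_Int Int_absorb2[OF assms])
  then show ?thesis by simp
qed

lemma integral_Icc_initial:
  fixes f :: "real \<Rightarrow> 'a::banach"
  assumes "x \<in> {0..b}" "\<And>t. x < t \<Longrightarrow> t \<le> b \<Longrightarrow> f t = 0"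
  shows "integral {0..b} f = integral {0..x} f"
proof -
  have "integral {0..b} f = integral {0..b} (\<lambda>t. if 0 \<le> t \<and> t \<le> x then f t else 0)"
    using assms by (intro integral_cong) auto
  also have "\<dots> = integral {0..x} f"
    using assms(1) by (intro integral_Icc_if) auto
  finally show ?thesis .
qed

lemma abs_integral_le:
  fixes f :: "real \<Rightarrow> real"
  assumes "a \<le> b" "continuous_on {a..b} f" "\<And>s. s \<in> {a..b} \<Longrightarrow> \<bar>f s\<bar> \<le> B"
  shows "\<bar>integral {a..b} f\<bar> \<le> (b - a) * B"
  using integral_bound[OF assms(1,2), of B] assms(3) by (simp add: mult.commute)

text \<open>The fixed point equation results from inserting the ansatz
  \<open>\<psi> x = cos_sqrt \<mu> x + \<integral> K (x, r) * cos_sqrt \<mu> r dr\<close> over \<open>[-x, x]\<close> into the Volterra equation of the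
  Sturm--Liouville problem: \<open>sin_sqrt \<mu> w * cos_sqrt \<mu> s\<close> is half the integral of \<open>cos_sqrt \<mu>\<close> over
  \<open>[s - w, s + w]\<close>, so \<open>\<mu>\<close> drops out. It is a contraction for the weight \<open>exp (N x)\<close>, since
  \<open>u exp (- N u) \<le> 1 / N\<close>.\<close>

lemma goursat_kernel_exists:
  fixes q :: "real \<Rightarrow> real" and h b :: real
  assumes q: "q absolutely_integrable_on {0..b}"
  obtains K where "continuous_on (double_triangle b) K"
    "\<And>x r. (x, r) \<in> double_triangle b \<Longrightarrow> K (x, r) = h / 2 + integral {0..(x + r) / 2} q / 2 +
       integral {0..x} (\<lambda>t. q t * integral {max (- t) (r - (x - t))..min t (r + (x - t))} (\<lambda>s. K (t, s))) / 2"
proof -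
  let ?D = "double_triangle b"
  \<comment> \<open>The truncation \<open>max 0 (x - t)\<close> makes the window degenerate as soon
    as t \<ge> x, since |r| \<le> x. The inner integral then vanishes, and the outer one may run
    over the fixed interval [0,b], for which continuity in (x, r) is available.\<close>
  define lo where "lo = (\<lambda>((x, r), t). max (- t) (r - max 0 (x - t)) :: real)"
  define up where "up = (\<lambda>((x, r), t). min t (r + max 0 (x - t)) :: real)"
  define I where "I K p t = integral {lo (p, t)..up (p, t)} (\<lambda>s. K (t, s))"
    for K :: "real \<times> real \<Rightarrow> real" and p :: "real \<times> real" and t :: real
  define Tr where "Tr K = (\<lambda>(x, r). h / 2 + integral {0..(x + r) / 2} q / 2 +
      integral {0..b} (\<lambda>t. q t * I K (x, r) t) / 2)" for K
  \<comment> \<open>The window has length at most 2 (x - t) and \<open>Tr\<close> carries a factor 1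
    / 2, so the contraction factor is the integral of |q| divided by N. Adding 1 keeps N positive
    when q vanishes.\<close>
  define N where "N = 2 * integral {0..b} (\<lambda>t. \<bar>q t\<bar>) + 1"
  have qi: "(\<lambda>t. \<bar>q t\<bar>) integrable_on {0..b}" and q1: "q integrable_on {0..b}"
    using q by (simp_all add: absolutely_integrable_on_def)
  have N: "N > 0" unfolding N_def
    using Henstock_Kurzweil_Integration.integral_nonneg[OF qi] by (simp add: add_nonneg_pos)
  have le: "lo (p, t) \<le> up (p, t)" if "p \<in> ?D" "t \<in> {0..b}" for p t
    using that by (auto simp: lo_def up_def double_triangle_def max_def min_def abs_if split: if_splits)
  have mem: "(t, s) \<in> ?D" if "p \<in> ?D" "t \<in> {0..b}" "s \<in> {lo (p, t)..up (p, t)}" for p t s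
    using that by (auto simp: lo_def up_def double_triangle_def)
  have zero: "lo ((x, r), t) = up ((x, r), t)" if "(x, r) \<in> ?D" "x \<le> t" for x r t
    using that by (auto simp: lo_def up_def double_triangle_def)
  have contK: "continuous_on {lo (p, t)..up (p, t)} (\<lambda>s. K (t, s))"
    if "continuous_on ?D K" "p \<in> ?D" "t \<in> {0..b}" for K p t
    by (rule continuous_on_compose2[OF that(1)])
       (use mem[OF that(2,3)] in \<open>auto intro!: continuous_intros\<close>)
  have contI: "continuous_on (?D \<times> {0..b}) (\<lambda>(p, t). I K p t)" if K: "continuous_on ?D K" for K
  proof -
    have "continuous_on (?D \<times> {0..b}) (\<lambda>z. integral {lo z..up z} ((\<lambda>z s. K (snd z, s)) z))"
    proof (rule continuous_on_integral_bounds)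
      show "continuous_on (?D \<times> {0..b}) lo" "continuous_on (?D \<times> {0..b}) up"
        unfolding lo_def up_def case_prod_unfold by (intro continuous_intros)+
      show "continuous_on {(z, s). z \<in> ?D \<times> {0..b} \<and> lo z \<le> s \<and> s \<le> up z} (\<lambda>(z, s). K (snd z, s))"
        unfolding case_prod_unfold
        by (rule continuous_on_compose2[OF K]) (use mem in \<open>force intro!: continuous_intros\<close>)+
    qed (use le in auto)
    then show ?thesis by (simp add: I_def case_prod_unfold)
  qed
  have contIt: "continuous_on {0..b} (I K p)" if "continuous_on ?D K" "p \<in> ?D" for K p
    using continuous_on_compose2[OF contI[OF that(1)], of "{0..b}" "\<lambda>t. (p, t)"] that(2)
    by (simp add: continuous_on_Pair continuous_on_id continuous_on_const image_subset_iff)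
  have contQ: "continuous_on {0..b} (\<lambda>x. integral {0..x} q)"
    by (rule indefinite_integral_continuous_1[OF q1])
  have cont: "continuous_on ?D (Tr K)" if K: "continuous_on ?D K" for K
  proof -
    have "continuous_on ?D (\<lambda>p. integral {0..(fst p + snd p) / 2} q)"
      by (rule continuous_on_compose2[OF contQ])
         (auto intro!: continuous_intros simp: double_triangle_def)
    then have "continuous_on ?D (\<lambda>p. h / 2 + integral {0..(fst p + snd p) / 2} q / 2 +
        integral {0..b} (\<lambda>t. q t * I K p t) / 2)"
      by (intro continuous_intros continuous_on_integral_weighted_param[OF compact_double_triangle q]
          contI K) simp_all
    then show ?thesis by (simp add: Tr_def case_prod_unfold)
  qed
  have init: "integral {0..b} (\<lambda>t. q t * I K (x, r) t) = integral {0..x} (\<lambda>t. q t * I K (x, r) t)"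
    if "(x, r) \<in> ?D" for K x r
    using that zero[OF that] by (intro integral_Icc_initial) (auto simp: double_triangle_def I_def)
  have contr: "\<bar>Tr f p - Tr g p\<bar> \<le> M / 2 * exp (N * fst p)"
    if f: "continuous_on ?D f" and g: "continuous_on ?D g" and M: "0 \<le> M"
      and fg: "\<And>p. p \<in> ?D \<Longrightarrow> \<bar>f p - g p\<bar> \<le> M * exp (N * fst p)" and p: "p \<in> ?D" for f g M p
  proof -
    obtain x r where xr: "p = (x, r)" by fastforce
    have x: "x \<in> {0..b}" and xrD: "(x, r) \<in> ?D"
      using p xr by (auto simp: double_triangle_def)
    have sub: "{0..x} \<subseteq> {0..b}" using x by auto
    have qx: "q absolutely_integrable_on {0..x}"
      by (rule absolutely_integrable_on_subinterval[OF q sub])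
    have int: "(\<lambda>t. q t * I k p t) integrable_on {0..x}" if "continuous_on ?D k" for k
      using absolutely_integrable_scaleR_continuous[OF qx continuous_on_subset[OF contIt[OF that p] sub]]
      by (simp add: absolutely_integrable_on_def)
    have eq: "Tr f p - Tr g p = integral {0..x} (\<lambda>t. q t *\<^sub>R (I f p t - I g p t)) / 2"
      using init[OF xrD, of f] init[OF xrD, of g] int[OF f] int[OF g]
      by (simp add: Tr_def xr right_diff_distrib Henstock_Kurzweil_Integration.integral_diff
          flip: diff_divide_distrib)
    have bd: "norm (integral {0..x} (\<lambda>t. q t *\<^sub>R (I f p t - I g p t)))
        \<le> (2 * M) * exp (N * x) / N * integral {0..b} (\<lambda>t. \<bar>q t\<bar>)"
    proof (rule norm_integral_weighted[OF q x N])
      show "continuous_on {0..x} (\<lambda>t. I f p t - I g p t)"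
        using sub by (intro continuous_intros continuous_on_subset[OF contIt[OF f p]]
            continuous_on_subset[OF contIt[OF g p]])
      fix t assume t: "t \<in> {0..x}"
      then have tb: "t \<in> {0..b}" using x by auto
      have "I f p t - I g p t = integral {lo (p, t)..up (p, t)} (\<lambda>s. f (t, s) - g (t, s))"
        unfolding I_def
        by (rule Henstock_Kurzweil_Integration.integral_diff[symmetric])
           (intro integrable_continuous_real contK f g p tb)+
      also have "\<bar>\<dots>\<bar> \<le> (up (p, t) - lo (p, t)) * (M * exp (N * t))"
        by (rule abs_integral_le[OF le[OF p tb]])
           (use contK[OF f p tb] contK[OF g p tb] fg mem[OF p tb] in \<open>force intro!: continuous_intros\<close>)+
      also have "\<dots> \<le> (2 * (x - t)) * (M * exp (N * t))"
        using t M xr by (intro mult_right_mono) (auto simp: lo_def up_def)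
      finally show "norm (I f p t - I g p t) \<le> (x - t) * (2 * M * exp (N * t))"
        by (simp add: algebra_simps)
    qed (use M in simp)
    have "\<bar>Tr f p - Tr g p\<bar> = norm (integral {0..x} (\<lambda>t. q t *\<^sub>R (I f p t - I g p t))) / 2"
      by (simp add: eq)
    also have "\<dots> \<le> ((2 * M) * exp (N * x) / N * integral {0..b} (\<lambda>t. \<bar>q t\<bar>)) / 2"
      by (rule divide_right_mono[OF bd]) simp
    also have "\<dots> = M * exp (N * x) * (integral {0..b} (\<lambda>t. \<bar>q t\<bar>) / N)"
      by simp
    also have "\<dots> \<le> M * exp (N * x) * (1 / 2)"
      using M N by (intro mult_left_mono) (auto simp: N_def field_simps)
    finally show ?thesis by (simp add: xr)
  qed
  have w: "continuous_on ?D (\<lambda>p. exp (N * fst p))"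
    by (intro continuous_intros)
  show thesis
  proof (rule weighted_contraction_fixpoint[OF compact_double_triangle w _ cont contr])
    fix K assume K: "continuous_on ?D K" "\<And>p. p \<in> ?D \<Longrightarrow> K p = Tr K p"
    have K_eq: "K (x, r) = h / 2 + integral {0..(x + r) / 2} q / 2 +
       integral {0..x} (\<lambda>t. q t * integral {max (- t) (r - (x - t))..min t (r + (x - t))} (\<lambda>s. K (t, s))) / 2"
      if xr: "(x, r) \<in> ?D" for x r
    proof -
      have "K (x, r) = Tr K (x, r)" by (rule K(2)[OF xr])
      also have "\<dots> = h / 2 + integral {0..(x + r) / 2} q / 2 + integral {0..x} (\<lambda>t. q t * I K (x, r) t) / 2"
        using init[OF xr, of K] by (simp add: Tr_def)
      also have "integral {0..x} (\<lambda>t. q t * I K (x, r) t) =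
          integral {0..x} (\<lambda>t. q t * integral {max (- t) (r - (x - t))..min t (r + (x - t))} (\<lambda>s. K (t, s)))"
        by (intro integral_cong) (simp add: I_def lo_def up_def)
      finally show ?thesis .
    qed
    show thesis by (rule that[OF K(1) K_eq])
  qed simp
qed

text \<open>Integrates \<open>cos_sqrt \<mu> r * k s\<close> over the pairs with |s - r| \<le> w in
  both orders. For fixed s the variable r fills [s - w, s + w], whence the product of sine and
  cosine. With w = x - t and k the row of K at t this treats the double integral in the Goursat
  equation.\<close>

lemma integral_window_cos_sqrt:
  fixes k :: "real \<Rightarrow> real"
  assumes k: "continuous_on {-t..t} k" and t: "0 \<le> t" and w: "0 \<le> w"
  shows "integral {-(t + w)..t + w} (\<lambda>r. cos_sqrt \<mu> r * integral {max (- t) (r - w)..min t (r + w)} k)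
    = 2 * sin_sqrt \<mu> w * integral {-t..t} (\<lambda>s. k s * cos_sqrt \<mu> s)"
proof -
  \<comment> \<open>For \<mu> < 0 the hyperbolic cosine is unbounded; restricting r makes
    \<open>G\<close> bounded on the whole plane, as the interchange requires.\<close>
  define G where "G s r = (if -(t + w) \<le> r \<and> r \<le> t + w \<and> \<bar>s - r\<bar> \<le> w then cos_sqrt \<mu> r else 0)" for s r
  have "continuous_on {-(t + w)..t + w} (cos_sqrt \<mu>)"
    using continuous_on_cos_sqrt[OF continuous_on_id] by simp
  then obtain B where B: "B > 0" "\<And>r. r \<in> {-(t + w)..t + w} \<Longrightarrow> norm (cos_sqrt \<mu> r) \<le> B"
    using continuous_on_compact_norm_bound[OF compact_Icc] by blast
  have "integral {-t..t} (\<lambda>s. k s * integral {-(t + w)..t + w} (G s))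
      = integral {-(t + w)..t + w} (\<lambda>r. integral {-t..t} (\<lambda>s. k s * G s r))"
  proof (rule integral_swap_weighted)
    show "k absolutely_integrable_on {-t..t}"
      using k by (rule absolutely_integrable_continuous_real)
    show "(\<lambda>(s, r). G s r) \<in> borel_measurable borel"
      unfolding G_def borel_prod[symmetric] by measurable
    show "\<bar>G s r\<bar> \<le> B" for s r
      using B by (auto simp: G_def)
  qed
  moreover have "integral {-t..t} (\<lambda>s. k s * integral {-(t + w)..t + w} (G s))
      = integral {-t..t} (\<lambda>s. 2 * sin_sqrt \<mu> w * (k s * cos_sqrt \<mu> s))"
  proof (rule integral_cong)
    fix s assume s: "s \<in> {-t..t}"
    have "integral {-(t + w)..t + w} (G s)
        = integral {-(t + w)..t + w} (\<lambda>r. if s - w \<le> r \<and> r \<le> s + w then cos_sqrt \<mu> r else 0)"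
      by (intro integral_cong) (auto simp: G_def)
    also have "\<dots> = integral {s - w..s + w} (cos_sqrt \<mu>)"
      using s by (intro integral_Icc_if) auto
    also have "\<dots> = 2 * (sin_sqrt \<mu> w * cos_sqrt \<mu> s)"
      unfolding sin_sqrt_times_cos_sqrt
      using integral_cos_sqrt[of "s - w" "s + w" \<mu>] w by (simp add: has_integral_iff)
    finally show "k s * integral {-(t + w)..t + w} (G s) = 2 * sin_sqrt \<mu> w * (k s * cos_sqrt \<mu> s)"
      by simp
  qed
  moreover have "integral {-(t + w)..t + w} (\<lambda>r. integral {-t..t} (\<lambda>s. k s * G s r))
      = integral {-(t + w)..t + w} (\<lambda>r. cos_sqrt \<mu> r * integral {max (- t) (r - w)..min t (r + w)} k)"
  proof (rule integral_cong)
    fix r assume r: "r \<in> {-(t + w)..t + w}"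
    have "integral {-t..t} (\<lambda>s. k s * G s r)
        = integral {-t..t} (\<lambda>s. if max (- t) (r - w) \<le> s \<and> s \<le> min t (r + w) then cos_sqrt \<mu> r * k s else 0)"
      using r by (intro integral_cong) (auto simp: G_def)
    also have "\<dots> = integral {max (- t) (r - w)..min t (r + w)} (\<lambda>s. cos_sqrt \<mu> r * k s)"
      by (intro integral_Icc_if) auto
    finally show "integral {-t..t} (\<lambda>s. k s * G s r)
        = cos_sqrt \<mu> r * integral {max (- t) (r - w)..min t (r + w)} k"
      by simp
  qed
  ultimately show ?thesis by simp
qed

text \<open>The condition t \<le> (x + r) / 2 reads 2 t - x \<le> r. After the interchange r
  therefore fills [2 t - x, x], the window of half-length x - t around t.\<close>

lemma integral_potential_cos_sqrt:
  assumes q: "q absolutely_integrable_on {0..x}" and x: "0 \<le> x"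
  shows "integral {-x..x} (\<lambda>r. integral {0..(x + r) / 2} q * cos_sqrt \<mu> r)
    = 2 * integral {0..x} (\<lambda>t. q t * (sin_sqrt \<mu> (x - t) * cos_sqrt \<mu> t))"
proof -
  define G where "G t r = (if -x \<le> r \<and> r \<le> x \<and> 2 * t - x \<le> r then cos_sqrt \<mu> r else 0)" for t r
  have "continuous_on {-x..x} (cos_sqrt \<mu>)"
    using continuous_on_cos_sqrt[OF continuous_on_id] by simp
  then obtain B where B: "B > 0" "\<And>r. r \<in> {-x..x} \<Longrightarrow> norm (cos_sqrt \<mu> r) \<le> B"
    using continuous_on_compact_norm_bound[OF compact_Icc] by blast
  have "integral {0..x} (\<lambda>t. q t * integral {-x..x} (G t)) = integral {-x..x} (\<lambda>r. integral {0..x} (\<lambda>t. q t * G t r))"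
  proof (rule integral_swap_weighted[OF q])
    show "(\<lambda>(s, r). G s r) \<in> borel_measurable borel"
      unfolding G_def borel_prod[symmetric] by measurable
    show "\<bar>G s r\<bar> \<le> B" for s r
      using B by (auto simp: G_def)
  qed
  moreover have "integral {0..x} (\<lambda>t. q t * integral {-x..x} (G t))
      = integral {0..x} (\<lambda>t. 2 * (q t * (sin_sqrt \<mu> (x - t) * cos_sqrt \<mu> t)))"
  proof (rule integral_cong)
    fix t assume t: "t \<in> {0..x}"
    have "integral {-x..x} (G t) = integral {-x..x} (\<lambda>r. if 2 * t - x \<le> r \<and> r \<le> x then cos_sqrt \<mu> r else 0)"
      by (intro integral_cong) (auto simp: G_def)
    also have "\<dots> = integral {2 * t - x..x} (cos_sqrt \<mu>)"
      using t by (intro integral_Icc_if) auto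
    also have "\<dots> = 2 * (sin_sqrt \<mu> (x - t) * cos_sqrt \<mu> t)"
      unfolding sin_sqrt_times_cos_sqrt
      using integral_cos_sqrt[of "2 * t - x" x \<mu>] t by (simp add: has_integral_iff algebra_simps)
    finally show "q t * integral {-x..x} (G t) = 2 * (q t * (sin_sqrt \<mu> (x - t) * cos_sqrt \<mu> t))"
      by simp
  qed
  moreover have "integral {-x..x} (\<lambda>r. integral {0..x} (\<lambda>t. q t * G t r))
      = integral {-x..x} (\<lambda>r. integral {0..(x + r) / 2} q * cos_sqrt \<mu> r)"
  proof (rule integral_cong)
    fix r assume r: "r \<in> {-x..x}"
    have "integral {0..x} (\<lambda>t. q t * G t r)
        = integral {0..x} (\<lambda>t. if 0 \<le> t \<and> t \<le> (x + r) / 2 then q t * cos_sqrt \<mu> r else 0)"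
      using r by (intro integral_cong) (auto simp: G_def)
    also have "\<dots> = integral {0..(x + r) / 2} (\<lambda>t. q t * cos_sqrt \<mu> r)"
      using r by (intro integral_Icc_if) auto
    finally show "integral {0..x} (\<lambda>t. q t * G t r) = integral {0..(x + r) / 2} q * cos_sqrt \<mu> r"
      by simp
  qed
  ultimately show ?thesis by simp
qed

text \<open>Multiply the kernel equation by \<open>cos_sqrt \<mu> r\<close> and integrate over
  [-x,x]. The constant yields \<open>h * sin_sqrt \<mu> x\<close>, the single integral yields the
  potential acting on the cosine, and the double integral yields the potential acting on the
  integral part of \<psi>.\<close>

lemma goursat_kernel_volterra:
  fixes \<mu> :: real and \<psi> :: "real \<Rightarrow> real"
  assumes q: "q absolutely_integrable_on {0..b}"
    and K: "continuous_on (double_triangle b) K"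
    and K_eq: "\<And>x r. (x, r) \<in> double_triangle b \<Longrightarrow> K (x, r) = h / 2 + integral {0..(x + r) / 2} q / 2 +
       integral {0..x} (\<lambda>t. q t * integral {max (- t) (r - (x - t))..min t (r + (x - t))} (\<lambda>s. K (t, s))) / 2"
    and x: "x \<in> {0..b}"
  defines "\<psi> \<equiv> \<lambda>x. cos_sqrt \<mu> x + integral {-x..x} (\<lambda>r. K (x, r) * cos_sqrt \<mu> r)"
  shows "\<psi> x = cos_sqrt \<mu> x + h * sin_sqrt \<mu> x + integral {0..x} (\<lambda>t. q t * (sin_sqrt \<mu> (x - t) * \<psi> t))"
    and "continuous_on {0..b} \<psi>"
proof -
  let ?C = "cos_sqrt \<mu>" and ?S = "sin_sqrt \<mu>"
  define A where "A t = integral {-t..t} (\<lambda>s. K (t, s) * ?C s)" for t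
  have contA: "continuous_on {0..b} A"
    unfolding A_def
  proof (rule continuous_on_integral_bounds)
    show "continuous_on {(t, s). t \<in> {0..b} \<and> - t \<le> s \<and> s \<le> t} (\<lambda>(t, s). K (t, s) * ?C s)"
      unfolding case_prod_unfold
      by (intro continuous_intros continuous_on_compose2[OF K]) (auto simp: double_triangle_def)
  qed (auto intro!: continuous_intros)
  have \<psi>_eq: "\<psi> t = ?C t + A t" for t
    by (simp add: \<psi>_def A_def)
  show cont\<psi>: "continuous_on {0..b} \<psi>"
    unfolding \<psi>_eq by (intro continuous_intros contA)
  have sub: "{0..x} \<subseteq> {0..b}" and x0: "0 \<le> x" using x by auto
  have qx: "q absolutely_integrable_on {0..x}"
    by (rule absolutely_integrable_on_subinterval[OF q sub])
  have intq: "(\<lambda>t. q t * f t) integrable_on {0..x}" if "continuous_on {0..x} f" for f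
    using absolutely_integrable_scaleR_continuous[OF qx that] by (simp add: absolutely_integrable_on_def)
  define I where "I r t = integral {max (- t) (r - (x - t))..min t (r + (x - t))} (\<lambda>s. K (t, s))" for r t
  \<comment> \<open>On this rectangle the window is never empty, because |r| \<le> x. Joint
    continuity supplies both the measurability and the bound needed for the interchange.\<close>
  have contI: "continuous_on ({0..x} \<times> {-x..x}) (\<lambda>(t, r). I r t)"
  proof -
    have "continuous_on ({0..x} \<times> {-x..x})
      (\<lambda>z. integral {max (- fst z) (snd z - (x - fst z))..min (fst z) (snd z + (x - fst z))} ((\<lambda>z s. K (fst z, s)) z))"
    proof (rule continuous_on_integral_bounds)
      show "continuous_on {(z, s). z \<in> {0..x} \<times> {- x..x} \<and> max (- fst z) (snd z - (x - fst z)) \<le> s \<and>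
          s \<le> min (fst z) (snd z + (x - fst z))} (\<lambda>(z, s). K (fst z, s))"
        unfolding case_prod_unfold
        by (rule continuous_on_compose2[OF K])
           (use x in \<open>force intro!: continuous_intros simp: double_triangle_def\<close>)+
    qed (auto intro!: continuous_intros)
    then show ?thesis by (simp add: I_def case_prod_unfold)
  qed
  define G where "G t r = (if (t, r) \<in> {0..x} \<times> {-x..x} then ?C r * I r t else 0)" for t r
  have contCI: "continuous_on ({0..x} \<times> {-x..x}) (\<lambda>z. ?C (snd z) * I (snd z) (fst z))"
    using contI by (intro continuous_intros) (simp add: case_prod_unfold)
  obtain B where B: "B > 0" "\<And>z. z \<in> {0..x} \<times> {-x..x} \<Longrightarrow> norm (?C (snd z) * I (snd z) (fst z)) \<le> B"
    by (rule continuous_on_compact_norm_bound[OF _ contCI]) (auto intro: compact_Times)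
  have third: "integral {-x..x} (\<lambda>r. ?C r * integral {0..x} (\<lambda>t. q t * I r t))
      = 2 * integral {0..x} (\<lambda>t. q t * (?S (x - t) * A t))"
  proof -
    have "integral {0..x} (\<lambda>t. q t * integral {-x..x} (G t)) = integral {-x..x} (\<lambda>r. integral {0..x} (\<lambda>t. q t * G t r))"
    proof (rule integral_swap_weighted[OF qx])
      have "(\<lambda>z. indicator ({0..x} \<times> {-x..x}) z *\<^sub>R (?C (snd z) * I (snd z) (fst z))) \<in> borel_measurable borel"
        by (rule borel_measurable_continuous_on_indicator[OF _ contCI])
           (simp add: borel_closed closed_Times)
      then show "(\<lambda>(t, r). G t r) \<in> borel_measurable borel"
        by (rule back_subst[of "\<lambda>f. f \<in> borel_measurable borel"])
           (auto simp: G_def indicator_def fun_eq_iff)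
      show "\<bar>G t r\<bar> \<le> B" for t r
        using B(1) B(2)[of "(t, r)"] by (auto simp: G_def)
    qed
    moreover have "integral {0..x} (\<lambda>t. q t * integral {-x..x} (G t)) = integral {0..x} (\<lambda>t. 2 * (q t * (?S (x - t) * A t)))"
    proof (rule integral_cong)
      fix t assume t: "t \<in> {0..x}"
      have "integral {-x..x} (G t) = integral {-(t + (x - t))..t + (x - t)} (\<lambda>r. ?C r * I r t)"
        using t by (simp, intro integral_cong) (auto simp: G_def)
      also have "\<dots> = 2 * ?S (x - t) * A t"
        unfolding I_def A_def
        by (rule integral_window_cos_sqrt)
           (use t x in \<open>auto intro!: continuous_intros continuous_on_compose2[OF K] simp: double_triangle_def\<close>)
      finally show "q t * integral {-x..x} (G t) = 2 * (q t * (?S (x - t) * A t))" by simp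
    qed
    moreover have "integral {-x..x} (\<lambda>r. integral {0..x} (\<lambda>t. q t * G t r))
        = integral {-x..x} (\<lambda>r. ?C r * integral {0..x} (\<lambda>t. q t * I r t))"
    proof (rule integral_cong)
      fix r assume r: "r \<in> {-x..x}"
      have "integral {0..x} (\<lambda>t. q t * G t r) = integral {0..x} (\<lambda>t. ?C r * (q t * I r t))"
        using r by (intro integral_cong) (auto simp: G_def)
      then show "integral {0..x} (\<lambda>t. q t * G t r) = ?C r * integral {0..x} (\<lambda>t. q t * I r t)"
        by simp
    qed
    ultimately show ?thesis by simp
  qed
  have i1: "(\<lambda>r. h / 2 * ?C r) integrable_on {-x..x}"
    by (intro integrable_continuous_real continuous_intros)
  have contQ: "continuous_on {0..x} (\<lambda>u. integral {0..u} q)"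
    using qx by (intro indefinite_integral_continuous_1) (simp add: absolutely_integrable_on_def)
  have i2: "(\<lambda>r. integral {0..(x + r) / 2} q * ?C r) integrable_on {-x..x}"
    by (intro integrable_continuous_real continuous_intros continuous_on_compose2[OF contQ]) auto
  have i0: "(\<lambda>r. K (x, r) * ?C r) integrable_on {-x..x}"
    by (intro integrable_continuous_real continuous_intros continuous_on_compose2[OF K])
       (use x in \<open>auto simp: double_triangle_def\<close>)
  have dec: "?C r * integral {0..x} (\<lambda>t. q t * I r t)
      = 2 * (K (x, r) * ?C r - h / 2 * ?C r - integral {0..(x + r) / 2} q * ?C r / 2)" if "r \<in> {-x..x}" for r
    using K_eq[of x r] that x by (simp add: I_def double_triangle_def abs_le_iff field_simps)
  have "2 * integral {0..x} (\<lambda>t. q t * (?S (x - t) * A t))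
      = integral {-x..x} (\<lambda>r. 2 * (K (x, r) * ?C r - h / 2 * ?C r - integral {0..(x + r) / 2} q * ?C r / 2))"
    unfolding third[symmetric] by (rule integral_cong) (rule dec)
  also have "\<dots> = 2 * (A x - integral {-x..x} (\<lambda>r. h / 2 * ?C r)
      - integral {-x..x} (\<lambda>r. integral {0..(x + r) / 2} q * ?C r) / 2)"
    using i0 i1 i2
    by (simp add: A_def Henstock_Kurzweil_Integration.integral_diff
        Henstock_Kurzweil_Integration.integrable_diff integrable_on_divide)
  also have "integral {-x..x} (\<lambda>r. h / 2 * ?C r) = h * ?S x"
    using integral_cos_sqrt[of "-x" x \<mu>] x0 by (simp add: has_integral_iff)
  also have "integral {-x..x} (\<lambda>r. integral {0..(x + r) / 2} q * ?C r)
      = 2 * integral {0..x} (\<lambda>t. q t * (?S (x - t) * ?C t))"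
    by (rule integral_potential_cos_sqrt[OF qx x0])
  finally have "A x = h * ?S x + integral {0..x} (\<lambda>t. q t * (?S (x - t) * ?C t))
      + integral {0..x} (\<lambda>t. q t * (?S (x - t) * A t))"
    by simp
  also have "\<dots> = h * ?S x + integral {0..x} (\<lambda>t. q t * (?S (x - t) * ?C t) + q t * (?S (x - t) * A t))"
    by (subst Henstock_Kurzweil_Integration.integral_add)
       (auto intro!: intq continuous_intros continuous_on_subset[OF contA sub])
  finally show "\<psi> x = ?C x + h * ?S x + integral {0..x} (\<lambda>t. q t * (?S (x - t) * \<psi> t))"
    by (simp add: \<psi>_eq distrib_left)
qed

text \<open>A plain bound on the compact interval would not do: the factor u has to be kept, since
  \<open>norm_integral_weighted\<close> draws its gain from it.\<close>

lemma sin_sqrt_bound: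
  assumes "0 \<le> b"
  obtains B where "B > 0" "\<And>u. u \<in> {0..b} \<Longrightarrow> \<bar>sin_sqrt \<mu> u\<bar> \<le> u * B"
proof -
  have "continuous_on {0..b} (cos_sqrt \<mu>)"
    using continuous_on_cos_sqrt[OF continuous_on_id] by simp
  then obtain B where B: "B > 0" "\<And>r. r \<in> {0..b} \<Longrightarrow> norm (cos_sqrt \<mu> r) \<le> B"
    using continuous_on_compact_norm_bound[OF compact_Icc] by blast
  show thesis
  proof (rule that[OF B(1)])
    fix u assume u: "u \<in> {0..b}"
    have "sin_sqrt \<mu> u = integral {0..u} (cos_sqrt \<mu>)"
      using integral_cos_sqrt[of 0 u \<mu>] u by (simp add: has_integral_iff)
    also have "\<bar>\<dots>\<bar> \<le> (u - 0) * B"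
      using u B(2) continuous_on_cos_sqrt[OF continuous_on_id, of "{0..u}" \<mu>] by (intro abs_integral_le) auto
    finally show "\<bar>sin_sqrt \<mu> u\<bar> \<le> u * B" by simp
  qed
qed

lemma volterra_solution_unique:
  fixes y z :: "real \<Rightarrow> 'b::euclidean_space"
  assumes q: "q absolutely_integrable_on {0..b}"
    and y: "continuous_on {0..b} y"
      "\<And>x. x \<in> {0..b} \<Longrightarrow> y x = f x + integral {0..x} (\<lambda>t. q t *\<^sub>R (sin_sqrt \<mu> (x - t) *\<^sub>R y t))"
    and z: "continuous_on {0..b} z"
      "\<And>x. x \<in> {0..b} \<Longrightarrow> z x = f x + integral {0..x} (\<lambda>t. q t *\<^sub>R (sin_sqrt \<mu> (x - t) *\<^sub>R z t))"
    and x: "x \<in> {0..b}"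
  shows "y x = z x"
proof -
  obtain B where B: "B > 0" "\<And>u. u \<in> {0..b} \<Longrightarrow> \<bar>sin_sqrt \<mu> u\<bar> \<le> u * B"
    using sin_sqrt_bound[of b \<mu>] x by auto
  have qi: "(\<lambda>t. \<bar>q t\<bar>) integrable_on {0..b}"
    using q by (simp add: absolutely_integrable_on_def)
  \<comment> \<open>Here \<open>norm_integral_weighted\<close> gives the contraction factor B / N
    times the integral of |q|.\<close>
  define N where "N = 2 * B * integral {0..b} (\<lambda>t. \<bar>q t\<bar>) + 1"
  have N: "N > 0" unfolding N_def
    using Henstock_Kurzweil_Integration.integral_nonneg[OF qi] B(1) by (simp add: add_nonneg_pos)
  have "y x - z x = 0"
  proof (rule zero_if_weighted_contraction[where D = "{0..b}" and w = "\<lambda>x. exp (N * x)"])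
    fix M x assume M: "0 \<le> M" and bd: "\<And>x. x \<in> {0..b} \<Longrightarrow> norm (y x - z x) \<le> M * exp (N * x)"
      and x: "x \<in> {0..b}"
    have sub: "{0..x} \<subseteq> {0..b}" using x by auto
    have qx: "q absolutely_integrable_on {0..x}"
      by (rule absolutely_integrable_on_subinterval[OF q sub])
    have int: "(\<lambda>t. q t *\<^sub>R (sin_sqrt \<mu> (x - t) *\<^sub>R g t)) integrable_on {0..x}"
      if "continuous_on {0..b} g" for g :: "real \<Rightarrow> 'b"
    proof -
      have "continuous_on {0..x} (\<lambda>t. sin_sqrt \<mu> (x - t) *\<^sub>R g t)"
        by (intro continuous_intros continuous_on_subset[OF that sub])
      from absolutely_integrable_scaleR_continuous[OF qx this] show ?thesis
        unfolding absolutely_integrable_on_def by blast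
    qed
    have "y x - z x = integral {0..x} (\<lambda>t. q t *\<^sub>R (sin_sqrt \<mu> (x - t) *\<^sub>R (y t - z t)))"
      using y(2)[OF x] z(2)[OF x] int[OF y(1)] int[OF z(1)]
      by (simp add: scaleR_diff_right Henstock_Kurzweil_Integration.integral_diff)
    also have "norm \<dots> \<le> (B * M) * exp (N * x) / N * integral {0..b} (\<lambda>t. \<bar>q t\<bar>)"
    proof (rule norm_integral_weighted[OF q x N])
      show "continuous_on {0..x} (\<lambda>t. sin_sqrt \<mu> (x - t) *\<^sub>R (y t - z t))"
        by (intro continuous_intros continuous_on_subset[OF y(1) sub] continuous_on_subset[OF z(1) sub])
      fix t assume t: "t \<in> {0..x}"
      have "\<bar>sin_sqrt \<mu> (x - t)\<bar> * norm (y t - z t) \<le> ((x - t) * B) * (M * exp (N * t))"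
        using t x B(1) by (intro mult_mono B(2) bd) auto
      then show "norm (sin_sqrt \<mu> (x - t) *\<^sub>R (y t - z t)) \<le> (x - t) * (B * M * exp (N * t))"
        unfolding norm_scaleR by (simp only: mult_ac)
    qed (use B M in simp)
    also have "\<dots> = M * exp (N * x) * (B * integral {0..b} (\<lambda>t. \<bar>q t\<bar>) / N)"
      by simp
    also have "\<dots> \<le> M * exp (N * x) * (1 / 2)"
      using M N by (intro mult_left_mono) (auto simp: N_def field_simps)
    finally show "norm (y x - z x) \<le> M / 2 * exp (N * x)" by simp
  qed (use x in \<open>auto intro!: continuous_intros y(1) z(1)\<close>)
  then show ?thesis by simp
qed

text \<open>The order of the quantifiers is the point: one kernel serves all \<mu>, y and v. The
  Goursat kernel produces a solution of the same Volterra equation, and uniqueness identifies it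
  with y. As the cosine is even, the kernel on [-x,x] folds to K (x, r) + K (x, - r) on
  [0,x].\<close>

lemma transformation_kernel_exists:
  fixes q :: "real \<Rightarrow> real"
  assumes q: "q absolutely_integrable_on {0..b}"
  obtains K where "continuous_on (lower_triangle b) K"
    "\<And>\<mu> (y :: real \<Rightarrow> 'b::euclidean_space) v x. continuous_on {0..b} y \<Longrightarrow>
      (\<And>x. x \<in> {0..b} \<Longrightarrow> y x = (cos_sqrt \<mu> x + h * sin_sqrt \<mu> x) *\<^sub>R v +
         integral {0..x} (\<lambda>t. q t *\<^sub>R (sin_sqrt \<mu> (x - t) *\<^sub>R y t))) \<Longrightarrow>
      x \<in> {0..b} \<Longrightarrow> y x = (cos_sqrt \<mu> x + integral {0..x} (\<lambda>t. K (x, t) * cos_sqrt \<mu> t)) *\<^sub>R v"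
proof -
  obtain K where K: "continuous_on (double_triangle b) K"
    "\<And>x r. (x, r) \<in> double_triangle b \<Longrightarrow> K (x, r) = h / 2 + integral {0..(x + r) / 2} q / 2 +
       integral {0..x} (\<lambda>t. q t * integral {max (- t) (r - (x - t))..min t (r + (x - t))} (\<lambda>s. K (t, s))) / 2"
    by (rule goursat_kernel_exists[OF q]) blast
  have fold: "integral {-x..x} (\<lambda>r. K (x, r) * cos_sqrt \<mu> r) =
      integral {0..x} (\<lambda>r. (K (x, r) + K (x, - r)) * cos_sqrt \<mu> r)" if x: "x \<in> {0..b}" for x \<mu>
  proof -
    have int: "(\<lambda>r. K (x, r) * cos_sqrt \<mu> r) integrable_on {-x..x}"
      by (intro integrable_continuous_real continuous_intros continuous_on_compose2[OF K(1)])
         (use x in \<open>auto simp: double_triangle_def\<close>)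
    have i1: "(\<lambda>r. K (x, r) * cos_sqrt \<mu> r) integrable_on {0..x}"
      by (rule integrable_on_subinterval[OF int]) (use x in auto)
    have i2: "(\<lambda>r. K (x, - r) * cos_sqrt \<mu> r) integrable_on {0..x}"
      by (intro integrable_continuous_real continuous_intros continuous_on_compose2[OF K(1)])
         (use x in \<open>auto simp: double_triangle_def\<close>)
    have "integral {-x..x} (\<lambda>r. K (x, r) * cos_sqrt \<mu> r) =
        integral {-x..0} (\<lambda>r. K (x, r) * cos_sqrt \<mu> r) + integral {0..x} (\<lambda>r. K (x, r) * cos_sqrt \<mu> r)"
      using x by (intro Henstock_Kurzweil_Integration.integral_combine[symmetric] int) auto
    also have "integral {-x..0} (\<lambda>r. K (x, r) * cos_sqrt \<mu> r) = integral {0..x} (\<lambda>r. K (x, - r) * cos_sqrt \<mu> r)"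
      using Henstock_Kurzweil_Integration.integral_reflect_real[of x 0 "\<lambda>r. K (x, - r) * cos_sqrt \<mu> r"] by simp
    finally show ?thesis
      using i1 i2 by (simp add: distrib_right Henstock_Kurzweil_Integration.integral_add)
  qed
  show thesis
  proof (rule that[of "\<lambda>(x, r). K (x, r) + K (x, - r)"])
    show "continuous_on (lower_triangle b) (\<lambda>(x, r). K (x, r) + K (x, - r))"
      unfolding case_prod_unfold
      by (intro continuous_intros continuous_on_compose2[OF K(1)])
         (auto simp: lower_triangle_def double_triangle_def)
    fix \<mu> v x and y :: "real \<Rightarrow> 'b"
    assume y: "continuous_on {0..b} y"
      "\<And>x. x \<in> {0..b} \<Longrightarrow> y x = (cos_sqrt \<mu> x + h * sin_sqrt \<mu> x) *\<^sub>R v +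
         integral {0..x} (\<lambda>t. q t *\<^sub>R (sin_sqrt \<mu> (x - t) *\<^sub>R y t))" and x: "x \<in> {0..b}"
    define \<psi> where "\<psi> x = cos_sqrt \<mu> x + integral {-x..x} (\<lambda>r. K (x, r) * cos_sqrt \<mu> r)" for x
    have \<psi>: "\<psi> x = cos_sqrt \<mu> x + h * sin_sqrt \<mu> x + integral {0..x} (\<lambda>t. q t * (sin_sqrt \<mu> (x - t) * \<psi> t))"
        "continuous_on {0..b} \<psi>" if "x \<in> {0..b}" for x
      unfolding \<psi>_def by (rule goursat_kernel_volterra[OF q K(1) _ that]; rule K(2); assumption)+
    have "y x = \<psi> x *\<^sub>R v"
    proof (rule volterra_solution_unique[OF q y _ _ x])
      show "continuous_on {0..b} (\<lambda>x. \<psi> x *\<^sub>R v)"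
        using \<psi>(2)[OF x] by (intro continuous_intros)
      fix x assume x': "x \<in> {0..b}"
      have "\<psi> x *\<^sub>R v = (cos_sqrt \<mu> x + h * sin_sqrt \<mu> x) *\<^sub>R v
          + integral {0..x} (\<lambda>t. q t * (sin_sqrt \<mu> (x - t) * \<psi> t)) *\<^sub>R v"
        by (subst \<psi>(1)[OF x']) (simp add: scaleR_add_left)
      also have "integral {0..x} (\<lambda>t. q t * (sin_sqrt \<mu> (x - t) * \<psi> t)) *\<^sub>R v
          = integral {0..x} (\<lambda>t. q t *\<^sub>R (sin_sqrt \<mu> (x - t) *\<^sub>R (\<psi> t *\<^sub>R v)))"
      proof -
        have "(\<lambda>t. q t *\<^sub>R (sin_sqrt \<mu> (x - t) * \<psi> t)) absolutely_integrable_on {0..x}"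
          using x' by (intro absolutely_integrable_scaleR_continuous continuous_intros
              continuous_on_subset[OF \<psi>(2)[OF x']] absolutely_integrable_on_subinterval[OF q]) auto
        then have "(\<lambda>t. q t * (sin_sqrt \<mu> (x - t) * \<psi> t)) integrable_on {0..x}"
          by (simp add: absolutely_integrable_on_def)
        from integral_linear[OF this bounded_linear_scaleR_left[of v]] show ?thesis
          by (simp add: o_def mult.assoc)
      qed
      finally show "\<psi> x *\<^sub>R v = (cos_sqrt \<mu> x + h * sin_sqrt \<mu> x) *\<^sub>R v
          + integral {0..x} (\<lambda>t. q t *\<^sub>R (sin_sqrt \<mu> (x - t) *\<^sub>R (\<psi> t *\<^sub>R v)))" .
    qed
    then show "y x = (cos_sqrt \<mu> x + integral {0..x} (\<lambda>t. (case (x, t) of (x, r) \<Rightarrow> K (x, r) + K (x, - r)) * cos_sqrt \<mu> t)) *\<^sub>R v"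
      by (simp add: \<psi>_def fold[OF x])
  qed
qed

section \<open>The resolvent kernel\<close>

lemma borel_measurable_triangle_if:
  fixes f :: "real \<times> real \<Rightarrow> real"
  assumes "continuous_on (lower_triangle r) f"
  shows "(\<lambda>(x, t). if (x, t) \<in> lower_triangle r then f (x, t) else 0) \<in> borel_measurable borel"
proof -
  have "(\<lambda>z. indicator (lower_triangle r) z *\<^sub>R f z) \<in> borel_measurable borel"
    by (rule borel_measurable_continuous_on_indicator[OF _ assms])
       (simp add: borel_closed compact_imp_closed compact_lower_triangle)
  then show ?thesis
    by (rule back_subst[of "\<lambda>f. f \<in> borel_measurable borel"]) (auto simp: indicator_def fun_eq_iff)
qed

lemma integral_triangle_swap:
  fixes f :: "real \<times> real \<Rightarrow> real"
  assumes f: "continuous_on (lower_triangle r) f"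
  shows "integral {0..r} (\<lambda>x. integral {0..x} (\<lambda>t. f (x, t))) = integral {0..r} (\<lambda>t. integral {t..r} (\<lambda>x. f (x, t)))"
proof -
  define G where "G x t = (if (x, t) \<in> lower_triangle r then f (x, t) else 0)" for x t
  obtain B where B: "B > 0" "\<And>z. z \<in> lower_triangle r \<Longrightarrow> norm (f z) \<le> B"
    using continuous_on_compact_norm_bound[OF compact_lower_triangle f] by blast
  have "integral {0..r} (\<lambda>x. 1 * integral {0..r} (G x)) = integral {0..r} (\<lambda>t. integral {0..r} (\<lambda>x. 1 * G x t))"
  proof (rule integral_swap_weighted)
    show "(\<lambda>_. 1::real) absolutely_integrable_on {0..r}"
      by (intro absolutely_integrable_continuous_real continuous_intros)
    show "(\<lambda>(x, t). G x t) \<in> borel_measurable borel"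
      using borel_measurable_triangle_if[OF f] by (simp add: G_def)
    show "\<bar>G x t\<bar> \<le> B" for x t
      using B by (auto simp: G_def)
  qed
  moreover have "integral {0..r} (G x) = integral {0..x} (\<lambda>t. f (x, t))" if x: "x \<in> {0..r}" for x
  proof -
    have "integral {0..r} (G x) = integral {0..r} (\<lambda>t. if 0 \<le> t \<and> t \<le> x then f (x, t) else 0)"
      using x by (intro integral_cong) (auto simp: G_def lower_triangle_def)
    then show ?thesis using x by (subst (asm) integral_Icc_if) auto
  qed
  moreover have "integral {0..r} (\<lambda>x. G x t) = integral {t..r} (\<lambda>x. f (x, t))" if t: "t \<in> {0..r}" for t
  proof -
    have "integral {0..r} (\<lambda>x. G x t) = integral {0..r} (\<lambda>x. if t \<le> x \<and> x \<le> r then f (x, t) else 0)"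
      using t by (intro integral_cong) (auto simp: G_def lower_triangle_def)
    then show ?thesis using t by (subst (asm) integral_Icc_if) auto
  qed
  ultimately show ?thesis
    using integral_cong[of "{0..r}" "\<lambda>x. integral {0..r} (G x)" "\<lambda>x. integral {0..x} (\<lambda>t. f (x, t))"]
      integral_cong[of "{0..r}" "\<lambda>t. integral {0..r} (\<lambda>x. G x t)" "\<lambda>t. integral {t..r} (\<lambda>x. f (x, t))"]
    by simp
qed

lemma lower_triangle_mono: "r \<le> b \<Longrightarrow> lower_triangle r \<subseteq> lower_triangle b"
  by (auto simp: lower_triangle_def)

lemma continuous_on_triangle_row:
  assumes "continuous_on (lower_triangle b) H" "r \<le> b" "A \<subseteq> {0..r}"
  shows "continuous_on A (\<lambda>x. H (r, x))"
  by (rule continuous_on_compose2[OF assms(1)])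
     (use assms(2,3) in \<open>auto intro!: continuous_intros simp: lower_triangle_def\<close>)

lemma continuous_on_triangle_column:
  assumes "continuous_on (lower_triangle b) H" "0 \<le> x" "A \<subseteq> {x..b}"
  shows "continuous_on A (\<lambda>r. H (r, x))"
  by (rule continuous_on_compose2[OF assms(1)])
     (use assms(2,3) in \<open>auto intro!: continuous_intros simp: lower_triangle_def\<close>)

text \<open>The equation is H + K + H K = 0, that is (1 + H) (1 + K) = 1 for the Volterra operators.
  Since K is bounded by B, integrating exp (- N x) over [t,r] suffices and gives the factor B / N =
  1 / 2; the weight decreases in t because the integral runs over x \<ge> t.\<close>

lemma resolvent_kernel_exists:
  fixes K :: "real \<times> real \<Rightarrow> real"
  assumes K: "continuous_on (lower_triangle b) K"
  obtains H where "continuous_on (lower_triangle b) H"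
    "\<And>r t. (r, t) \<in> lower_triangle b \<Longrightarrow> H (r, t) = - K (r, t) - integral {t..r} (\<lambda>x. H (r, x) * K (x, t))"
proof -
  define Tr where "Tr H = (\<lambda>(r, t). - K (r, t) - integral {t..r} (\<lambda>x. H (r, x) * K (x, t)))" for H
  obtain B where B: "B > 0" "\<And>z. z \<in> lower_triangle b \<Longrightarrow> norm (K z) \<le> B"
    using continuous_on_compact_norm_bound[OF compact_lower_triangle K] by blast
  define N where "N = 2 * B"
  have N: "N > 0" using B(1) by (simp add: N_def)
  have cont: "continuous_on (lower_triangle b) (Tr H)" if H: "continuous_on (lower_triangle b) H" for H
  proof -
    have "continuous_on (lower_triangle b) (\<lambda>p. integral {snd p..fst p} ((\<lambda>p x. H (fst p, x) * K (x, snd p)) p))"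
    proof (rule continuous_on_integral_bounds)
      show "continuous_on {(p, x). p \<in> lower_triangle b \<and> snd p \<le> x \<and> x \<le> fst p} (\<lambda>(p, x). H (fst p, x) * K (x, snd p))"
        unfolding case_prod_unfold
        by (intro continuous_intros continuous_on_compose2[OF H] continuous_on_compose2[OF K])
           (auto simp: lower_triangle_def)
    qed (auto intro!: continuous_intros simp: lower_triangle_def)
    then have "continuous_on (lower_triangle b) (\<lambda>p. - K p - integral {snd p..fst p} (\<lambda>x. H (fst p, x) * K (x, snd p)))"
      by (intro continuous_intros K) simp
    then show ?thesis by (simp add: Tr_def case_prod_unfold)
  qed
  have contr: "\<bar>Tr f p - Tr g p\<bar> \<le> M / 2 * exp (- N * snd p)"
    if f: "continuous_on (lower_triangle b) f" and g: "continuous_on (lower_triangle b) g" and M: "0 \<le> M"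
      and fg: "\<And>p. p \<in> lower_triangle b \<Longrightarrow> \<bar>f p - g p\<bar> \<le> M * exp (- N * snd p)"
      and p: "p \<in> lower_triangle b" for f g M p
  proof -
    obtain r t where rt: "p = (r, t)" by fastforce
    have t: "0 \<le> t" "t \<le> r" "r \<le> b" using p rt by (auto simp: lower_triangle_def)
    have sub: "{t..r} \<subseteq> {0..r}" "{t..r} \<subseteq> {t..b}" using t by auto
    have int: "(\<lambda>x. k (r, x) * K (x, t)) integrable_on {t..r}" if "continuous_on (lower_triangle b) k" for k
      by (intro integrable_continuous_real continuous_intros continuous_on_triangle_row[OF that t(3) sub(1)]
          continuous_on_triangle_column[OF K t(1) sub(2)])
    have "Tr f p - Tr g p = integral {t..r} (\<lambda>x. g (r, x) * K (x, t) - f (r, x) * K (x, t))"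
      using int[OF f] int[OF g] by (simp add: Tr_def rt Henstock_Kurzweil_Integration.integral_diff)
    also have "norm \<dots> \<le> integral {t..r} (\<lambda>x. B * M * exp (- N * x))"
    proof (rule Henstock_Kurzweil_Integration.integral_norm_bound_integral)
      show "(\<lambda>x. g (r, x) * K (x, t) - f (r, x) * K (x, t)) integrable_on {t..r}"
        by (intro Henstock_Kurzweil_Integration.integrable_diff int f g)
      show "(\<lambda>x. B * M * exp (- N * x)) integrable_on {t..r}"
        by (intro integrable_continuous_real continuous_intros)
      fix x assume x: "x \<in> {t..r}"
      have "\<bar>f (r, x) - g (r, x)\<bar> * \<bar>K (x, t)\<bar> \<le> (M * exp (- N * x)) * B"
        using x t B(2)[of "(x, t)"] fg[of "(r, x)"] M by (intro mult_mono) (auto simp: lower_triangle_def)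
      moreover have "g (r, x) * K (x, t) - f (r, x) * K (x, t) = - ((f (r, x) - g (r, x)) * K (x, t))"
        by (simp add: algebra_simps)
      ultimately show "norm (g (r, x) * K (x, t) - f (r, x) * K (x, t)) \<le> B * M * exp (- N * x)"
        by (simp only: real_norm_def abs_minus_cancel abs_mult mult_ac)
    qed
    also have "\<dots> = B * M * ((exp (- N * r) - exp (- N * t)) / (- N))"
      using has_integral_exp_linear[of "- N" t r] N t by (simp add: has_integral_iff)
    also have "\<dots> \<le> B * M * (exp (- N * t) / N)"
      using B(1) M N by (intro mult_left_mono) (auto simp: field_simps)
    also have "\<dots> = M / 2 * exp (- N * t)"
      using B(1) by (simp add: N_def)
    finally show ?thesis by (simp add: rt)
  qed
  have w: "continuous_on (lower_triangle b) (\<lambda>p. exp (- N * snd p))"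
    by (intro continuous_intros)
  show thesis
  proof (rule weighted_contraction_fixpoint[OF compact_lower_triangle w _ cont contr])
    fix H assume H: "continuous_on (lower_triangle b) H" "\<And>p. p \<in> lower_triangle b \<Longrightarrow> H p = Tr H p"
    show thesis
    proof (rule that[OF H(1)])
      fix r t assume "(r, t) \<in> lower_triangle b"
      then show "H (r, t) = - K (r, t) - integral {t..r} (\<lambda>x. H (r, x) * K (x, t))"
        by (subst H(2)) (auto simp: Tr_def)
    qed
  qed simp
qed

text \<open>Apply 1 + H to g = (1 + K) f. Exchanging the integrals over the triangle brings out the
  composed kernel H K, which the resolvent equation replaces by - H - K, and everything but f
  cancels.\<close>

lemma resolvent_kernel_inverts:
  fixes K H :: "real \<times> real \<Rightarrow> real" and f g :: "real \<Rightarrow> real"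
  assumes K: "continuous_on (lower_triangle b) K" and H: "continuous_on (lower_triangle b) H"
    and H_eq: "\<And>r t. (r, t) \<in> lower_triangle b \<Longrightarrow> H (r, t) = - K (r, t) - integral {t..r} (\<lambda>x. H (r, x) * K (x, t))"
    and f: "continuous_on {0..b} f"
    and g: "\<And>x. x \<in> {0..b} \<Longrightarrow> g x = f x + integral {0..x} (\<lambda>t. K (x, t) * f t)"
    and r: "r \<in> {0..b}"
  shows "f r = g r + integral {0..r} (\<lambda>x. H (r, x) * g x)"
proof -
  have r': "r \<le> b" "{0..r} \<subseteq> {0..b}" using r by auto
  have fr: "continuous_on {0..r} f" by (rule continuous_on_subset[OF f r'(2)])
  have K': "continuous_on (lower_triangle r) K" by (rule continuous_on_subset[OF K lower_triangle_mono[OF r'(1)]])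
  have int1: "(\<lambda>x. H (r, x) * f x) integrable_on {0..r}"
    by (intro integrable_continuous_real continuous_intros continuous_on_triangle_row[OF H r'(1)] fr) auto
  have contKf: "continuous_on {0..r} (\<lambda>x. integral {0..x} (\<lambda>t. K (x, t) * f t))"
  proof (rule continuous_on_integral_bounds)
    show "continuous_on {(x, t). x \<in> {0..r} \<and> 0 \<le> t \<and> t \<le> x} (\<lambda>(x, t). K (x, t) * f t)"
      unfolding case_prod_unfold
      by (intro continuous_intros continuous_on_compose2[OF K'] continuous_on_compose2[OF fr])
         (auto simp: lower_triangle_def)
  qed (auto intro!: continuous_intros)
  have int2: "(\<lambda>x. H (r, x) * integral {0..x} (\<lambda>t. K (x, t) * f t)) integrable_on {0..r}"
    by (intro integrable_continuous_real continuous_intros continuous_on_triangle_row[OF H r'(1)] contKf) auto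
  have contHr: "continuous_on (lower_triangle r) (\<lambda>z. H (r, fst z))"
    by (rule continuous_on_compose2[OF continuous_on_triangle_row[OF H r'(1) order_refl]])
       (auto intro!: continuous_intros simp: lower_triangle_def)
  have "integral {0..r} (\<lambda>x. H (r, x) * g x)
      = integral {0..r} (\<lambda>x. H (r, x) * f x + H (r, x) * integral {0..x} (\<lambda>t. K (x, t) * f t))"
    using r' by (intro integral_cong) (subst g, auto simp: distrib_left)
  also have "\<dots> = integral {0..r} (\<lambda>x. H (r, x) * f x)
      + integral {0..r} (\<lambda>x. integral {0..x} (\<lambda>t. (\<lambda>(x, t). H (r, x) * K (x, t) * f t) (x, t)))"
    using int1 int2 by (simp add: Henstock_Kurzweil_Integration.integral_add mult.assoc)
  also have "integral {0..r} (\<lambda>x. integral {0..x} (\<lambda>t. (\<lambda>(x, t). H (r, x) * K (x, t) * f t) (x, t)))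
      = integral {0..r} (\<lambda>t. integral {t..r} (\<lambda>x. (\<lambda>(x, t). H (r, x) * K (x, t) * f t) (x, t)))"
  proof (rule integral_triangle_swap)
    show "continuous_on (lower_triangle r) (\<lambda>(x, t). H (r, x) * K (x, t) * f t)"
      unfolding case_prod_unfold
      by (intro continuous_intros contHr continuous_on_compose2[OF K'] continuous_on_compose2[OF fr])
         (auto simp: lower_triangle_def)
  qed
  also have "\<dots> = integral {0..r} (\<lambda>t. - (H (r, t) * f t) - K (r, t) * f t)"
  proof (rule integral_cong)
    fix t assume t: "t \<in> {0..r}"
    have "integral {t..r} (\<lambda>x. H (r, x) * K (x, t)) = - H (r, t) - K (r, t)"
      using H_eq[of r t] t r by (simp add: lower_triangle_def)
    moreover have "integral {t..r} (\<lambda>x. (\<lambda>(x, t). H (r, x) * K (x, t) * f t) (x, t))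
        = integral {t..r} (\<lambda>x. H (r, x) * K (x, t)) * f t"
      by simp
    ultimately show "integral {t..r} (\<lambda>x. (\<lambda>(x, t). H (r, x) * K (x, t) * f t) (x, t)) = - (H (r, t) * f t) - K (r, t) * f t"
      by (simp add: left_diff_distrib)
  qed
  also have "\<dots> = - integral {0..r} (\<lambda>t. H (r, t) * f t) - integral {0..r} (\<lambda>t. K (r, t) * f t)"
  proof (subst Henstock_Kurzweil_Integration.integral_diff)
    show "(\<lambda>t. - (H (r, t) * f t)) integrable_on {0..r}"
      using int1 by (rule integrable_neg)
    show "(\<lambda>t. K (r, t) * f t) integrable_on {0..r}"
      by (intro integrable_continuous_real continuous_intros continuous_on_triangle_row[OF K r'(1)] fr) auto
  qed simp
  finally show ?thesis using g[OF r] by simp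
qed

text \<open>If \<open>H\<close> is the resolvent kernel, the transform of \<open>response H s / sin \<alpha>\<close>, cut off at \<open>s\<close>, is
  \<open>sin (\<surd>\<mu> s) / \<surd>\<mu>\<close>.\<close>

definition response :: "(real \<times> real \<Rightarrow> real) \<Rightarrow> real \<Rightarrow> real \<Rightarrow> real" where
  "response H s x = 1 + integral {x..s} (\<lambda>r. H (r, x))"

lemma continuous_on_response:
  assumes H: "continuous_on (lower_triangle b) H"
  shows "continuous_on (lower_triangle b) (\<lambda>(s, x). response H s x)"
proof -
  have "continuous_on (lower_triangle b) (\<lambda>p. integral {snd p..fst p} ((\<lambda>p r. H (r, snd p)) p))"
  proof (rule continuous_on_integral_bounds)
    show "continuous_on {(p, x). p \<in> lower_triangle b \<and> snd p \<le> x \<and> x \<le> fst p} (\<lambda>(p, r). H (r, snd p))"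
      unfolding case_prod_unfold
      by (intro continuous_on_compose2[OF H] continuous_intros) (auto simp: lower_triangle_def)
  qed (auto intro!: continuous_intros simp: lower_triangle_def)
  then show ?thesis
    by (simp add: response_def case_prod_unfold continuous_on_add continuous_on_const)
qed

lemma continuous_on_response_row:
  assumes H: "continuous_on (lower_triangle b) H" and s: "s \<le> b" "A \<subseteq> {0..s}"
  shows "continuous_on A (response H s)"
  using continuous_on_triangle_row[OF continuous_on_response[OF H] s] by simp

text \<open>\<open>response H s\<close> is the adjoint of 1 + H applied to the indicator function of
  [0,s]; the identity moves 1 + H over to \<psi>.\<close>

lemma integral_response:
  fixes \<psi> :: "real \<Rightarrow> real"
  assumes H: "continuous_on (lower_triangle b) H" and \<psi>: "continuous_on {0..b} \<psi>" and s: "s \<in> {0..b}"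
  shows "integral {0..s} (\<lambda>x. response H s x * \<psi> x) = integral {0..s} (\<lambda>r. \<psi> r + integral {0..r} (\<lambda>x. H (r, x) * \<psi> x))"
proof -
  have s': "s \<le> b" "{0..s} \<subseteq> {0..b}" using s by auto
  have H': "continuous_on (lower_triangle s) H" by (rule continuous_on_subset[OF H lower_triangle_mono[OF s'(1)]])
  have \<psi>': "continuous_on {0..s} \<psi>" by (rule continuous_on_subset[OF \<psi> s'(2)])
  have cont: "continuous_on (lower_triangle s) (\<lambda>(r, x). H (r, x) * \<psi> x)"
    unfolding case_prod_unfold
    by (intro continuous_intros continuous_on_compose2[OF H'] continuous_on_compose2[OF \<psi>'])
       (auto simp: lower_triangle_def)
  have i1: "\<psi> integrable_on {0..s}"
    using \<psi>' by (rule integrable_continuous_real)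
  have i2: "(\<lambda>r. integral {0..r} (\<lambda>x. H (r, x) * \<psi> x)) integrable_on {0..s}"
  proof (intro integrable_continuous_real continuous_on_integral_bounds)
    show "continuous_on {(r, x). r \<in> {0..s} \<and> 0 \<le> x \<and> x \<le> r} (\<lambda>(r, x). H (r, x) * \<psi> x)"
      using cont by (rule continuous_on_subset) (auto simp: lower_triangle_def)
  qed (auto intro!: continuous_intros)
  have i3: "(\<lambda>x. integral {x..s} (\<lambda>r. H (r, x) * \<psi> x)) integrable_on {0..s}"
  proof (intro integrable_continuous_real continuous_on_integral_bounds)
    have "continuous_on {(x, r). x \<in> {0..s} \<and> x \<le> r \<and> r \<le> s} (\<lambda>z. (\<lambda>(r, x). H (r, x) * \<psi> x) (snd z, fst z))"
      by (rule continuous_on_compose2[OF cont]) (auto intro!: continuous_intros simp: lower_triangle_def)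
    then show "continuous_on {(x, r). x \<in> {0..s} \<and> x \<le> r \<and> r \<le> s} (\<lambda>(x, r). H (r, x) * \<psi> x)"
      by (simp add: case_prod_unfold)
  qed (auto intro!: continuous_intros)
  have "integral {0..s} (\<lambda>x. response H s x * \<psi> x) = integral {0..s} (\<lambda>x. \<psi> x + integral {x..s} (\<lambda>r. H (r, x) * \<psi> x))"
    by (simp add: response_def distrib_right)
  also have "\<dots> = integral {0..s} \<psi> + integral {0..s} (\<lambda>x. integral {x..s} (\<lambda>r. (\<lambda>(r, x). H (r, x) * \<psi> x) (r, x)))"
    using i1 i3 by (simp add: Henstock_Kurzweil_Integration.integral_add)
  also have "integral {0..s} (\<lambda>x. integral {x..s} (\<lambda>r. (\<lambda>(r, x). H (r, x) * \<psi> x) (r, x)))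
      = integral {0..s} (\<lambda>r. integral {0..r} (\<lambda>x. (\<lambda>(r, x). H (r, x) * \<psi> x) (r, x)))"
    by (rule integral_triangle_swap[OF cont, symmetric])
  also have "integral {0..s} \<psi> + \<dots> = integral {0..s} (\<lambda>r. \<psi> r + integral {0..r} (\<lambda>x. H (r, x) * \<psi> x))"
    using i1 i2 by (simp add: Henstock_Kurzweil_Integration.integral_add)
  finally show ?thesis .
qed

section \<open>Parseval's identity and the transfer function\<close>

lemma half_open_Icc_subset: "b \<in> half_open l \<Longrightarrow> {0..b} \<subseteq> half_open l"
  unfolding half_open_def by (auto intro: le_less_trans[of "ereal _" "ereal b" l])

lemma half_open_borel [measurable]: "half_open l \<in> sets borel"
  unfolding half_open_def by measurable

text \<open>Parseval's identity is stated for nonnegative integrals, which may be infinite. As the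
  left-hand side is finite here, \<tau>-integrability is a conclusion, and the identity passes to
  real integrals that can be added and subtracted.\<close>

lemma parseval_real:
  assumes parseval: "\<And>y. y \<in> L2_vanishing_near l \<Longrightarrow>
      (\<integral>\<^sup>+x\<in>half_open l. ennreal ((cmod (y x))\<^sup>2) \<partial>lebesgue) =
      (\<integral>\<^sup>+\<mu>. ennreal ((cmod (sl_transform l \<phi> y \<mu>))\<^sup>2) \<partial>\<tau>)"
    and \<tau>: "sets \<tau> = sets borel" and c: "c \<in> half_open l"
    and f: "f \<in> borel_measurable lebesgue" "\<And>x. x \<notin> {0..c} \<Longrightarrow> f x = 0"
      "integrable lebesgue (\<lambda>x. (f x)\<^sup>2)"
    and T: "T \<in> borel_measurable borel"
      "\<And>\<mu>. sl_transform l \<phi> (\<lambda>x. complex_of_real (f x)) \<mu> = complex_of_real (T \<mu>)"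
  shows "integrable \<tau> (\<lambda>\<mu>. (T \<mu>)\<^sup>2)" and "(LINT \<mu>|\<tau>. (T \<mu>)\<^sup>2) = (LINT x|lebesgue. (f x)\<^sup>2)"
proof -
  let ?y = "\<lambda>x. complex_of_real (f x)"
  have sub: "{0..c} \<subseteq> half_open l" by (rule half_open_Icc_subset[OF c])
  have nn: "(\<integral>\<^sup>+x\<in>half_open l. ennreal ((cmod (?y x))\<^sup>2) \<partial>lebesgue) = ennreal (LINT x|lebesgue. (f x)\<^sup>2)"
  proof -
    have "(\<integral>\<^sup>+x\<in>half_open l. ennreal ((cmod (?y x))\<^sup>2) \<partial>lebesgue) = (\<integral>\<^sup>+x. ennreal ((f x)\<^sup>2) \<partial>lebesgue)"
    proof (rule nn_integral_cong)
      fix x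
      have "f x = 0" if "x \<notin> half_open l"
        using f(2) sub that by blast
      then show "ennreal ((cmod (?y x))\<^sup>2) * indicator (half_open l) x = ennreal ((f x)\<^sup>2)"
        by (simp add: indicator_def)
    qed
    also have "\<dots> = ennreal (LINT x|lebesgue. (f x)\<^sup>2)"
      by (rule nn_integral_eq_integral[OF f(3)]) simp
    finally show ?thesis .
  qed
  have "(\<lambda>x. indicator (half_open l) x *\<^sub>R ?y x) \<in> borel_measurable lebesgue"
    using f(1) by (intro borel_measurable_scaleR borel_measurable_indicator borel_measurable_of_real) auto
  then have "?y \<in> L2_vanishing_near l"
    using nn c f(2) unfolding L2_vanishing_near_def set_borel_measurable_def
    by (auto intro!: bexI[of _ c])
  from parseval[OF this] have eq: "(\<integral>\<^sup>+\<mu>. ennreal ((T \<mu>)\<^sup>2) \<partial>\<tau>) = ennreal (LINT x|lebesgue. (f x)\<^sup>2)"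
    unfolding nn T(2) by simp
  have meas: "(\<lambda>\<mu>. (T \<mu>)\<^sup>2) \<in> borel_measurable \<tau>"
    using T(1) by (simp add: measurable_cong_sets[OF \<tau> refl])
  show int: "integrable \<tau> (\<lambda>\<mu>. (T \<mu>)\<^sup>2)"
    by (rule integrableI_nn_integral_finite[OF meas _ eq]) auto
  have "ennreal (LINT \<mu>|\<tau>. (T \<mu>)\<^sup>2) = ennreal (LINT x|lebesgue. (f x)\<^sup>2)"
    using nn_integral_eq_integral[OF int] eq by simp
  then show "(LINT \<mu>|\<tau>. (T \<mu>)\<^sup>2) = (LINT x|lebesgue. (f x)\<^sup>2)"
    by (subst (asm) ennreal_inj) auto
qed

lemma integrable_indicator_continuous:
  fixes g :: "real \<Rightarrow> 'b::euclidean_space"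
  assumes "continuous_on {0..s} g"
  shows "integrable lebesgue (\<lambda>x. indicator {0..s} x *\<^sub>R g x)"
    and "(LINT x|lebesgue. indicator {0..s} x *\<^sub>R g x) = integral {0..s} g"
proof -
  have *: "g absolutely_integrable_on {0..s}"
    using assms by (rule absolutely_integrable_continuous_real)
  show "integrable lebesgue (\<lambda>x. indicator {0..s} x *\<^sub>R g x)"
    using * by (simp add: set_integrable_def)
  show "(LINT x|lebesgue. indicator {0..s} x *\<^sub>R g x) = integral {0..s} g"
    using set_lebesgue_integral_eq_integral(2)[OF *] by (simp add: set_lebesgue_integral_def)
qed

text \<open>The solution is \<sigma> \<psi>, with \<sigma> = sin \<alpha> in the application, so
  dividing the response by \<sigma> removes the normalization; \<open>integral_response\<close> then
  leaves the integral of the cosine over [0,s]. The integrability statement is kept for the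
  additivity of the transform.\<close>

lemma sl_transform_response:
  assumes H: "continuous_on (lower_triangle b) H" and b: "b \<in> half_open l" and s: "s \<in> {0..b}"
    and \<psi>: "continuous_on {0..b} \<psi>"
      "\<And>r. r \<in> {0..b} \<Longrightarrow> cos_sqrt \<mu> r = \<psi> r + integral {0..r} (\<lambda>x. H (r, x) * \<psi> x)"
    and \<phi>: "\<And>x. x \<in> {0..b} \<Longrightarrow> \<phi> x (complex_of_real \<mu>) = complex_of_real (\<sigma> * \<psi> x)" and \<sigma>: "\<sigma> \<noteq> 0"
  defines "f \<equiv> \<lambda>x. indicator {0..s} x * (response H s x / \<sigma>)"
  shows "set_integrable lebesgue (half_open l) (\<lambda>x. complex_of_real (f x) * \<phi> x (complex_of_real \<mu>))"
    and "sl_transform l \<phi> (\<lambda>x. complex_of_real (f x)) \<mu> = complex_of_real (sin_sqrt \<mu> s)"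
proof -
  have s': "s \<le> b" "{0..s} \<subseteq> {0..b}" "{0..s} \<subseteq> half_open l"
    using s half_open_Icc_subset[OF b] by auto
  have cont: "continuous_on {0..s} (\<lambda>x. response H s x * \<psi> x)"
    by (intro continuous_intros continuous_on_response_row[OF H s'(1)] continuous_on_subset[OF \<psi>(1) s'(2)]) simp
  have eq: "indicator (half_open l) x *\<^sub>R (complex_of_real (f x) * \<phi> x (complex_of_real \<mu>))
      = complex_of_real (indicator {0..s} x *\<^sub>R (response H s x * \<psi> x))" for x
  proof (cases "x \<in> {0..s}")
    case True
    then have "x \<in> {0..b}" "x \<in> half_open l" using s' by auto
    then show ?thesis using True \<phi>[of x] \<sigma> by (simp add: f_def)
  next
    case False
    then have "f x = 0" by (simp add: f_def)
    then show ?thesis using False by simp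
  qed
  show "set_integrable lebesgue (half_open l) (\<lambda>x. complex_of_real (f x) * \<phi> x (complex_of_real \<mu>))"
    unfolding set_integrable_def eq by (intro integrable_of_real integrable_indicator_continuous(1) cont)
  have "sl_transform l \<phi> (\<lambda>x. complex_of_real (f x)) \<mu> = complex_of_real (integral {0..s} (\<lambda>x. response H s x * \<psi> x))"
    unfolding sl_transform_def set_lebesgue_integral_def eq integral_complex_of_real
    by (simp only: integrable_indicator_continuous(2)[OF cont])
  also have "integral {0..s} (\<lambda>x. response H s x * \<psi> x) = integral {0..s} (cos_sqrt \<mu>)"
    unfolding integral_response[OF H \<psi>(1) s] using s' by (intro integral_cong) (auto simp: \<psi>(2))
  also have "\<dots> = sin_sqrt \<mu> s"
    using integral_cos_sqrt[of 0 s \<mu>] s by (simp add: has_integral_iff)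
  finally show "sl_transform l \<phi> (\<lambda>x. complex_of_real (f x)) \<mu> = complex_of_real (sin_sqrt \<mu> s)" .
qed

text \<open>Polarization. Parseval's identity is available for norms only, so it is applied to the
  cut-off responses at s and at t and to their sum; all of them are real, hence these three suffice
  for the inner product.\<close>

lemma transfer_function_response:
  assumes parseval: "\<And>y. y \<in> L2_vanishing_near l \<Longrightarrow>
      (\<integral>\<^sup>+x\<in>half_open l. ennreal ((cmod (y x))\<^sup>2) \<partial>lebesgue) =
      (\<integral>\<^sup>+\<mu>. ennreal ((cmod (sl_transform l \<phi> y \<mu>))\<^sup>2) \<partial>\<tau>)"
    and \<tau>: "sets \<tau> = sets borel"
    and H: "continuous_on (lower_triangle b) H" and b: "b \<in> half_open l"
    and \<psi>: "\<And>\<mu>. continuous_on {0..b} (\<psi> \<mu>)"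
      "\<And>\<mu> r. r \<in> {0..b} \<Longrightarrow> cos_sqrt \<mu> r = \<psi> \<mu> r + integral {0..r} (\<lambda>x. H (r, x) * \<psi> \<mu> x)"
    and \<phi>: "\<And>\<mu> x. x \<in> {0..b} \<Longrightarrow> \<phi> x (complex_of_real \<mu>) = complex_of_real (\<sigma> * \<psi> \<mu> x)" and \<sigma>: "\<sigma> \<noteq> 0"
    and st: "0 \<le> s" "s \<le> t" "t \<le> b"
  shows "transfer_function_of \<tau> (s + t) - transfer_function_of \<tau> (t - s)
    = 2 * integral {0..s} (\<lambda>x. response H s x * response H t x) / \<sigma>\<^sup>2"
proof -
  define f where "f s x = indicator {0..s} x * (response H s x / \<sigma>)" for s x
  have contR: "continuous_on {0..u} (response H s)" if "s \<in> {0..b}" "u \<le> s" for s u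
    by (rule continuous_on_response_row[OF H]) (use that in auto)
  have meas: "f s \<in> borel_measurable lebesgue" if "s \<in> {0..b}" for s
  proof -
    have "continuous_on {0..s} (\<lambda>x. response H s x / \<sigma>)"
      using \<sigma> by (intro continuous_intros contR that order_refl) auto
    from borel_measurable_integrable[OF integrable_indicator_continuous(1)[OF this]]
    show ?thesis by (simp add: f_def [abs_def])
  qed
  have prod: "integrable lebesgue (\<lambda>x. f s x * f t x)"
    "(LINT x|lebesgue. f s x * f t x) = integral {0..s} (\<lambda>x. response H s x * response H t x) / \<sigma>\<^sup>2"
    if "s \<in> {0..b}" "t \<in> {0..b}" "s \<le> t" for s t
  proof -
    have eq: "f s x * f t x = indicator {0..s} x *\<^sub>R (response H s x * response H t x / \<sigma>\<^sup>2)" for x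
      using that by (auto simp: f_def indicator_def power2_eq_square)
    have cont: "continuous_on {0..s} (\<lambda>x. response H s x * response H t x / \<sigma>\<^sup>2)"
      using that \<sigma> by (intro continuous_intros contR) auto
    show "integrable lebesgue (\<lambda>x. f s x * f t x)"
      unfolding eq by (rule integrable_indicator_continuous(1)[OF cont])
    show "(LINT x|lebesgue. f s x * f t x) = integral {0..s} (\<lambda>x. response H s x * response H t x) / \<sigma>\<^sup>2"
      unfolding eq integrable_indicator_continuous(2)[OF cont] by simp
  qed
  have tr: "set_integrable lebesgue (half_open l) (\<lambda>x. complex_of_real (f s x) * \<phi> x (complex_of_real \<mu>))"
    "sl_transform l \<phi> (\<lambda>x. complex_of_real (f s x)) \<mu> = complex_of_real (sin_sqrt \<mu> s)" if "s \<in> {0..b}" for s \<mu>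
    unfolding f_def
    by (rule sl_transform_response[OF H b that, where \<psi> = "\<psi> \<mu>" and \<mu> = \<mu> and \<phi> = \<phi> and \<sigma> = \<sigma>];
        rule \<psi> \<phi> \<sigma>; assumption)+
  have sb: "s \<in> {0..b}" and tb: "t \<in> {0..b}" using st by auto
  have sq: "integrable \<tau> (\<lambda>\<mu>. (sin_sqrt \<mu> u)\<^sup>2)"
    "(LINT \<mu>|\<tau>. (sin_sqrt \<mu> u)\<^sup>2) = (LINT x|lebesgue. f u x * f u x)" if u: "u \<in> {0..b}" for u
  proof -
    note P = parseval_real[OF parseval \<tau> b meas[OF u] _ _ borel_measurable_sin_sqrt tr(2)[OF u]]
    have z: "f u x = 0" if "x \<notin> {0..b}" for x using that u by (auto simp: f_def)
    have i: "integrable lebesgue (\<lambda>x. (f u x)\<^sup>2)" using prod(1)[OF u u] by (simp add: power2_eq_square)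
    show "integrable \<tau> (\<lambda>\<mu>. (sin_sqrt \<mu> u)\<^sup>2)"
      by (rule P(1)[OF _ z i])
    show "(LINT \<mu>|\<tau>. (sin_sqrt \<mu> u)\<^sup>2) = (LINT x|lebesgue. f u x * f u x)"
      using P(2)[OF _ z i] by (simp add: power2_eq_square)
  qed
  have sum_sq: "integrable \<tau> (\<lambda>\<mu>. (sin_sqrt \<mu> s + sin_sqrt \<mu> t)\<^sup>2)"
    "(LINT \<mu>|\<tau>. (sin_sqrt \<mu> s + sin_sqrt \<mu> t)\<^sup>2) = (LINT x|lebesgue. (f s x + f t x)\<^sup>2)"
  proof -
    have m: "(\<lambda>x. f s x + f t x) \<in> borel_measurable lebesgue"
      using meas[OF sb] meas[OF tb] by (rule borel_measurable_add)
    have T: "sl_transform l \<phi> (\<lambda>x. complex_of_real (f s x + f t x)) \<mu> = complex_of_real (sin_sqrt \<mu> s + sin_sqrt \<mu> t)" for \<mu>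
      using set_integral_add(2)[OF tr(1)[OF sb] tr(1)[OF tb], of \<mu> \<mu>] tr(2)[OF sb, of \<mu>] tr(2)[OF tb, of \<mu>]
      by (simp add: sl_transform_def distrib_right)
    have z: "f s x + f t x = 0" if "x \<notin> {0..b}" for x using that st by (auto simp: f_def)
    have i: "integrable lebesgue (\<lambda>x. (f s x + f t x)\<^sup>2)"
    proof -
      have "(\<lambda>x. (f s x + f t x)\<^sup>2) = (\<lambda>x. f s x * f s x + f t x * f t x + 2 * (f s x * f t x))"
        by (auto simp: power2_eq_square algebra_simps)
      then show ?thesis
        using prod(1)[OF sb sb] prod(1)[OF tb tb] prod(1)[OF sb tb st(2)] by simp
    qed
    have mT: "(\<lambda>\<mu>. sin_sqrt \<mu> s + sin_sqrt \<mu> t) \<in> borel_measurable borel" by measurable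
    show "integrable \<tau> (\<lambda>\<mu>. (sin_sqrt \<mu> s + sin_sqrt \<mu> t)\<^sup>2)"
      "(LINT \<mu>|\<tau>. (sin_sqrt \<mu> s + sin_sqrt \<mu> t)\<^sup>2) = (LINT x|lebesgue. (f s x + f t x)\<^sup>2)"
      by (rule parseval_real[OF parseval \<tau> b m z i mT T]; assumption)+
  qed
  have cross: "(LINT \<mu>|\<tau>. sin_sqrt \<mu> s * sin_sqrt \<mu> t) = (LINT x|lebesgue. f s x * f t x)"
  proof -
    have "(\<lambda>\<mu>. sin_sqrt \<mu> s * sin_sqrt \<mu> t)
        = (\<lambda>\<mu>. ((sin_sqrt \<mu> s + sin_sqrt \<mu> t)\<^sup>2 - (sin_sqrt \<mu> s)\<^sup>2 - (sin_sqrt \<mu> t)\<^sup>2) / 2)"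
      by (auto simp: power2_eq_square field_simps)
    then have "(LINT \<mu>|\<tau>. sin_sqrt \<mu> s * sin_sqrt \<mu> t)
        = ((LINT x|lebesgue. (f s x + f t x)\<^sup>2) - (LINT x|lebesgue. f s x * f s x) - (LINT x|lebesgue. f t x * f t x)) / 2"
      using sum_sq sq[OF sb] sq[OF tb] by simp
    also have "(\<lambda>x. (f s x + f t x)\<^sup>2) = (\<lambda>x. f s x * f s x + f t x * f t x + 2 * (f s x * f t x))"
      by (auto simp: power2_eq_square algebra_simps)
    also have "(LINT x|lebesgue. f s x * f s x + f t x * f t x + 2 * (f s x * f t x))
        = (LINT x|lebesgue. f s x * f s x) + (LINT x|lebesgue. f t x * f t x) + 2 * (LINT x|lebesgue. f s x * f t x)"
      using prod(1)[OF sb sb] prod(1)[OF tb tb] prod(1)[OF sb tb st(2)] by simp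
    finally show ?thesis by simp
  qed
  \<comment> \<open>Both transfer integrals must exist separately before their difference can be
    merged; each kernel is twice the square of a transform already known to be square
    integrable.\<close>
  have kernel: "integrable \<tau> (transfer_kernel u)" if u: "0 \<le> u" "u \<le> 2 * b" for u
  proof -
    have "transfer_kernel u = (\<lambda>\<mu>. 2 * (sin_sqrt \<mu> (u / 2))\<^sup>2)"
      by (auto simp: power2_eq_square sin_sqrt_times_sin_sqrt)
    then show ?thesis using sq(1)[of "u / 2"] u by simp
  qed
  have "transfer_function_of \<tau> (s + t) - transfer_function_of \<tau> (t - s)
      = (LINT \<mu>|\<tau>. transfer_kernel (s + t) \<mu> - transfer_kernel (t - s) \<mu>)"
    unfolding transfer_function_of_def using st
    by (subst Bochner_Integration.integral_diff) (auto intro!: kernel)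
  also have "\<dots> = (LINT \<mu>|\<tau>. 2 * (sin_sqrt \<mu> s * sin_sqrt \<mu> t))"
  proof -
    have "transfer_kernel (s + t) \<mu> - transfer_kernel (t - s) \<mu> = 2 * (sin_sqrt \<mu> s * sin_sqrt \<mu> t)" for \<mu>
      using sin_sqrt_times_sin_sqrt[of \<mu> t s] by (simp add: add.commute mult.commute)
    then show ?thesis by (simp only:)
  qed
  also have "\<dots> = 2 * (LINT x|lebesgue. f s x * f t x)"
    by (simp add: cross)
  finally show ?thesis
    by (simp add: prod(2)[OF sb tb st(2)])
qed

text \<open>Collects what the comparison of two problems needs from each. \<phi> and the
  transformation kernel disappear from view, and \<tau> survives only in the last clause, through
  its transfer function.\<close>

lemma inverse_problem_data:
  assumes spectral: "spectral_measure l q h \<tau>" and q: "locally_integrable l q" and b: "b \<in> half_open l"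
  obtains \<alpha> H \<psi> where "0 < \<alpha>" "\<alpha> < pi" "h = cot \<alpha>" "continuous_on (lower_triangle b) H"
    "\<forall>\<mu>. continuous_on {0..b} (\<psi> \<mu>)"
    "\<forall>\<mu>. \<forall>r\<in>{0..b}. cos_sqrt \<mu> r = \<psi> \<mu> r + integral {0..r} (\<lambda>x. H (r, x) * \<psi> \<mu> x)"
    "\<exists>\<mu>. \<forall>x\<in>{0..b}. 0 < \<psi> \<mu> x"
    "\<forall>\<mu>. \<exists>y dy. sl_solution l q (complex_of_real \<mu>) y dy \<and> dy 0 = complex_of_real (cos \<alpha>) \<and>
       (\<forall>x\<in>{0..b}. y x = complex_of_real (sin \<alpha> * \<psi> \<mu> x))"
    "\<forall>s t. 0 \<le> s \<longrightarrow> s \<le> t \<longrightarrow> t \<le> b \<longrightarrow> transfer_function_of \<tau> (s + t) - transfer_function_of \<tau> (t - s)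
       = 2 * integral {0..s} (\<lambda>x. response H s x * response H t x) / (sin \<alpha>)\<^sup>2"
proof -
  obtain \<phi> where \<tau>: "sets \<tau> = sets borel" and \<phi>: "fundamental_solution l q h \<phi>"
    and parseval: "\<And>y. y \<in> L2_vanishing_near l \<Longrightarrow>
      (\<integral>\<^sup>+x\<in>half_open l. ennreal ((cmod (y x))\<^sup>2) \<partial>lebesgue) =
      (\<integral>\<^sup>+\<mu>. ennreal ((cmod (sl_transform l \<phi> y \<mu>))\<^sup>2) \<partial>\<tau>)"
    using spectral unfolding spectral_measure_def by blast
  obtain \<alpha> where \<alpha>: "0 < \<alpha>" "\<alpha> < pi" "h = cot \<alpha>"
    and sol: "\<And>z. \<exists>d\<phi>. sl_solution l q z (\<lambda>x. \<phi> x z) d\<phi> \<and>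
         \<phi> 0 z = complex_of_real (sin \<alpha>) \<and> d\<phi> 0 = complex_of_real (cos \<alpha>)"
    using \<phi> unfolding fundamental_solution_def by blast
  have sin: "sin \<alpha> > 0" using \<alpha> by (rule_tac sin_gt_zero)
  have sub: "{0..b} \<subseteq> half_open l" by (rule half_open_Icc_subset[OF b])
  have b0: "0 \<le> b" using b by (simp add: half_open_def)
  have qb: "q absolutely_integrable_on {0..b}"
    using q b by (simp add: locally_integrable_def)
  obtain K where K: "continuous_on (lower_triangle b) K"
    and K_sol: "\<And>\<mu> (y :: real \<Rightarrow> complex) v x. continuous_on {0..b} y \<Longrightarrow>
      (\<And>x. x \<in> {0..b} \<Longrightarrow> y x = (cos_sqrt \<mu> x + h * sin_sqrt \<mu> x) *\<^sub>R v +
         integral {0..x} (\<lambda>t. q t *\<^sub>R (sin_sqrt \<mu> (x - t) *\<^sub>R y t))) \<Longrightarrow>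
      x \<in> {0..b} \<Longrightarrow> y x = (cos_sqrt \<mu> x + integral {0..x} (\<lambda>t. K (x, t) * cos_sqrt \<mu> t)) *\<^sub>R v"
    by (rule transformation_kernel_exists[OF qb, where h = h and 'b = complex]) blast
  obtain H where H: "continuous_on (lower_triangle b) H"
    and H_eq: "\<And>r t. (r, t) \<in> lower_triangle b \<Longrightarrow> H (r, t) = - K (r, t) - integral {t..r} (\<lambda>x. H (r, x) * K (x, t))"
    by (rule resolvent_kernel_exists[OF K]) blast
  define \<psi> where "\<psi> \<mu> x = cos_sqrt \<mu> x + integral {0..x} (\<lambda>t. K (x, t) * cos_sqrt \<mu> t)" for \<mu> x
  have cont\<psi>: "continuous_on {0..b} (\<psi> \<mu>)" for \<mu>
    unfolding \<psi>_def
  proof (intro continuous_intros continuous_on_integral_bounds)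
    show "continuous_on {(x, t). x \<in> {0..b} \<and> 0 \<le> t \<and> t \<le> x} (\<lambda>(x, t). K (x, t) * cos_sqrt \<mu> t)"
      unfolding case_prod_unfold
      by (intro continuous_intros continuous_on_compose2[OF K]) (auto simp: lower_triangle_def)
  qed auto
  have inv\<psi>: "cos_sqrt \<mu> r = \<psi> \<mu> r + integral {0..r} (\<lambda>x. H (r, x) * \<psi> \<mu> x)" if "r \<in> {0..b}" for \<mu> r
    by (rule resolvent_kernel_inverts[OF K H H_eq _ _ that])
       (auto simp: \<psi>_def intro!: continuous_intros)
  have \<phi>_eq: "\<phi> x (complex_of_real \<mu>) = complex_of_real (sin \<alpha> * \<psi> \<mu> x)" if x: "x \<in> {0..b}" for \<mu> x
  proof -
    obtain d\<phi> where d\<phi>: "sl_solution l q (complex_of_real \<mu>) (\<lambda>x. \<phi> x (complex_of_real \<mu>)) d\<phi>"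
      "\<phi> 0 (complex_of_real \<mu>) = complex_of_real (sin \<alpha>)" "d\<phi> 0 = complex_of_real (cos \<alpha>)"
      using sol by blast
    have "\<phi> x (complex_of_real \<mu>) = \<psi> \<mu> x *\<^sub>R complex_of_real (sin \<alpha>)"
      unfolding \<psi>_def
    proof (rule K_sol[where y = "\<lambda>x. \<phi> x (complex_of_real \<mu>)", OF _ _ x])
      show "continuous_on {0..b} (\<lambda>x. \<phi> x (complex_of_real \<mu>))"
        using d\<phi>(1) b by (intro abs_continuous_on_imp_continuous_on)
          (auto simp: sl_solution_def locally_abs_continuous_def)
      fix x assume "x \<in> {0..b}"
      then have "x \<in> half_open l" using sub by auto
      from sl_solution_variation_of_constants[OF d\<phi>(1) this]
      have "integral {0..x} (\<lambda>t. sin_sqrt \<mu> (x - t) *\<^sub>R (q t *\<^sub>R \<phi> t (complex_of_real \<mu>))) = \<phi> x (complex_of_real \<mu>) -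
          (cos_sqrt \<mu> x *\<^sub>R complex_of_real (sin \<alpha>) + sin_sqrt \<mu> x *\<^sub>R complex_of_real (cos \<alpha>))"
        unfolding d\<phi>(2,3) by (rule integral_unique)
      moreover have "complex_of_real (cos \<alpha>) = h *\<^sub>R complex_of_real (sin \<alpha>)"
        using sin by (simp add: \<alpha>(3) cot_def scaleR_conv_of_real)
      ultimately show "\<phi> x (complex_of_real \<mu>) = (cos_sqrt \<mu> x + h * sin_sqrt \<mu> x) *\<^sub>R complex_of_real (sin \<alpha>) +
         integral {0..x} (\<lambda>t. q t *\<^sub>R (sin_sqrt \<mu> (x - t) *\<^sub>R \<phi> t (complex_of_real \<mu>)))"
        by (simp add: algebra_simps)
    qed
    then show ?thesis by (simp add: scaleR_conv_of_real mult.commute)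
  qed
  have pos: "\<exists>\<mu>. \<forall>x\<in>{0..b}. 0 < \<psi> \<mu> x"
  proof -
    obtain B where B: "B > 0" "\<And>z. z \<in> lower_triangle b \<Longrightarrow> norm (K z) \<le> B"
      using continuous_on_compact_norm_bound[OF compact_lower_triangle K] by blast
    \<comment> \<open>With this \<mu> cosine and sine become cosh (B x) and sinh (B x) / B. As |K|
      \<le> B, the integral term of \<psi> is at most sinh (B x), which stays below cosh (B
      x).\<close>
    define \<mu> where "\<mu> = - (B\<^sup>2)"
    have C: "cos_sqrt \<mu> x = cosh (B * x)" and S: "sin_sqrt \<mu> x = sinh (B * x) / B" for x
      using B(1) by (auto simp: \<mu>_def cos_sqrt_def sin_sqrt_def)
    have "0 < \<psi> \<mu> x" if x: "x \<in> {0..b}" for x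
    proof -
      have "norm (integral {0..x} (\<lambda>t. K (x, t) * cos_sqrt \<mu> t)) \<le> integral {0..x} (\<lambda>t. B * cos_sqrt \<mu> t)"
      proof (rule Henstock_Kurzweil_Integration.integral_norm_bound_integral)
        show "(\<lambda>t. K (x, t) * cos_sqrt \<mu> t) integrable_on {0..x}"
          using x by (intro integrable_continuous_real continuous_intros continuous_on_triangle_row[OF K]) auto
        show "(\<lambda>t. B * cos_sqrt \<mu> t) integrable_on {0..x}"
          by (intro integrable_continuous_real continuous_intros)
        fix t assume t: "t \<in> {0..x}"
        have "\<bar>K (x, t)\<bar> * cosh (B * t) \<le> B * cosh (B * t)"
          using B(2)[of "(x, t)"] t x by (intro mult_right_mono) (auto simp: lower_triangle_def)
        then show "norm (K (x, t) * cos_sqrt \<mu> t) \<le> B * cos_sqrt \<mu> t"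
          by (simp add: C abs_mult)
      qed
      also have "\<dots> = sinh (B * x)"
        using integral_cos_sqrt[of 0 x \<mu>] x B(1) by (simp add: has_integral_iff S)
      also have "\<dots> < cosh (B * x)"
        by (rule sinh_less_cosh_real)
      finally show ?thesis by (simp add: \<psi>_def C)
    qed
    then show ?thesis by blast
  qed
  have sol': "\<exists>y dy. sl_solution l q (complex_of_real \<mu>) y dy \<and> dy 0 = complex_of_real (cos \<alpha>) \<and>
       (\<forall>x\<in>{0..b}. y x = complex_of_real (sin \<alpha> * \<psi> \<mu> x))" for \<mu>
    using sol[of "complex_of_real \<mu>"] \<phi>_eq by blast
  have trans: "transfer_function_of \<tau> (s + t) - transfer_function_of \<tau> (t - s)
       = 2 * integral {0..s} (\<lambda>x. response H s x * response H t x) / (sin \<alpha>)\<^sup>2"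
    if "0 \<le> s" "s \<le> t" "t \<le> b" for s t
    by (rule transfer_function_response[OF parseval \<tau> H b cont\<psi> inv\<psi> \<phi>_eq _ that]) (use sin in auto)
  show thesis
  proof (rule that[OF \<alpha> H _ _ pos])
    show "\<forall>\<mu>. continuous_on {0..b} (\<psi> \<mu>)"
      by (intro allI cont\<psi>)
    show "\<forall>\<mu>. \<forall>r\<in>{0..b}. cos_sqrt \<mu> r = \<psi> \<mu> r + integral {0..r} (\<lambda>x. H (r, x) * \<psi> \<mu> x)"
      by (intro allI ballI inv\<psi>)
    show "\<forall>\<mu>. \<exists>y dy. sl_solution l q (complex_of_real \<mu>) y dy \<and> dy 0 = complex_of_real (cos \<alpha>) \<and>
       (\<forall>x\<in>{0..b}. y x = complex_of_real (sin \<alpha> * \<psi> \<mu> x))"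
      by (intro allI sol')
    show "\<forall>s t. 0 \<le> s \<longrightarrow> s \<le> t \<longrightarrow> t \<le> b \<longrightarrow> transfer_function_of \<tau> (s + t) - transfer_function_of \<tau> (t - s)
       = 2 * integral {0..s} (\<lambda>x. response H s x * response H t x) / (sin \<alpha>)\<^sup>2"
      by (intro allI impI trans)
  qed
qed

section \<open>Uniqueness\<close>

lemma eq_if_integrals_eq:
  fixes f g :: "real \<Rightarrow> real"
  assumes "a < b" and f: "continuous_on {a..b} f" and g: "continuous_on {a..b} g"
    and eq: "\<And>t. t \<in> {a..b} \<Longrightarrow> integral {a..t} f = integral {a..t} g"
    and x: "x \<in> {a..b}"
  shows "f x = g x"
proof (rule vector_derivative_unique_within_closed_interval[OF \<open>a < b\<close>])
  show "x \<in> cbox a b" using x by simp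
  show "((\<lambda>t. integral {a..t} f) has_vector_derivative f x) (at x within cbox a b)"
    using integral_has_vector_derivative[OF f x] by simp
  show "((\<lambda>t. integral {a..t} f) has_vector_derivative g x) (at x within cbox a b)"
    using has_vector_derivative_transform[OF x _ integral_has_vector_derivative[OF g x]] eq by auto
qed

text \<open>On [0,s] the response is 1 + O(s), so its squared norm is s + O(s^2). The limit is the
  same for every H, which isolates the constant in front of the inner products.\<close>

lemma response_energy_limit:
  assumes H: "continuous_on (lower_triangle b) H" and b: "0 < b"
  shows "((\<lambda>s. integral {0..s} (\<lambda>x. response H s x * response H s x) / s) \<longlongrightarrow> 1) (at_right 0)"
proof -
  obtain B where B: "B > 0" "\<And>z. z \<in> lower_triangle b \<Longrightarrow> norm (H z) \<le> B"
    using continuous_on_compact_norm_bound[OF compact_lower_triangle H] by blast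
  have bound: "norm (integral {0..s} (\<lambda>x. response H s x * response H s x) / s - 1) \<le> B * s * (2 + B * s)"
    if s: "s \<in> {0<..<b}" for s
  proof -
    have cont: "continuous_on {0..s} (response H s)"
      by (rule continuous_on_response_row[OF H]) (use s in auto)
    have near: "\<bar>response H s x - 1\<bar> \<le> B * s" if x: "x \<in> {0..s}" for x
    proof -
      have "\<bar>integral {x..s} (\<lambda>r. H (r, x))\<bar> \<le> (s - x) * B"
        by (rule abs_integral_le)
           (use x s B(2) in \<open>auto intro!: continuous_on_triangle_column[OF H] simp: lower_triangle_def\<close>)
      also have "\<dots> \<le> s * B" using x B(1) by (intro mult_right_mono) auto
      finally show ?thesis by (simp add: response_def mult.commute)
    qed
    have "\<bar>integral {0..s} (\<lambda>x. response H s x * response H s x - 1)\<bar> \<le> (s - 0) * (B * s * (2 + B * s))"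
    proof (rule abs_integral_le)
      fix x assume x: "x \<in> {0..s}"
      have "response H s x * response H s x - 1 = (response H s x - 1) * (2 + (response H s x - 1))"
        by (simp add: algebra_simps)
      also have "\<bar>\<dots>\<bar> = \<bar>response H s x - 1\<bar> * \<bar>2 + (response H s x - 1)\<bar>"
        by (rule abs_mult)
      also have "\<dots> \<le> (B * s) * (2 + B * s)"
        using near[OF x] B(1) s by (intro mult_mono) auto
      finally show "\<bar>response H s x * response H s x - 1\<bar> \<le> B * s * (2 + B * s)" .
    qed (use s in \<open>auto intro!: continuous_intros cont\<close>)
    moreover have "integral {0..s} (\<lambda>x. response H s x * response H s x - 1)
        = integral {0..s} (\<lambda>x. response H s x * response H s x) - s"
      using s by (subst Henstock_Kurzweil_Integration.integral_diff)
        (auto intro!: integrable_continuous_real continuous_intros cont)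
    ultimately have "\<bar>integral {0..s} (\<lambda>x. response H s x * response H s x) - s\<bar> / s \<le> B * s * (2 + B * s)"
      using s by (simp add: field_simps)
    moreover have "integral {0..s} (\<lambda>x. response H s x * response H s x) / s - 1
        = (integral {0..s} (\<lambda>x. response H s x * response H s x) - s) / s"
      using s by (simp add: field_simps)
    ultimately show ?thesis using s by (simp add: abs_divide)
  qed
  have "((\<lambda>s. B * s * (2 + B * s)) \<longlongrightarrow> B * 0 * (2 + B * 0)) (at_right 0)"
    by (intro tendsto_intros)
  then have "((\<lambda>s. integral {0..s} (\<lambda>x. response H s x * response H s x) / s - 1) \<longlongrightarrow> 0) (at_right 0)"
    by (intro Lim_null_comparison[OF eventually_at_rightI[OF bound b]]) auto
  then show ?thesis by (rule LIM_zero_cancel)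
qed

text \<open>The two derivatives of the kernel \<open>\<integral> response H s x * response H t x dx\<close> give a
  nonlinear Gelfand--Levitan equation for \<open>H\<close>; being of Volterra type, it determines \<open>H\<close>.\<close>

lemma response_gram_second_kind:
  assumes H: "continuous_on (lower_triangle b) H" and st: "0 \<le> s" "s \<le> t" "t \<le> b"
  shows "integral {0..s} (\<lambda>x. response H s x * response H t x) - integral {0..s} (\<lambda>x. response H s x * response H s x)
    = integral {s..t} (\<lambda>r. integral {0..s} (\<lambda>x. response H s x * H (r, x)))"
proof -
  have contR: "continuous_on {0..s} (response H u)" if "s \<le> u" "u \<le> b" for u
    by (rule continuous_on_response_row[OF H]) (use that in auto)
  have diff: "response H t x - response H s x = integral {s..t} (\<lambda>r. H (r, x))" if x: "x \<in> {0..s}" for x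
  proof -
    have "(\<lambda>r. H (r, x)) integrable_on {x..t}"
      by (intro integrable_continuous_real continuous_on_triangle_column[OF H]) (use x st in auto)
    then show ?thesis
      using Henstock_Kurzweil_Integration.integral_combine[of x s t "\<lambda>r. H (r, x)"] x st by (simp add: response_def)
  qed
  have "integral {0..s} (\<lambda>x. response H s x * response H t x) - integral {0..s} (\<lambda>x. response H s x * response H s x)
      = integral {0..s} (\<lambda>x. response H s x * response H t x - response H s x * response H s x)"
    using st by (intro Henstock_Kurzweil_Integration.integral_diff[symmetric] integrable_continuous_real
        continuous_intros contR) auto
  also have "\<dots> = integral {0..s} (\<lambda>x. integral {s..t} (\<lambda>r. response H s x * H (r, x)))"
    by (intro integral_cong) (simp add: diff flip: right_diff_distrib)
  also have "\<dots> = integral {s..t} (\<lambda>r. integral {0..s} (\<lambda>x. response H s x * H (r, x)))"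
  proof -
    have "continuous_on (cbox (0, s) (s, t)) (\<lambda>(x, r). response H s x * H (r, x))"
      unfolding case_prod_unfold
      by (intro continuous_intros continuous_on_compose2[OF contR[OF order_refl]] continuous_on_compose2[OF H])
         (use st in \<open>auto simp: cbox_Pair_eq lower_triangle_def\<close>)
    from integral_swap_continuous[OF this] show ?thesis by simp
  qed
  finally show ?thesis .
qed

text \<open>Differentiating the inner products in both variables leaves an equation quadratic in H.
  Both kernels are bounded, so their difference satisfies a linear Volterra inequality and must
  vanish.\<close>

lemma response_gram_determines_kernel:
  assumes H1: "continuous_on (lower_triangle b) H1" and H2: "continuous_on (lower_triangle b) H2"
    and c: "0 < c1" "0 < c2" and b: "0 < b'" "b' < b"
    and eq: "\<And>s t. 0 \<le> s \<Longrightarrow> s \<le> t \<Longrightarrow> t \<le> b \<Longrightarrow>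
      c1 * integral {0..s} (\<lambda>x. response H1 s x * response H1 t x) =
      c2 * integral {0..s} (\<lambda>x. response H2 s x * response H2 t x)"
  shows "c1 = c2" and "\<And>p. p \<in> lower_triangle b' \<Longrightarrow> H1 p = H2 p"
proof -
  have b0: "0 < b" using b by simp
  show c12: "c1 = c2"
  proof -
    have L1: "((\<lambda>s. c1 * (integral {0..s} (\<lambda>x. response H1 s x * response H1 s x) / s)) \<longlongrightarrow> c1 * 1) (at_right 0)"
      by (intro tendsto_intros response_energy_limit[OF H1 b0])
    have L2: "((\<lambda>s. c2 * (integral {0..s} (\<lambda>x. response H2 s x * response H2 s x) / s)) \<longlongrightarrow> c2 * 1) (at_right 0)"
      by (intro tendsto_intros response_energy_limit[OF H2 b0])
    have ev: "eventually (\<lambda>s. c1 * (integral {0..s} (\<lambda>x. response H1 s x * response H1 s x) / s)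
        = c2 * (integral {0..s} (\<lambda>x. response H2 s x * response H2 s x) / s)) (at_right 0)"
      by (rule eventually_at_rightI[OF _ b0]) (use eq in simp)
    from tendsto_unique[OF trivial_limit_at_right_real iffD1[OF tendsto_cong[OF ev] L1] L2]
    show ?thesis by simp
  qed
  have gram: "integral {0..s} (\<lambda>x. response H1 s x * response H1 t x) = integral {0..s} (\<lambda>x. response H2 s x * response H2 t x)"
    if "0 \<le> s" "s \<le> t" "t \<le> b" for s t
    using eq[OF that] c c12 by simp
  \<comment> \<open>The derivative in the second variable: subtracting the value at t = s leaves an
    integral over [s,t]. Since r \<le> b' < b, the interval [s,b] is nondegenerate even when s =
    r.\<close>
  have first: "integral {0..s} (\<lambda>x. response H1 s x * H1 (r, x)) = integral {0..s} (\<lambda>x. response H2 s x * H2 (r, x))"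
    if s: "0 \<le> s" "s \<le> r" "r \<le> b'" for s r
  proof (rule eq_if_integrals_eq[where a = s and b = b and x = r
        and f = "\<lambda>r. integral {0..s} (\<lambda>x. response H1 s x * H1 (r, x))"
        and g = "\<lambda>r. integral {0..s} (\<lambda>x. response H2 s x * H2 (r, x))"])
    show "s < b" using s b by simp
    have cont: "continuous_on {s..b} (\<lambda>r. integral {0..s} (\<lambda>x. response H s x * H (r, x)))"
      if H: "continuous_on (lower_triangle b) H" for H :: "real \<times> real \<Rightarrow> real"
    proof (rule continuous_on_integral_bounds)
      have "s \<le> b" using s b by simp
      then show "continuous_on {(r, x). r \<in> {s..b} \<and> 0 \<le> x \<and> x \<le> s} (\<lambda>(r, x). response H s x * H (r, x))"
        unfolding case_prod_unfold
        by (intro continuous_intros continuous_on_compose2[OF continuous_on_response_row[OF H _ order_refl]]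
            continuous_on_compose2[OF H]) (use s in \<open>auto simp: lower_triangle_def\<close>)
    qed (use s in \<open>auto intro!: continuous_intros\<close>)
    show "continuous_on {s..b} (\<lambda>r. integral {0..s} (\<lambda>x. response H1 s x * H1 (r, x)))"
      "continuous_on {s..b} (\<lambda>r. integral {0..s} (\<lambda>x. response H2 s x * H2 (r, x)))"
      using cont[OF H1] cont[OF H2] by simp_all
    fix t assume t: "t \<in> {s..b}"
    then show "integral {s..t} (\<lambda>r. integral {0..s} (\<lambda>x. response H1 s x * H1 (r, x)))
      = integral {s..t} (\<lambda>r. integral {0..s} (\<lambda>x. response H2 s x * H2 (r, x)))"
      using response_gram_second_kind[OF H1 s(1), of t] response_gram_second_kind[OF H2 s(1), of t]
        gram[OF s(1), of t] gram[OF s(1), of s] by simp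
  qed (use s b in auto)
  \<comment> \<open>The derivative in the first variable. \<open>integral_response\<close> with the
    row of H at r in the role of \<psi> writes the previous identity as an integral over [0,s], so
    that \<open>response\<close> drops out altogether.\<close>
  have second: "H1 (r, u) + integral {0..u} (\<lambda>x. H1 (u, x) * H1 (r, x)) = H2 (r, u) + integral {0..u} (\<lambda>x. H2 (u, x) * H2 (r, x))"
    if u: "0 \<le> u" "u \<le> r" "r \<le> b'" and r: "0 < r" for u r
  proof (rule eq_if_integrals_eq[where a = 0 and b = r and x = u
        and f = "\<lambda>u. H1 (r, u) + integral {0..u} (\<lambda>x. H1 (u, x) * H1 (r, x))"
        and g = "\<lambda>u. H2 (r, u) + integral {0..u} (\<lambda>x. H2 (u, x) * H2 (r, x))"])
    have rb: "r \<le> b" using u b by simp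
    have row: "continuous_on {0..r} (\<lambda>x. H (r, x))" if "continuous_on (lower_triangle b) H" for H :: "real \<times> real \<Rightarrow> real"
      by (rule continuous_on_triangle_row[OF that rb order_refl])
    have cont: "continuous_on {0..r} (\<lambda>u. H (r, u) + integral {0..u} (\<lambda>x. H (u, x) * H (r, x)))"
      if H: "continuous_on (lower_triangle b) H" for H :: "real \<times> real \<Rightarrow> real"
    proof (intro continuous_intros row H continuous_on_integral_bounds)
      show "continuous_on {(u, x). u \<in> {0..r} \<and> 0 \<le> x \<and> x \<le> u} (\<lambda>(u, x). H (u, x) * H (r, x))"
        unfolding case_prod_unfold
        by (intro continuous_intros continuous_on_compose2[OF row[OF H]] continuous_on_compose2[OF H])
           (use rb in \<open>auto simp: lower_triangle_def\<close>)
    qed auto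
    show "continuous_on {0..r} (\<lambda>u. H1 (r, u) + integral {0..u} (\<lambda>x. H1 (u, x) * H1 (r, x)))"
      "continuous_on {0..r} (\<lambda>u. H2 (r, u) + integral {0..u} (\<lambda>x. H2 (u, x) * H2 (r, x)))"
      using cont[OF H1] cont[OF H2] by simp_all
    fix s assume s: "s \<in> {0..r}"
    have resp: "integral {0..s} (\<lambda>x. response H s x * H (r, x)) = integral {0..s} (\<lambda>u. H (r, u) + integral {0..u} (\<lambda>x. H (u, x) * H (r, x)))"
      if H: "continuous_on (lower_triangle b) H" for H :: "real \<times> real \<Rightarrow> real"
      by (rule integral_response[OF continuous_on_subset[OF H lower_triangle_mono[OF rb]] row[OF H] s])
    show "integral {0..s} (\<lambda>u. H1 (r, u) + integral {0..u} (\<lambda>x. H1 (u, x) * H1 (r, x)))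
        = integral {0..s} (\<lambda>u. H2 (r, u) + integral {0..u} (\<lambda>x. H2 (u, x) * H2 (r, x)))"
      using first[of s r] s u by (simp add: resp[OF H1] resp[OF H2])
  qed (use u r in auto)
  have H1': "continuous_on (lower_triangle b') H1" and H2': "continuous_on (lower_triangle b') H2"
    using b by (auto intro!: continuous_on_subset[OF H1 lower_triangle_mono] continuous_on_subset[OF H2 lower_triangle_mono])
  have contD: "continuous_on (lower_triangle b') (\<lambda>p. H1 p - H2 p)"
    by (intro continuous_intros H1' H2')
  have corner: "H1 (0, 0) - H2 (0, 0) = 0"
  proof (rule continuous_constant_on_closure[where S = "{0<..b'}" and f = "\<lambda>r. H1 (r, 0) - H2 (r, 0)"])
    show "continuous_on (closure {0<..b'}) (\<lambda>r. H1 (r, 0) - H2 (r, 0))"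
      using b by (intro continuous_on_triangle_column[OF contD]) auto
    show "H1 (r, 0) - H2 (r, 0) = 0" if "r \<in> {0<..b'}" for r
      using second[of 0 r] that by simp
  qed (use b in auto)
  obtain B1 where B1: "B1 > 0" "\<And>z. z \<in> lower_triangle b' \<Longrightarrow> norm (H1 z) \<le> B1"
    using continuous_on_compact_norm_bound[OF compact_lower_triangle H1'] by blast
  obtain B2 where B2: "B2 > 0" "\<And>z. z \<in> lower_triangle b' \<Longrightarrow> norm (H2 z) \<le> B2"
    using continuous_on_compact_norm_bound[OF compact_lower_triangle H2'] by blast
  \<comment> \<open>In the split product difference both factors have second coordinate x, so each
    kernel difference is at most M exp (N x). Integrating over x gives the factor (B1 + B2) /
    N.\<close>
  define N where "N = 2 * (B1 + B2)"
  have N: "N > 0" using B1(1) B2(1) by (simp add: N_def)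
  fix p assume p: "p \<in> lower_triangle b'"
  have "H1 p - H2 p = 0"
  proof (rule zero_if_weighted_contraction[OF compact_lower_triangle contD _ _ _ p, where w = "\<lambda>p. exp (N * snd p)"])
    fix M p assume M: "0 \<le> M" and bd: "\<And>p. p \<in> lower_triangle b' \<Longrightarrow> norm (H1 p - H2 p) \<le> M * exp (N * snd p)"
      and p: "p \<in> lower_triangle b'"
    obtain r u where ru: "p = (r, u)" by fastforce
    have u: "0 \<le> u" "u \<le> r" "r \<le> b'" using p ru by (auto simp: lower_triangle_def)
    show "norm (H1 p - H2 p) \<le> M / 2 * exp (N * snd p)"
    proof (cases "r = 0")
      case True
      then show ?thesis using u corner M by (simp add: ru)
    next
      case False
      have row: "continuous_on {0..u} (\<lambda>x. H (v, x))"
        if "continuous_on (lower_triangle b') H" "u \<le> v" "v \<le> b'" for H v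
        by (rule continuous_on_triangle_row[OF that(1,3)]) (use that in auto)
      have ub: "u \<le> b'" using u by simp
      have i: "(\<lambda>x. H1 (u, x) * H1 (r, x)) integrable_on {0..u}" "(\<lambda>x. H2 (u, x) * H2 (r, x)) integrable_on {0..u}"
        by (intro integrable_continuous_real continuous_intros row H1' H2' u ub order_refl)+
      have "H1 p - H2 p = integral {0..u} (\<lambda>x. H2 (u, x) * H2 (r, x) - H1 (u, x) * H1 (r, x))"
        using second[OF u] False u i by (simp add: ru Henstock_Kurzweil_Integration.integral_diff)
      also have "norm \<dots> \<le> integral {0..u} (\<lambda>x. (B1 + B2) * M * exp (N * x))"
      proof (rule Henstock_Kurzweil_Integration.integral_norm_bound_integral)
        show "(\<lambda>x. H2 (u, x) * H2 (r, x) - H1 (u, x) * H1 (r, x)) integrable_on {0..u}"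
          by (intro Henstock_Kurzweil_Integration.integrable_diff i)
        show "(\<lambda>x. (B1 + B2) * M * exp (N * x)) integrable_on {0..u}"
          by (intro integrable_continuous_real continuous_intros)
        fix x assume x: "x \<in> {0..u}"
        then have mem: "(u, x) \<in> lower_triangle b'" "(r, x) \<in> lower_triangle b'"
          using u by (auto simp: lower_triangle_def)
        have "\<bar>H1 (u, x) - H2 (u, x)\<bar> * \<bar>H1 (r, x)\<bar> \<le> (M * exp (N * x)) * B1"
          using bd[OF mem(1)] B1(2)[OF mem(2)] M by (intro mult_mono) auto
        moreover have "\<bar>H2 (u, x)\<bar> * \<bar>H1 (r, x) - H2 (r, x)\<bar> \<le> B2 * (M * exp (N * x))"
          using bd[OF mem(2)] B2(2)[OF mem(1)] B2(1) M by (intro mult_mono) auto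
        moreover have "H2 (u, x) * H2 (r, x) - H1 (u, x) * H1 (r, x)
            = - ((H1 (u, x) - H2 (u, x)) * H1 (r, x) + H2 (u, x) * (H1 (r, x) - H2 (r, x)))"
          by (simp add: algebra_simps)
        then have "norm (H2 (u, x) * H2 (r, x) - H1 (u, x) * H1 (r, x))
            \<le> \<bar>H1 (u, x) - H2 (u, x)\<bar> * \<bar>H1 (r, x)\<bar> + \<bar>H2 (u, x)\<bar> * \<bar>H1 (r, x) - H2 (r, x)\<bar>"
          by (simp only: real_norm_def abs_minus_cancel abs_triangle_ineq flip: abs_mult)
        ultimately show "norm (H2 (u, x) * H2 (r, x) - H1 (u, x) * H1 (r, x)) \<le> (B1 + B2) * M * exp (N * x)"
          by (simp add: algebra_simps)
      qed
      also have "\<dots> = (B1 + B2) * M * ((exp (N * u) - exp (N * 0)) / N)"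
        using has_integral_exp_linear[of N 0 u] N u by (simp add: has_integral_iff)
      also have "\<dots> \<le> (B1 + B2) * M * (exp (N * u) / N)"
        using B1(1) B2(1) M N by (intro mult_left_mono divide_right_mono) auto
      also have "\<dots> = M / 2 * exp (N * u)"
        using N by (simp add: N_def field_simps)
      finally show ?thesis by (simp add: ru)
    qed
  qed (auto intro!: continuous_intros)
  then show "H1 p = H2 p" by simp
qed

section \<open>Recovering the solutions, the potential and the boundary constant\<close>

lemma volterra_second_kind_unique:
  assumes H: "continuous_on (lower_triangle b) H"
    and f: "continuous_on {0..b} f" and g: "continuous_on {0..b} g"
    and eq: "\<And>r. r \<in> {0..b} \<Longrightarrow> f r + integral {0..r} (\<lambda>x. H (r, x) * f x) = g r + integral {0..r} (\<lambda>x. H (r, x) * g x)"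
    and x: "x \<in> {0..b}"
  shows "f x = (g x :: real)"
proof -
  obtain B where B: "B > 0" "\<And>z. z \<in> lower_triangle b \<Longrightarrow> norm (H z) \<le> B"
    using continuous_on_compact_norm_bound[OF compact_lower_triangle H] by blast
  define N where "N = 2 * B"
  have N: "N > 0" using B(1) by (simp add: N_def)
  have "f x - g x = 0"
  proof (rule zero_if_weighted_contraction[where D = "{0..b}" and w = "\<lambda>x. exp (N * x)"
        and d = "\<lambda>x. f x - g x" and p = x])
    fix M r assume M: "0 \<le> M" and bd: "\<And>x. x \<in> {0..b} \<Longrightarrow> norm (f x - g x) \<le> M * exp (N * x)"
      and r: "r \<in> {0..b}"
    have i: "(\<lambda>x. H (r, x) * k x) integrable_on {0..r}" if "continuous_on {0..b} k" for k
      using r by (intro integrable_continuous_real continuous_intros continuous_on_triangle_row[OF H]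
          continuous_on_subset[OF that]) auto
    have "f r - g r = integral {0..r} (\<lambda>x. H (r, x) * g x - H (r, x) * f x)"
      using eq[OF r] i[OF f] i[OF g] by (simp add: Henstock_Kurzweil_Integration.integral_diff)
    also have "norm \<dots> \<le> integral {0..r} (\<lambda>x. B * M * exp (N * x))"
    proof (rule Henstock_Kurzweil_Integration.integral_norm_bound_integral)
      show "(\<lambda>x. H (r, x) * g x - H (r, x) * f x) integrable_on {0..r}"
        by (intro Henstock_Kurzweil_Integration.integrable_diff i f g)
      show "(\<lambda>x. B * M * exp (N * x)) integrable_on {0..r}"
        by (intro integrable_continuous_real continuous_intros)
      fix x assume x: "x \<in> {0..r}"
      have "\<bar>H (r, x)\<bar> * \<bar>f x - g x\<bar> \<le> B * (M * exp (N * x))"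
        using x r B bd[of x] by (intro mult_mono) (auto simp: lower_triangle_def)
      moreover have "H (r, x) * g x - H (r, x) * f x = - (H (r, x) * (f x - g x))"
        by (simp add: algebra_simps)
      ultimately show "norm (H (r, x) * g x - H (r, x) * f x) \<le> B * M * exp (N * x)"
        by (simp only: real_norm_def abs_minus_cancel abs_mult mult.assoc)
    qed
    also have "\<dots> = B * M * ((exp (N * r) - exp (N * 0)) / N)"
      using has_integral_exp_linear[of N 0 r] N r by (simp add: has_integral_iff)
    also have "\<dots> \<le> B * M * (exp (N * r) / N)"
      using B(1) M N by (intro mult_left_mono divide_right_mono) auto
    also have "\<dots> = M / 2 * exp (N * r)"
      using N by (simp add: N_def)
    finally show "norm (f r - g r) \<le> M / 2 * exp (N * r)" .
  qed (use x in \<open>auto intro!: continuous_intros f g\<close>)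
  then show ?thesis by simp
qed

text \<open>Subtracting the two equations at a point gives (q1 - q2) y1 = 0. The interval in the
  second conclusion is open because the second derivative is two-sided, so a neighbourhood on which
  the first derivatives agree is needed.\<close>

lemma sl_solution_potential_unique:
  assumes y1: "sl_solution l1 q1 z y1 dy1" and y2: "sl_solution l2 q2 z y2 dy2"
    and b: "b \<in> half_open l1" "b \<in> half_open l2" "0 < b"
    and eq: "\<And>x. x \<in> {0..b} \<Longrightarrow> y1 x = y2 x"
  shows "\<And>x. x \<in> {0..b} \<Longrightarrow> dy1 x = dy2 x"
    and "AE x in lebesgue. x \<in> {0<..<b} \<longrightarrow> y1 x \<noteq> 0 \<longrightarrow> q1 x = q2 x"
proof -
  have sub: "{0..b} \<subseteq> half_open l1" "{0..b} \<subseteq> half_open l2"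
    using half_open_Icc_subset b by auto
  show dy: "dy1 x = dy2 x" if x: "x \<in> {0..b}" for x
  proof (rule vector_derivative_unique_within_closed_interval[OF b(3)])
    show "x \<in> cbox 0 b" using x by simp
    show "(y1 has_vector_derivative dy1 x) (at x within cbox 0 b)"
      using y1 x sub by (auto simp: sl_solution_def intro!: has_vector_derivative_within_subset[OF _ sub(1)])
    have "(y2 has_vector_derivative dy2 x) (at x within {0..b})"
      using y2 x sub by (auto simp: sl_solution_def intro!: has_vector_derivative_within_subset[OF _ sub(2)])
    then show "(y1 has_vector_derivative dy2 x) (at x within cbox 0 b)"
      using has_vector_derivative_transform[OF x] eq by auto
  qed
  have "AE x in lebesgue. x \<in> half_open l1 \<longrightarrow> dy1 differentiable (at x) \<and>
       - vector_derivative dy1 (at x) + complex_of_real (q1 x) * y1 x - z * y1 x = 0"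
    using y1 by (simp add: sl_solution_def)
  moreover have "AE x in lebesgue. x \<in> half_open l2 \<longrightarrow> dy2 differentiable (at x) \<and>
       - vector_derivative dy2 (at x) + complex_of_real (q2 x) * y2 x - z * y2 x = 0"
    using y2 by (simp add: sl_solution_def)
  ultimately show "AE x in lebesgue. x \<in> {0<..<b} \<longrightarrow> y1 x \<noteq> 0 \<longrightarrow> q1 x = q2 x"
  proof eventually_elim
    case (elim x)
    show ?case
    proof (intro impI)
      assume x: "x \<in> {0<..<b}" and nz: "y1 x \<noteq> 0"
      then have xl: "x \<in> half_open l1" "x \<in> half_open l2" using sub by auto
      have "(dy1 has_vector_derivative vector_derivative dy1 (at x)) (at x)"
        using elim xl by (simp add: vector_derivative_works)
      then have "(dy2 has_vector_derivative vector_derivative dy1 (at x)) (at x)"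
        by (rule has_vector_derivative_transform_within_open[OF _ open_greaterThanLessThan x]) (use dy in auto)
      then have "vector_derivative dy2 (at x) = vector_derivative dy1 (at x)"
        by (rule vector_derivative_at)
      then have "complex_of_real (q1 x) * y1 x = complex_of_real (q2 x) * y1 x"
        using elim xl eq[of x] x by (auto simp: algebra_simps)
      then show "q1 x = q2 x" using nz by simp
    qed
  qed
qed

lemma local_uniqueness:
  assumes spec1: "spectral_measure l1 q1 h1 \<tau>1" and q1: "locally_integrable l1 q1"
    and spec2: "spectral_measure l2 q2 h2 \<tau>2" and q2: "locally_integrable l2 q2"
    and b: "b \<in> half_open l1" "b \<in> half_open l2"
    and eq: "\<And>t. 0 \<le> t \<Longrightarrow> t \<le> 2 * b \<Longrightarrow> transfer_function_of \<tau>1 t = transfer_function_of \<tau>2 t"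
    and b': "0 < b'" "b' < b"
  shows "AE x in lebesgue. x \<in> {0<..<b'} \<longrightarrow> q1 x = q2 x" and "h1 = h2"
proof -
  obtain \<alpha>1 H1 \<psi>1 where \<alpha>1: "0 < \<alpha>1" "\<alpha>1 < pi" "h1 = cot \<alpha>1" and H1: "continuous_on (lower_triangle b) H1"
    and \<psi>1: "\<forall>\<mu>. continuous_on {0..b} (\<psi>1 \<mu>)"
      "\<forall>\<mu>. \<forall>r\<in>{0..b}. cos_sqrt \<mu> r = \<psi>1 \<mu> r + integral {0..r} (\<lambda>x. H1 (r, x) * \<psi>1 \<mu> x)"
    and pos1: "\<exists>\<mu>. \<forall>x\<in>{0..b}. 0 < \<psi>1 \<mu> x"
    and sol1: "\<forall>\<mu>. \<exists>y dy. sl_solution l1 q1 (complex_of_real \<mu>) y dy \<and> dy 0 = complex_of_real (cos \<alpha>1) \<and>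
       (\<forall>x\<in>{0..b}. y x = complex_of_real (sin \<alpha>1 * \<psi>1 \<mu> x))"
    and trans1: "\<forall>s t. 0 \<le> s \<longrightarrow> s \<le> t \<longrightarrow> t \<le> b \<longrightarrow> transfer_function_of \<tau>1 (s + t) - transfer_function_of \<tau>1 (t - s)
       = 2 * integral {0..s} (\<lambda>x. response H1 s x * response H1 t x) / (sin \<alpha>1)\<^sup>2"
    by (rule inverse_problem_data[OF spec1 q1 b(1)]) (rule that; assumption)
  obtain \<alpha>2 H2 \<psi>2 where \<alpha>2: "0 < \<alpha>2" "\<alpha>2 < pi" "h2 = cot \<alpha>2" and H2: "continuous_on (lower_triangle b) H2"
    and \<psi>2: "\<forall>\<mu>. continuous_on {0..b} (\<psi>2 \<mu>)"
      "\<forall>\<mu>. \<forall>r\<in>{0..b}. cos_sqrt \<mu> r = \<psi>2 \<mu> r + integral {0..r} (\<lambda>x. H2 (r, x) * \<psi>2 \<mu> x)"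
    and pos2: "\<exists>\<mu>. \<forall>x\<in>{0..b}. 0 < \<psi>2 \<mu> x"
    and sol2: "\<forall>\<mu>. \<exists>y dy. sl_solution l2 q2 (complex_of_real \<mu>) y dy \<and> dy 0 = complex_of_real (cos \<alpha>2) \<and>
       (\<forall>x\<in>{0..b}. y x = complex_of_real (sin \<alpha>2 * \<psi>2 \<mu> x))"
    and trans2: "\<forall>s t. 0 \<le> s \<longrightarrow> s \<le> t \<longrightarrow> t \<le> b \<longrightarrow> transfer_function_of \<tau>2 (s + t) - transfer_function_of \<tau>2 (t - s)
       = 2 * integral {0..s} (\<lambda>x. response H2 s x * response H2 t x) / (sin \<alpha>2)\<^sup>2"
    by (rule inverse_problem_data[OF spec2 q2 b(2)]) (rule that; assumption)
  have sin: "0 < sin \<alpha>1" "0 < sin \<alpha>2"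
    using \<alpha>1 \<alpha>2 by (auto intro: sin_gt_zero)
  have gram: "1 / (sin \<alpha>1)\<^sup>2 * integral {0..s} (\<lambda>x. response H1 s x * response H1 t x)
      = 1 / (sin \<alpha>2)\<^sup>2 * integral {0..s} (\<lambda>x. response H2 s x * response H2 t x)"
    if "0 \<le> s" "s \<le> t" "t \<le> b" for s t
    using trans1[rule_format, OF that] trans2[rule_format, OF that] eq[of "s + t"] eq[of "t - s"] that by simp
  note unique = response_gram_determines_kernel[OF H1 H2 _ _ b' gram]
  have "1 / (sin \<alpha>1)\<^sup>2 = 1 / (sin \<alpha>2)\<^sup>2"
    by (rule unique(1)) (use sin in auto)
  then have sin_eq: "sin \<alpha>1 = sin \<alpha>2"
    using sin by (simp add: power2_eq_iff_nonneg)
  have H_eq: "H1 p = H2 p" if "p \<in> lower_triangle b'" for p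
    by (rule unique(2)[OF _ _ _ _ _ that]) (use sin in auto)
  have bb: "b' \<le> b" "{0..b'} \<subseteq> {0..b}" using b' by auto
  \<comment> \<open>With equal kernels both functions solve the same Volterra equation, whose
    right-hand side \<open>cos_sqrt \<mu>\<close> does not depend on the problem.\<close>
  have \<psi>_eq: "\<psi>1 \<mu> x = \<psi>2 \<mu> x" if x: "x \<in> {0..b'}" for \<mu> x
  proof (rule volterra_second_kind_unique[OF _ _ _ _ x])
    show "continuous_on (lower_triangle b') H1"
      by (rule continuous_on_subset[OF H1 lower_triangle_mono[OF bb(1)]])
    show "continuous_on {0..b'} (\<psi>1 \<mu>)" "continuous_on {0..b'} (\<psi>2 \<mu>)"
      by (rule continuous_on_subset[OF \<psi>1(1)[rule_format] bb(2)] continuous_on_subset[OF \<psi>2(1)[rule_format] bb(2)])+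
    fix r assume r: "r \<in> {0..b'}"
    have "integral {0..r} (\<lambda>x. H2 (r, x) * \<psi>2 \<mu> x) = integral {0..r} (\<lambda>x. H1 (r, x) * \<psi>2 \<mu> x)"
      using r H_eq by (intro integral_cong) (auto simp: lower_triangle_def)
    then show "\<psi>1 \<mu> r + integral {0..r} (\<lambda>x. H1 (r, x) * \<psi>1 \<mu> x) = \<psi>2 \<mu> r + integral {0..r} (\<lambda>x. H1 (r, x) * \<psi>2 \<mu> x)"
      using \<psi>1(2)[rule_format, of r \<mu>] \<psi>2(2)[rule_format, of r \<mu>] r bb by auto
  qed
  \<comment> \<open>A single spectral parameter is enough, provided its solution has no zeros: then
    the equation can be divided by it at almost every point.\<close>
  obtain \<mu> where \<mu>: "\<And>x. x \<in> {0..b} \<Longrightarrow> 0 < \<psi>1 \<mu> x" using pos1 by blast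
  obtain y1 dy1 where y1: "sl_solution l1 q1 (complex_of_real \<mu>) y1 dy1" "dy1 0 = complex_of_real (cos \<alpha>1)"
    "\<And>x. x \<in> {0..b} \<Longrightarrow> y1 x = complex_of_real (sin \<alpha>1 * \<psi>1 \<mu> x)" using sol1 by blast
  obtain y2 dy2 where y2: "sl_solution l2 q2 (complex_of_real \<mu>) y2 dy2" "dy2 0 = complex_of_real (cos \<alpha>2)"
    "\<And>x. x \<in> {0..b} \<Longrightarrow> y2 x = complex_of_real (sin \<alpha>2 * \<psi>2 \<mu> x)" using sol2 by blast
  have b'l: "b' \<in> half_open l1" "b' \<in> half_open l2"
    using half_open_Icc_subset[OF b(1)] half_open_Icc_subset[OF b(2)] b' by auto
  have y_eq: "y1 x = y2 x" if "x \<in> {0..b'}" for x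
    using y1(3)[of x] y2(3)[of x] \<psi>_eq[OF that] that bb sin_eq by auto
  note pot = sl_solution_potential_unique[OF y1(1) y2(1) b'l b'(1) y_eq]
  have "dy1 0 = dy2 0" by (rule pot(1)) (use b' in auto)
  then have "cos \<alpha>1 = cos \<alpha>2" using y1(2) y2(2) by simp
  then show "h1 = h2" using sin_eq \<alpha>1(3) \<alpha>2(3) by (simp add: cot_def)
  have nz: "y1 x \<noteq> 0" if "x \<in> {0<..<b'}" for x
    using y1(3)[of x] \<mu>[of x] sin that b' by auto
  show "AE x in lebesgue. x \<in> {0<..<b'} \<longrightarrow> q1 x = q2 x"
  proof -
    have "AE x in lebesgue. x \<in> {0<..<b'} \<longrightarrow> y1 x \<noteq> 0 \<longrightarrow> q1 x = q2 x"
      by (rule pot(2))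
    then show ?thesis by eventually_elim (use nz in auto)
  qed
qed

lemma half_open_double:
  assumes "0 \<le> t" "t \<le> 2 * b" "ereal b < l"
  shows "t \<in> half_open (2 * l)"
proof -
  have "ereal t \<le> 2 * ereal b" using assms(2) by simp
  also have "\<dots> < 2 * l" using assms(3) by (cases l) auto
  finally show ?thesis using assms(1) by (simp add: half_open_def)
qed

theorem theorem2p1:
  fixes l1 l2 a :: ereal and q1 q2 :: "real \<Rightarrow> real" and h1 h2 :: real
    and \<Phi>1 \<Phi>2 :: "real \<Rightarrow> real"
  assumes "0 < l1" and "0 < l2"
    and "locally_integrable l1 q1" and "locally_integrable l2 q2"
    and "is_transfer_function l1 q1 h1 \<Phi>1" and "is_transfer_function l2 q2 h2 \<Phi>2"
    and "0 < a" and "a \<le> min l1 l2"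
    and "\<forall>t\<in>half_open (2 * a). \<Phi>1 t = \<Phi>2 t"
  shows "(AE x in lebesgue. x \<in> half_open a \<longrightarrow> q1 x = q2 x) \<and> h1 = h2"
proof -
  obtain \<tau>1 where \<tau>1: "spectral_measure l1 q1 h1 \<tau>1" "\<forall>t\<in>half_open (2 * l1). \<Phi>1 t = transfer_function_of \<tau>1 t"
    using assms(5) unfolding is_transfer_function_def by blast
  obtain \<tau>2 where \<tau>2: "spectral_measure l2 q2 h2 \<tau>2" "\<forall>t\<in>half_open (2 * l2). \<Phi>2 t = transfer_function_of \<tau>2 t"
    using assms(6) unfolding is_transfer_function_def by blast
  have local: "(AE x in lebesgue. x \<in> {0<..<b'} \<longrightarrow> q1 x = q2 x) \<and> h1 = h2" if b': "0 < b'" "ereal b' < a" for b'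
  proof -
    \<comment> \<open>The intermediate b supplies the strict inequality b' < b, while b < a keeps
      the closed interval [0,2b] inside [0,2a), where the transfer functions agree.\<close>
    obtain b where b: "b' < b" "ereal b < a"
      using ereal_dense2[OF b'(2)] by auto
    have bl: "ereal b < l1" "ereal b < l2"
      using b(2) assms(8) by (auto intro: less_le_trans)
    have bh: "b \<in> half_open l1" "b \<in> half_open l2"
      using bl b b' by (auto simp: half_open_def)
    have "transfer_function_of \<tau>1 t = transfer_function_of \<tau>2 t" if "0 \<le> t" "t \<le> 2 * b" for t
      using \<tau>1(2) \<tau>2(2) assms(9) half_open_double[OF that bl(1)] half_open_double[OF that bl(2)]
        half_open_double[OF that b(2)] by metis
    from local_uniqueness[OF \<tau>1(1) assms(3) \<tau>2(1) assms(4) bh this b'(1) b(1)]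
    show ?thesis by simp
  qed
  have "h1 = h2"
  proof -
    obtain b' where "0 < b'" "ereal b' < a" using ereal_dense2[OF assms(7)] by auto
    then show ?thesis using local by blast
  qed
  \<comment> \<open>The exceptional null set depends on the interval; rational end points leave only
    countably many of them, and the intervals still exhaust (0,a), also for infinite a.\<close>
  moreover have "AE x in lebesgue. \<forall>r::rat. 0 < real_of_rat r \<and> ereal (real_of_rat r) < a \<longrightarrow>
      x \<in> {0<..<real_of_rat r} \<longrightarrow> q1 x = q2 x"
    unfolding AE_all_countable
  proof
    fix r :: rat
    show "AE x in lebesgue. 0 < real_of_rat r \<and> ereal (real_of_rat r) < a \<longrightarrow>
      x \<in> {0<..<real_of_rat r} \<longrightarrow> q1 x = q2 x"
      using local[of "real_of_rat r"] by (cases "0 < real_of_rat r \<and> ereal (real_of_rat r) < a") auto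
  qed
  \<comment> \<open>All these intervals are open at 0, so the point 0 of [0,a) is discarded as a
    null set.\<close>
  moreover have "AE x in lebesgue. x \<noteq> (0::real)"
    by (rule AE_completion[OF AE_lborel_singleton])
  ultimately show ?thesis
  proof (intro conjI)
    assume ae: "AE x in lebesgue. \<forall>r::rat. 0 < real_of_rat r \<and> ereal (real_of_rat r) < a \<longrightarrow>
      x \<in> {0<..<real_of_rat r} \<longrightarrow> q1 x = q2 x" and nz: "AE x in lebesgue. x \<noteq> (0::real)"
    show "AE x in lebesgue. x \<in> half_open a \<longrightarrow> q1 x = q2 x"
      using ae nz
    proof eventually_elim
      case (elim x)
      show ?case
      proof
        assume x: "x \<in> half_open a"
        then obtain z where z: "x < z" "ereal z < a"
          using ereal_dense2[of "ereal x" a] by (auto simp: half_open_def)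
        obtain r where r: "x < real_of_rat r" "real_of_rat r < z"
          using of_rat_dense[OF z(1)] by blast
        have "ereal (real_of_rat r) < a" using r(2) z(2) by (meson ereal_less_le less_imp_le order.strict_trans less_ereal.simps(1))
        moreover have "0 < x" using elim(2) x by (simp add: half_open_def)
        moreover have "0 < real_of_rat r" using \<open>0 < x\<close> r(1) by linarith
        ultimately show "q1 x = q2 x"
          using elim(1) r(1) by simp
      qed
    qed
  qed
qed

end
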